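(* Let $n\ge 2$, let $M$ be a connected $n$-dimensional manifold, let $\Psi\colon M\to(\widetilde M^{n+2},\widetilde g)$ be a spacelike immersion into an $(n+2)$-dimensional Lorentzian manifold with induced metric $g=\Psi^*\widetilde g$, and let $\xi\in\mathfrak X^\perp(M)$ be a lightlike normal vector field that is an umbilical direction, $A_\xi=\lambda\cdot\mathrm{Id}$, with $\lambda\in C^\infty(M)$, $\lambda>0$. Let $(\mathcal T,\mathcal T^1,\widetilde g,\widetilde\nabla)$ be the associated tractor to the pair $(\Psi,\xi)$, and assume there is a lightlike normal vector field $\eta\in\mathfrak X^\perp(M)$ such that $\widetilde g(\xi,\eta)=-1$. Let $\omega$ be the one-form on $M$ with $\nabla^\perp\xi=\omega\otimes\xi$. Then the tractor connection $\widetilde\nabla$ is normal if and only if $\omega=\frac1\lambda d\lambda$ and, for every $X,Y\in\mathfrak X(M)$, the Ricci tensor of $g$ satisfies $$\mathrm{Ric}(X,Y)=\frac n2\|\mathbf H\|^2\,g(X,Y)-(n-2)\,\widetilde g(\mathbf H,\xi)\,g(X,A_\eta Y),$$ where $\mathbf H$ is the mean curvature vector field of $\Psi$ and $\|\mathbf H\|^2=\widetilde g(\mathbf H,\mathbf H)$.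
   Context: An immersion $\Psi\colon M^n\to(\widetilde M^{n+2},\widetilde g)$ into a Lorentzian manifold is spacelike if $g=\Psi^*\widetilde g$ is Riemannian. $\mathfrak X^\perp(M)$ denotes the normal vector fields along $\Psi$; a normal field is lightlike if it is nowhere zero and has zero $\widetilde g$-square. $\widetilde\nabla$ denotes the Levi-Civita connection of $\widetilde g$ and also the induced (pull-back) connection on $\Psi^*(T\widetilde M)$; $\nabla$ is the Levi-Civita connection of $g$, $\nabla^\perp$ the normal connection. The Gauss and Weingarten formulas are $\widetilde\nabla_XY=\nabla_XY+\mathrm{II}(X,Y)$ and $\widetilde\nabla_X\zeta=-A_\zeta X+\nabla^\perp_X\zeta$ for $X,Y\in\mathfrak X(M)$, $\zeta\in\mathfrak X^\perp(M)$, so $g(A_\zeta X,Y)=\widetilde g(\mathrm{II}(X,Y),\zeta)$. The mean curvature vector field is $\mathbf H=\frac1n\mathrm{trace}_g\mathrm{II}$. As the codimension is two and $\xi$ is lightlike, there is a unique one-form $\omega$ with $\nabla^\perp\xi=\omega\otimes\xi$. Curvature convention: $R(X,Y)Z=\nabla_X\nabla_YZ-\nabla_Y\nabla_XZ-\nabla_{[X,Y]}Z$ (likewise for other connections), and $\mathrm{Ric}(X,Y)=\sum_i g(R(E_i,X)Y,E_i)$ for a local $g$-orthonormal frame. A tractor conformal bundle on $M$ is a rank $n+2$ real vector bundle $\mathcal T\to M$ with a bundle metric $h$ of signature $(n+1,1)$ and a lightlike line subbundle $\mathcal T^1$. A tractor connection is a linear connection $\nabla^{\mathcal T}$ with $\nabla^{\mathcal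 T}h=0$ such that for nonvanishing local sections $\sigma$ of $\mathcal T^1$ the map $\beta_\sigma\colon TM\to(\mathcal T^1)^\perp/\mathcal T^1$, $\beta_\sigma(X)=\nabla^{\mathcal T}_X\sigma+\mathcal T^1$, is a vector bundle isomorphism. Then $h^\sigma(X,Y)=h(\beta_\sigma(X),\beta_\sigma(Y))$ is a Riemannian metric whose conformal class does not depend on $\sigma$; the tractor bundle with connection is called standard for a conformal structure $c$ if this class is $c$. The associated tractor to $(\Psi,\xi)$ (when $A_\xi^2=\lambda^2\,\mathrm{Id}$ with $\lambda$ non-vanishing, in particular when $A_\xi=\lambda\,\mathrm{Id}$ with $\lambda>0$) is $\mathcal T=\Psi^*(T\widetilde M)$ with bundle metric $\widetilde g$, $\mathcal T^1=\mathrm{Span}(\xi)$ and the induced connection $\widetilde\nabla$; it is a standard tractor conformal bundle with tractor connection for the conformal class of $g$. Normality: a tractor connection $\nabla^{\mathcal T}$ with curvature $R^{\mathcal T}$ is normal if (i) $R^{\mathcal T}(X,Y)\sigma\in\Gamma(\mathcal T^1)$ for all $X,Y\in\mathfrak X(M)$, $\sigma\in\Gamma(\mathcal T^1)$, so that $R^{\mathcal T}(X,Y)$ induces an endomorphism of $(\mathcal T^1)^\perp/\mathcal T^1$; and (ii) $\sum_{i=1}^n h\big(R^{\mathcal T}(E_i,X)\beta_\sigma(Y),\beta_\sigma(E_i)\big)=0$ for all $X,Y\in\mathfrak X(M)$, where $(E_1,\dots,E_n)$ is a local orthonormal frame for $h^\sigma$ (independent of the choice of $\sigma$). These conditions are used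 as the meaning of normality for all $n\ge 2$. *)

theory Defs
  imports "HOL-Analysis.Analysis"
begin

section \<open>Smooth functions between Euclidean spaces\<close>

text \<open>
  The set \<open>S\<close> is always an open set below; a map is \<open>C\<^sup>k\<^sup>+\<^sup>1\<close> if it is differentiable and all its
  directional derivatives are \<open>C\<^sup>k\<close>.
\<close>

primrec Ck_on :: "nat \<Rightarrow> 'a::euclidean_space set \<Rightarrow> ('a \<Rightarrow> 'b::real_normed_vector) \<Rightarrow> bool" where
  "Ck_on 0 S f \<longleftrightarrow> continuous_on S f"
| "Ck_on (Suc k) S f \<longleftrightarrow>
     (\<forall>x\<in>S. f differentiable (at x)) \<and> (\<forall>v. Ck_on k S (\<lambda>x. frechet_derivative f (at x) v))"

definition smooth_on :: "'a::euclidean_space set \<Rightarrow> ('a \<Rightarrow> 'b::real_normed_vector) \<Rightarrow> bool" where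
  "smooth_on S f \<longleftrightarrow> (\<forall>k. Ck_on k S f)"

section \<open>Manifolds\<close>

text \<open>
  A manifold is a (Hausdorff, second countable) topological type \<open>'m\<close> together with a smooth atlas
  of charts into a Euclidean space \<open>'e\<close>; its dimension is \<open>DIM('e)\<close>. A chart is a pair of its
  domain and its coordinate map (whose values outside the domain are irrelevant).
\<close>

type_synonym ('m, 'e) chart = "'m set \<times> ('m \<Rightarrow> 'e)"

definition chart_inv :: "('m, 'e) chart \<Rightarrow> 'e \<Rightarrow> 'm" where
  "chart_inv c = inv_into (fst c) (snd c)"

definition transition :: "('m, 'e) chart \<Rightarrow> ('m, 'e) chart \<Rightarrow> 'e \<Rightarrow> 'e" where
  "transition c d = snd d \<circ> chart_inv c"

definition smooth_atlas ::
    "('m::{t2_space,second_countable_topology}, 'e::euclidean_space) chart set \<Rightarrow> bool" where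
  "smooth_atlas \<A> \<longleftrightarrow>
     (\<Union>c\<in>\<A>. fst c) = UNIV \<and>
     (\<forall>c\<in>\<A>. open (fst c) \<and> open (snd c ` fst c) \<and>
        homeomorphism (fst c) (snd c ` fst c) (snd c) (chart_inv c)) \<and>
     (\<forall>c\<in>\<A>. \<forall>d\<in>\<A>. smooth_on (snd c ` (fst c \<inter> fst d)) (transition c d))"

text \<open>
  Every point gets a preferred chart, and the tangent space at \<open>p\<close> is the vector space \<open>'e\<close>, a
  vector \<open>v\<close> being the tangent vector at \<open>p\<close> whose components in the preferred chart of \<open>p\<close> are
  \<open>v\<close>. Its components in any other chart \<open>c\<close> around \<open>p\<close> are \<open>tcomp \<A> c p v\<close>. Vector fields are
  thus functions \<open>'m \<Rightarrow> 'e\<close>; since the preferred charts jump from point to point, smoothness is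
  always tested on the components in a fixed chart.
\<close>

definition chart_at :: "('m, 'e) chart set \<Rightarrow> 'm \<Rightarrow> ('m, 'e) chart" where
  "chart_at \<A> p = (SOME c. c \<in> \<A> \<and> p \<in> fst c)"

definition tcomp :: "('m, 'e::euclidean_space) chart set \<Rightarrow> ('m, 'e) chart \<Rightarrow> 'm \<Rightarrow> 'e \<Rightarrow> 'e" where
  "tcomp \<A> c p v =
     frechet_derivative (transition (chart_at \<A> p) c) (at (snd (chart_at \<A> p) p)) v"

definition smooth_fun ::
    "('m, 'e::euclidean_space) chart set \<Rightarrow> 'm set \<Rightarrow> ('m \<Rightarrow> 'b::real_normed_vector) \<Rightarrow> bool" where
  "smooth_fun \<A> U f \<longleftrightarrow> (\<forall>c\<in>\<A>. smooth_on (snd c ` (U \<inter> fst c)) (f \<circ> chart_inv c))"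

definition smooth_map ::
    "('m::topological_space, 'e::euclidean_space) chart set \<Rightarrow>
     ('w::topological_space, 'f::euclidean_space) chart set \<Rightarrow> ('m \<Rightarrow> 'w) \<Rightarrow> bool" where
  "smooth_map \<A> \<B> F \<longleftrightarrow>
     continuous_on UNIV F \<and> (\<forall>d\<in>\<B>. smooth_fun \<A> (F -` fst d) (snd d \<circ> F))"

definition tangent_map ::
    "('m, 'e::euclidean_space) chart set \<Rightarrow> ('w, 'f::euclidean_space) chart set \<Rightarrow>
     ('m \<Rightarrow> 'w) \<Rightarrow> 'm \<Rightarrow> 'e \<Rightarrow> 'f" where
  "tangent_map \<A> \<B> F p v =
     frechet_derivative (snd (chart_at \<B> (F p)) \<circ> F \<circ> chart_inv (chart_at \<A> p))
       (at (snd (chart_at \<A> p) p)) v"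

definition differential ::
    "('m, 'e::euclidean_space) chart set \<Rightarrow> ('m \<Rightarrow> real) \<Rightarrow> 'm \<Rightarrow> 'e \<Rightarrow> real" where
  "differential \<A> f p v =
     frechet_derivative (f \<circ> chart_inv (chart_at \<A> p)) (at (snd (chart_at \<A> p) p)) v"

definition fields_along ::
    "('m, 'e::euclidean_space) chart set \<Rightarrow> ('w, 'f::euclidean_space) chart set \<Rightarrow>
     ('m \<Rightarrow> 'w) \<Rightarrow> 'm set \<Rightarrow> ('m \<Rightarrow> 'f) set" where
  "fields_along \<A> \<B> F U =
     {Z. \<forall>d\<in>\<B>. smooth_fun \<A> (U \<inter> F -` fst d) (\<lambda>p. tcomp \<B> d (F p) (Z p))}"

definition vector_fields ::
    "('m, 'e::euclidean_space) chart set \<Rightarrow> 'm set \<Rightarrow> ('m \<Rightarrow> 'e) set" where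
  "vector_fields \<A> U = fields_along \<A> \<A> (\<lambda>p. p) U"

text \<open>
  Coordinate formula of the Lie bracket, evaluated in the preferred chart of the point.
\<close>

definition lie_bracket ::
    "('m, 'e::euclidean_space) chart set \<Rightarrow> ('m \<Rightarrow> 'e) \<Rightarrow> ('m \<Rightarrow> 'e) \<Rightarrow> 'm \<Rightarrow> 'e" where
  "lie_bracket \<A> X Y p =
     (let c = chart_at \<A> p;
          comp = (\<lambda>Z x. tcomp \<A> c (chart_inv c x) (Z (chart_inv c x)))
      in frechet_derivative (comp Y) (at (snd c p)) (X p)
         - frechet_derivative (comp X) (at (snd c p)) (Y p))"

definition one_form ::
    "('m::topological_space, 'e::euclidean_space) chart set \<Rightarrow> ('m \<Rightarrow> 'e \<Rightarrow> real) \<Rightarrow> bool" where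
  "one_form \<A> \<omega> \<longleftrightarrow>
     (\<forall>p. linear (\<omega> p)) \<and>
     (\<forall>U X. open U \<longrightarrow> X \<in> vector_fields \<A> U \<longrightarrow> smooth_fun \<A> U (\<lambda>p. \<omega> p (X p)))"

section \<open>Metrics\<close>

definition symmetric_2tensor ::
    "('m::topological_space, 'e::euclidean_space) chart set \<Rightarrow> ('m \<Rightarrow> 'e \<Rightarrow> 'e \<Rightarrow> real) \<Rightarrow> bool" where
  "symmetric_2tensor \<A> g \<longleftrightarrow>
     (\<forall>p. bilinear (g p)) \<and> (\<forall>p v w. g p v w = g p w v) \<and>
     (\<forall>U X Y. open U \<longrightarrow> X \<in> vector_fields \<A> U \<longrightarrow> Y \<in> vector_fields \<A> U \<longrightarrow>
        smooth_fun \<A> U (\<lambda>p. g p (X p) (Y p)))"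

definition riemannian_metric ::
    "('m::topological_space, 'e::euclidean_space) chart set \<Rightarrow> ('m \<Rightarrow> 'e \<Rightarrow> 'e \<Rightarrow> real) \<Rightarrow> bool" where
  "riemannian_metric \<A> g \<longleftrightarrow> symmetric_2tensor \<A> g \<and> (\<forall>p v. v \<noteq> 0 \<longrightarrow> g p v v > 0)"

definition lorentzian_metric ::
    "('m::topological_space, 'e::euclidean_space) chart set \<Rightarrow> ('m \<Rightarrow> 'e \<Rightarrow> 'e \<Rightarrow> real) \<Rightarrow> bool" where
  "lorentzian_metric \<A> g \<longleftrightarrow> symmetric_2tensor \<A> g \<and>
     (\<forall>p. \<exists>e::nat \<Rightarrow> 'e. \<forall>i<DIM('e). \<forall>j<DIM('e).
        g p (e i) (e j) = (if i = j then if i = 0 then -1 else 1 else 0))"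

definition pullback_metric ::
    "('m, 'e::euclidean_space) chart set \<Rightarrow> ('w, 'f::euclidean_space) chart set \<Rightarrow>
     ('m \<Rightarrow> 'w) \<Rightarrow> ('w \<Rightarrow> 'f \<Rightarrow> 'f \<Rightarrow> real) \<Rightarrow> 'm \<Rightarrow> 'e \<Rightarrow> 'e \<Rightarrow> real" where
  "pullback_metric \<A> \<B> F g p v w = g (F p) (tangent_map \<A> \<B> F p v) (tangent_map \<A> \<B> F p w)"

definition spacelike_immersion ::
    "('m::topological_space, 'e::euclidean_space) chart set \<Rightarrow>
     ('w::topological_space, 'f::euclidean_space) chart set \<Rightarrow>
     ('w \<Rightarrow> 'f \<Rightarrow> 'f \<Rightarrow> real) \<Rightarrow> ('m \<Rightarrow> 'w) \<Rightarrow> bool" where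
  "spacelike_immersion \<A> \<B> gt \<Psi> \<longleftrightarrow>
     smooth_map \<A> \<B> \<Psi> \<and> (\<forall>p. inj (tangent_map \<A> \<B> \<Psi> p)) \<and>
     riemannian_metric \<A> (pullback_metric \<A> \<B> \<Psi> gt)"

text \<open>
  The metric on frames acts on fields rather than on vectors, so that the notion also applies to
  the metric induced by a tractor connection below.
\<close>

definition on_fields ::
    "('m \<Rightarrow> 'e \<Rightarrow> 'e \<Rightarrow> real) \<Rightarrow> ('m \<Rightarrow> 'e) \<Rightarrow> ('m \<Rightarrow> 'e) \<Rightarrow> 'm \<Rightarrow> real" where
  "on_fields g X Y p = g p (X p) (Y p)"

definition orthonormal_frame ::
    "('m, 'e::euclidean_space) chart set \<Rightarrow> (('m \<Rightarrow> 'e) \<Rightarrow> ('m \<Rightarrow> 'e) \<Rightarrow> 'm \<Rightarrow> real) \<Rightarrow>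
     'm set \<Rightarrow> (nat \<Rightarrow> 'm \<Rightarrow> 'e) \<Rightarrow> bool" where
  "orthonormal_frame \<A> g U E \<longleftrightarrow>
     (\<forall>i<DIM('e). E i \<in> vector_fields \<A> U) \<and>
     (\<forall>p\<in>U. \<forall>i<DIM('e). \<forall>j<DIM('e). g (E i) (E j) p = (if i = j then 1 else 0))"

text \<open>
  The value at \<open>p\<close> of \<open>\<Sum>i. T(E\<^sub>i, E\<^sub>i)\<close>, for any local \<open>g\<close>-orthonormal frame \<open>E\<close> around \<open>p\<close>.
\<close>

definition frame_trace ::
    "('m::topological_space, 'e::euclidean_space) chart set \<Rightarrow>
     (('m \<Rightarrow> 'e) \<Rightarrow> ('m \<Rightarrow> 'e) \<Rightarrow> 'm \<Rightarrow> real) \<Rightarrow>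
     (('m \<Rightarrow> 'e) \<Rightarrow> ('m \<Rightarrow> 'e) \<Rightarrow> 'm \<Rightarrow> 'b::comm_monoid_add) \<Rightarrow> 'm \<Rightarrow> 'b" where
  "frame_trace \<A> g T p =
     (THE r. \<forall>U E. open U \<longrightarrow> p \<in> U \<longrightarrow> orthonormal_frame \<A> g U E \<longrightarrow>
        r = (\<Sum>i<DIM('e). T (E i) (E i) p))"

section \<open>Connections\<close>

text \<open>
  A vector bundle over \<open>'m\<close> with fibre \<open>'f\<close> enters through its spaces \<open>\<Gamma> U\<close> of smooth sections over
  open sets \<open>U\<close>. Sections over \<open>U\<close> are represented by total functions whose values outside \<open>U\<close> are
  irrelevant. A linear connection is regarded as an operator on local sections, compatible with
  restriction: this is the last clause, which in particular makes \<open>D\<close> local and independent of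
  the values outside \<open>U\<close>.
\<close>

definition linear_connection ::
    "('m::topological_space, 'e::euclidean_space) chart set \<Rightarrow>
     ('m set \<Rightarrow> ('m \<Rightarrow> 'f::real_vector) set) \<Rightarrow> (('m \<Rightarrow> 'e) \<Rightarrow> ('m \<Rightarrow> 'f) \<Rightarrow> ('m \<Rightarrow> 'f)) \<Rightarrow> bool" where
  "linear_connection \<A> \<Gamma> D \<longleftrightarrow>
     (\<forall>U X X' Z Z' f. open U \<longrightarrow>
        X \<in> vector_fields \<A> U \<longrightarrow> X' \<in> vector_fields \<A> U \<longrightarrow> Z \<in> \<Gamma> U \<longrightarrow> Z' \<in> \<Gamma> U \<longrightarrow>
        smooth_fun \<A> U (f :: 'm \<Rightarrow> real) \<longrightarrow>
        D X Z \<in> \<Gamma> U \<and>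
        (\<forall>p\<in>U. D (\<lambda>q. X q + X' q) Z p = D X Z p + D X' Z p) \<and>
        (\<forall>p\<in>U. D (\<lambda>q. f q *\<^sub>R X q) Z p = f p *\<^sub>R D X Z p) \<and>
        (\<forall>p\<in>U. D X (\<lambda>q. Z q + Z' q) p = D X Z p + D X Z' p) \<and>
        (\<forall>p\<in>U. D X (\<lambda>q. f q *\<^sub>R Z q) p = differential \<A> f p (X p) *\<^sub>R Z p + f p *\<^sub>R D X Z p) \<and>
        ((\<forall>p\<in>U. X p = X' p \<and> Z p = Z' p) \<longrightarrow> (\<forall>p\<in>U. D X Z p = D X' Z' p)))"

definition curvature ::
    "('m, 'e::euclidean_space) chart set \<Rightarrow> (('m \<Rightarrow> 'e) \<Rightarrow> ('m \<Rightarrow> 'f::ab_group_add) \<Rightarrow> ('m \<Rightarrow> 'f)) \<Rightarrow>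
     ('m \<Rightarrow> 'e) \<Rightarrow> ('m \<Rightarrow> 'e) \<Rightarrow> ('m \<Rightarrow> 'f) \<Rightarrow> 'm \<Rightarrow> 'f" where
  "curvature \<A> D X Y Z p = D X (D Y Z) p - D Y (D X Z) p - D (lie_bracket \<A> X Y) Z p"

definition levi_civita ::
    "('m::topological_space, 'e::euclidean_space) chart set \<Rightarrow> ('m \<Rightarrow> 'e \<Rightarrow> 'e \<Rightarrow> real) \<Rightarrow>
     (('m \<Rightarrow> 'e) \<Rightarrow> ('m \<Rightarrow> 'e) \<Rightarrow> ('m \<Rightarrow> 'e)) \<Rightarrow> bool" where
  "levi_civita \<A> g D \<longleftrightarrow>
     linear_connection \<A> (vector_fields \<A>) D \<and>
     (\<forall>U X Y Z. open U \<longrightarrow>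
        X \<in> vector_fields \<A> U \<longrightarrow> Y \<in> vector_fields \<A> U \<longrightarrow> Z \<in> vector_fields \<A> U \<longrightarrow>
        (\<forall>p\<in>U. D X Y p - D Y X p = lie_bracket \<A> X Y p) \<and>
        (\<forall>p\<in>U. differential \<A> (\<lambda>q. g q (Y q) (Z q)) p (X p) =
                 g p (D X Y p) (Z p) + g p (Y p) (D X Z p)))"

text \<open>
  The induced connection on the pull-back of the tangent bundle along \<open>F\<close> is characterised by
  \<open>D\<^sub>X (W \<circ> F) = \<nabla>\<^bsub>dF X\<^esub> W\<close>. The right-hand side at \<open>p\<close> is expressed through any local vector
  field \<open>Y\<close> with \<open>Y (F p) = dF\<^sub>p (X p)\<close>.
\<close>

definition pullback_connection ::
    "('m::topological_space, 'e::euclidean_space) chart set \<Rightarrow>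
     ('w::topological_space, 'f::euclidean_space) chart set \<Rightarrow> ('m \<Rightarrow> 'w) \<Rightarrow>
     (('w \<Rightarrow> 'f) \<Rightarrow> ('w \<Rightarrow> 'f) \<Rightarrow> ('w \<Rightarrow> 'f)) \<Rightarrow> (('m \<Rightarrow> 'e) \<Rightarrow> ('m \<Rightarrow> 'f) \<Rightarrow> ('m \<Rightarrow> 'f)) \<Rightarrow> bool" where
  "pullback_connection \<A> \<B> F nab D \<longleftrightarrow>
     linear_connection \<A> (fields_along \<A> \<B> F) D \<and>
     (\<forall>U V X Y W p. open U \<longrightarrow> open V \<longrightarrow> F ` U \<subseteq> V \<longrightarrow>
        X \<in> vector_fields \<A> U \<longrightarrow> Y \<in> vector_fields \<B> V \<longrightarrow> W \<in> vector_fields \<B> V \<longrightarrow>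
        p \<in> U \<longrightarrow> Y (F p) = tangent_map \<A> \<B> F p (X p) \<longrightarrow>
        D X (W \<circ> F) p = nab Y W (F p))"

definition ricci ::
    "('m::topological_space, 'e::euclidean_space) chart set \<Rightarrow> ('m \<Rightarrow> 'e \<Rightarrow> 'e \<Rightarrow> real) \<Rightarrow>
     (('m \<Rightarrow> 'e) \<Rightarrow> ('m \<Rightarrow> 'e) \<Rightarrow> ('m \<Rightarrow> 'e)) \<Rightarrow> ('m \<Rightarrow> 'e) \<Rightarrow> ('m \<Rightarrow> 'e) \<Rightarrow> 'm \<Rightarrow> real" where
  "ricci \<A> g nab X Y =
     frame_trace \<A> (on_fields g) (\<lambda>V W p. g p (curvature \<A> nab V X Y p) (W p))"

section \<open>Extrinsic geometry of a spacelike immersion\<close>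

text \<open>
  In this section \<open>gt\<close> is the ambient metric, \<open>D\<close> the induced connection along \<open>\<Psi>\<close>, and \<open>nab\<close> the
  Levi-Civita connection of the induced metric.
\<close>

definition normal_fields ::
    "('m, 'e::euclidean_space) chart set \<Rightarrow> ('w, 'f::euclidean_space) chart set \<Rightarrow>
     ('w \<Rightarrow> 'f \<Rightarrow> 'f \<Rightarrow> real) \<Rightarrow> ('m \<Rightarrow> 'w) \<Rightarrow> ('m \<Rightarrow> 'f) set" where
  "normal_fields \<A> \<B> gt \<Psi> =
     {\<zeta> \<in> fields_along \<A> \<B> \<Psi> UNIV. \<forall>p v. gt (\<Psi> p) (\<zeta> p) (tangent_map \<A> \<B> \<Psi> p v) = 0}"

definition lightlike ::
    "('w \<Rightarrow> 'f::zero \<Rightarrow> 'f \<Rightarrow> real) \<Rightarrow> ('m \<Rightarrow> 'w) \<Rightarrow> ('m \<Rightarrow> 'f) \<Rightarrow> bool" where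
  "lightlike gt \<Psi> \<zeta> \<longleftrightarrow> (\<forall>p. \<zeta> p \<noteq> 0 \<and> gt (\<Psi> p) (\<zeta> p) (\<zeta> p) = 0)"

definition second_fundamental_form ::
    "('m, 'e::euclidean_space) chart set \<Rightarrow> ('w, 'f::euclidean_space) chart set \<Rightarrow> ('m \<Rightarrow> 'w) \<Rightarrow>
     (('m \<Rightarrow> 'e) \<Rightarrow> ('m \<Rightarrow> 'f) \<Rightarrow> ('m \<Rightarrow> 'f)) \<Rightarrow> (('m \<Rightarrow> 'e) \<Rightarrow> ('m \<Rightarrow> 'e) \<Rightarrow> ('m \<Rightarrow> 'e)) \<Rightarrow>
     ('m \<Rightarrow> 'e) \<Rightarrow> ('m \<Rightarrow> 'e) \<Rightarrow> 'm \<Rightarrow> 'f" where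
  "second_fundamental_form \<A> \<B> \<Psi> D nab X Y p =
     D X (\<lambda>q. tangent_map \<A> \<B> \<Psi> q (Y q)) p - tangent_map \<A> \<B> \<Psi> p (nab X Y p)"

text \<open>
  Weingarten's formula as a definition: \<open>- A\<^sub>\<zeta> X\<close> and \<open>\<nabla>\<^sup>\<bottom>\<^sub>X \<zeta>\<close> are the tangential and the normal part
  of \<open>D\<^sub>X \<zeta>\<close>.
\<close>

definition shape_operator ::
    "('m, 'e::euclidean_space) chart set \<Rightarrow> ('w, 'f::euclidean_space) chart set \<Rightarrow>
     ('w \<Rightarrow> 'f \<Rightarrow> 'f \<Rightarrow> real) \<Rightarrow> ('m \<Rightarrow> 'w) \<Rightarrow> (('m \<Rightarrow> 'e) \<Rightarrow> ('m \<Rightarrow> 'f) \<Rightarrow> ('m \<Rightarrow> 'f)) \<Rightarrow>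
     ('m \<Rightarrow> 'f) \<Rightarrow> ('m \<Rightarrow> 'e) \<Rightarrow> 'm \<Rightarrow> 'e" where
  "shape_operator \<A> \<B> gt \<Psi> D \<zeta> X p =
     (THE u. \<forall>w. gt (\<Psi> p) (D X \<zeta> p + tangent_map \<A> \<B> \<Psi> p u) (tangent_map \<A> \<B> \<Psi> p w) = 0)"

definition normal_connection ::
    "('m, 'e::euclidean_space) chart set \<Rightarrow> ('w, 'f::euclidean_space) chart set \<Rightarrow>
     ('w \<Rightarrow> 'f \<Rightarrow> 'f \<Rightarrow> real) \<Rightarrow> ('m \<Rightarrow> 'w) \<Rightarrow> (('m \<Rightarrow> 'e) \<Rightarrow> ('m \<Rightarrow> 'f) \<Rightarrow> ('m \<Rightarrow> 'f)) \<Rightarrow>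
     ('m \<Rightarrow> 'e) \<Rightarrow> ('m \<Rightarrow> 'f) \<Rightarrow> 'm \<Rightarrow> 'f" where
  "normal_connection \<A> \<B> gt \<Psi> D X \<zeta> p =
     D X \<zeta> p + tangent_map \<A> \<B> \<Psi> p (shape_operator \<A> \<B> gt \<Psi> D \<zeta> X p)"

definition mean_curvature ::
    "('m::topological_space, 'e::euclidean_space) chart set \<Rightarrow> ('w, 'f::euclidean_space) chart set \<Rightarrow>
     ('w \<Rightarrow> 'f \<Rightarrow> 'f \<Rightarrow> real) \<Rightarrow> ('m \<Rightarrow> 'w) \<Rightarrow> (('m \<Rightarrow> 'e) \<Rightarrow> ('m \<Rightarrow> 'f) \<Rightarrow> ('m \<Rightarrow> 'f)) \<Rightarrow>
     (('m \<Rightarrow> 'e) \<Rightarrow> ('m \<Rightarrow> 'e) \<Rightarrow> ('m \<Rightarrow> 'e)) \<Rightarrow> 'm \<Rightarrow> 'f" where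
  "mean_curvature \<A> \<B> gt \<Psi> D nab p =
     (1 / real DIM('e)) *\<^sub>R
       frame_trace \<A> (on_fields (pullback_metric \<A> \<B> \<Psi> gt))
         (second_fundamental_form \<A> \<B> \<Psi> D nab) p"

section \<open>Tractors and normality\<close>

text \<open>
  The data of a tractor bundle with connection: smooth local sections of the bundle, bundle metric
  \<open>h\<close>, lightlike line subbundle \<open>T\<^sup>1\<close>, connection.
\<close>

record ('m, 'e, 'f) tractor =
  sections :: "'m set \<Rightarrow> ('m \<Rightarrow> 'f) set"
  bundle_metric :: "'m \<Rightarrow> 'f \<Rightarrow> 'f \<Rightarrow> real"
  line_bundle :: "'m \<Rightarrow> 'f set"
  tractor_conn :: "('m \<Rightarrow> 'e) \<Rightarrow> ('m \<Rightarrow> 'f) \<Rightarrow> ('m \<Rightarrow> 'f)"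

definition associated_tractor ::
    "('m, 'e::euclidean_space) chart set \<Rightarrow> ('w, 'f::euclidean_space) chart set \<Rightarrow>
     ('w \<Rightarrow> 'f \<Rightarrow> 'f \<Rightarrow> real) \<Rightarrow> ('m \<Rightarrow> 'w) \<Rightarrow> (('m \<Rightarrow> 'e) \<Rightarrow> ('m \<Rightarrow> 'f) \<Rightarrow> ('m \<Rightarrow> 'f)) \<Rightarrow>
     ('m \<Rightarrow> 'f) \<Rightarrow> ('m, 'e, 'f) tractor" where
  "associated_tractor \<A> \<B> gt \<Psi> D \<xi> =
     \<lparr>sections = fields_along \<A> \<B> \<Psi>, bundle_metric = (\<lambda>p. gt (\<Psi> p)),
      line_bundle = (\<lambda>p. span {\<xi> p}), tractor_conn = D\<rparr>"

definition line_sections :: "('m, 'e, 'f) tractor \<Rightarrow> 'm set \<Rightarrow> ('m \<Rightarrow> 'f) set" where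
  "line_sections T U = {\<sigma> \<in> sections T U. \<forall>p\<in>U. \<sigma> p \<in> line_bundle T p}"

text \<open>
  Elements of the quotient bundle \<open>(T\<^sup>1)\<^sup>\<bottom>/T\<^sup>1\<close> are cosets of \<open>T\<^sup>1\<close>; its sections are functions from
  points to cosets. \<open>quot_metric\<close> is the metric induced by \<open>h\<close> on cosets, and
  \<open>quot_curvature\<close> the action of \<open>R(X,Y)\<close> on sections of the quotient, obtained by
  lifting a section of the quotient, applying \<open>R(X,Y)\<close>, and projecting.
\<close>

definition beta :: "('m, 'e, 'f::plus) tractor \<Rightarrow> ('m \<Rightarrow> 'f) \<Rightarrow> ('m \<Rightarrow> 'e) \<Rightarrow> 'm \<Rightarrow> 'f set" where
  "beta T \<sigma> X p = {tractor_conn T X \<sigma> p + t | t. t \<in> line_bundle T p}"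

definition quot_metric :: "('m, 'e, 'f) tractor \<Rightarrow> 'm \<Rightarrow> 'f set \<Rightarrow> 'f set \<Rightarrow> real" where
  "quot_metric T p A B = (THE r. \<forall>a\<in>A. \<forall>b\<in>B. bundle_metric T p a b = r)"

definition sigma_metric ::
    "('m, 'e, 'f::plus) tractor \<Rightarrow> ('m \<Rightarrow> 'f) \<Rightarrow> ('m \<Rightarrow> 'e) \<Rightarrow> ('m \<Rightarrow> 'e) \<Rightarrow> 'm \<Rightarrow> real" where
  "sigma_metric T \<sigma> X Y p = quot_metric T p (beta T \<sigma> X p) (beta T \<sigma> Y p)"

definition quot_curvature ::
    "('m::topological_space, 'e::euclidean_space) chart set \<Rightarrow> ('m, 'e, 'f::ab_group_add) tractor \<Rightarrow>
     ('m \<Rightarrow> 'e) \<Rightarrow> ('m \<Rightarrow> 'e) \<Rightarrow> ('m \<Rightarrow> 'f set) \<Rightarrow> 'm \<Rightarrow> 'f set" where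
  "quot_curvature \<A> T X Y S p =
     {curvature \<A> (tractor_conn T) X Y s p + t | s t U.
        open U \<and> p \<in> U \<and> s \<in> sections T U \<and> (\<forall>q\<in>U. s q \<in> S q) \<and> t \<in> line_bundle T p}"

definition normal_tractor_connection ::
    "('m::topological_space, 'e::euclidean_space) chart set \<Rightarrow> ('m, 'e, 'f::ab_group_add) tractor \<Rightarrow>
     bool" where
  "normal_tractor_connection \<A> T \<longleftrightarrow>
     (\<forall>X\<in>vector_fields \<A> UNIV. \<forall>Y\<in>vector_fields \<A> UNIV. \<forall>\<sigma>\<in>line_sections T UNIV.
        curvature \<A> (tractor_conn T) X Y \<sigma> \<in> line_sections T UNIV) \<and>
     (\<forall>X\<in>vector_fields \<A> UNIV. \<forall>Y\<in>vector_fields \<A> UNIV.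
        \<forall>U. open U \<longrightarrow> (\<forall>\<sigma>\<in>line_sections T U. (\<forall>p\<in>U. \<sigma> p \<noteq> 0) \<longrightarrow>
          (\<forall>p\<in>U. frame_trace \<A> (sigma_metric T \<sigma>)
             (\<lambda>V W q. quot_metric T q (quot_curvature \<A> T V X (beta T \<sigma> Y) q) (beta T \<sigma> W q)) p
           = 0)))"

end

theory Submission
  imports Defs
begin

text \<open>
  Since \<open>D\<^sub>X \<xi> = \<omega>(X) \<xi> - \<lambda> d\<Psi>(X)\<close>, the tangential part of \<open>R(X,Y) \<xi>\<close> is
  \<open>(\<lambda> \<omega> - d\<lambda>)(X) Y - (\<lambda> \<omega> - d\<lambda>)(Y) X\<close>, while its product with \<open>\<xi>\<close> vanishes because \<open>R(X,Y)\<close> is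
  skew. As \<open>n \<ge> 2\<close>, condition (i) of normality means \<open>\<lambda> \<omega> = d\<lambda>\<close>. A section
  \<open>\<sigma> = f \<xi>\<close> has \<open>\<beta>\<^sub>\<sigma>(Y) = - f \<lambda> d\<Psi>(Y)\<close> modulo \<open>\<xi>\<close>, so the trace in condition (ii) is the \<open>g\<close>-trace of
  \<open>gt(R(E,X) d\<Psi>(Y), d\<Psi>(E))\<close>. With \<open>II(X,Y) = - \<lambda> g(X,Y) \<eta> - g(A\<^sub>\<eta> X, Y) \<xi>\<close> the Gauss equation turns it
  into \<open>Ric(X,Y) + \<lambda> tr(A\<^sub>\<eta>) g(X,Y) + (n - 2) \<lambda> g(A\<^sub>\<eta> X, Y)\<close>, and \<open>H = - \<lambda> \<eta> - (tr(A\<^sub>\<eta>) / n) \<xi>\<close>.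
\<close>

section \<open>Calculus of smooth functions\<close>

text \<open>All objects of the statement are operators on fields, and \<open>frame_trace\<close>,
  \<open>shape_operator\<close> and \<open>quot_metric\<close> are definite descriptions. A
  pointwise computation is possible only once values at a point are known to determine the operators
  and the described objects are known to exist uniquely. Hence bump functions (normality and the
  Ricci identity quantify over global fields, so values at a point must be realised globally),
  tensoriality and local orthonormal frames. A second obstacle: \<open>pullback_connection\<close>
  prescribes \<open>D\<close> only on compositions \<open>W \<circ> F\<close>. Metric compatibility
  and vanishing torsion along \<open>\<Psi>\<close> must be carried over from coordinate fields by
  the Leibniz rule. The two conditions of normality are evaluated in a fixed order. Condition (i)
  makes the curvature preserve the line and, by skewness, its orthogonal complement; then all lifts
  of a section of the quotient give one coset, on which \<open>quot_metric\<close> has a value. So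
  (ii) is computed under the equation for \<open>\<omega>\<close> that (i) yields, and the factor
  \<open>f * lam\<close> from the choice of \<sigma> cancels between \<open>beta\<close> and the
  rescaled frame.\<close>

lemma Ck_on_subset: "Ck_on k S f \<Longrightarrow> T \<subseteq> S \<Longrightarrow> Ck_on k T f"
  by (induction k arbitrary: f) (auto intro: continuous_on_subset)

lemma Ck_on_cong:
  assumes "open S" "\<And>x. x \<in> S \<Longrightarrow> f x = g x" "Ck_on k S f"
  shows "Ck_on k S g"
  using assms(2,3)
proof (induction k arbitrary: f g)
  case 0
  then show ?case by (auto intro: continuous_on_eq)
next
  case (Suc k)
  have d: "f differentiable at x" if "x \<in> S" for x
    using Suc.prems(2) that by simp
  have eq: "frechet_derivative f (at x) = frechet_derivative g (at x)" if "x \<in> S" for x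
    using frechet_derivative_transform_within_open[OF d assms(1)] that Suc.prems(1) by blast
  have "g differentiable at x" if x: "x \<in> S" for x
    using d[OF x] Suc.prems(1) assms(1) x
    unfolding differentiable_def by (meson has_derivative_transform_within_open)
  moreover have "Ck_on k S (\<lambda>x. frechet_derivative g (at x) v)" for v
    using Suc.IH[of "\<lambda>x. frechet_derivative f (at x) v"] Suc.prems(2) eq by simp
  ultimately show ?case by simp
qed

lemma Ck_on_Suc_imp: "Ck_on (Suc k) S f \<Longrightarrow> Ck_on k S f"
proof (induction k arbitrary: f)
  case 0
  then show ?case
    by (auto intro!: continuous_at_imp_continuous_on differentiable_imp_continuous_within)
next
  case (Suc k)
  then show ?case by (metis Ck_on.simps(2))
qed

text \<open>All derivatives are taken \<open>at x\<close> in the full space, so an open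
  neighbourhood of each point decides both differentiability and continuity.\<close>

lemma Ck_on_locally:
  assumes "\<And>x. x \<in> S \<Longrightarrow> \<exists>T. open T \<and> x \<in> T \<and> Ck_on k T f"
  shows "Ck_on k S f"
  using assms
proof (induction k arbitrary: f)
  case 0
  then show ?case
    by (metis Ck_on.simps(1) continuous_at_imp_continuous_on continuous_on_eq_continuous_at)
next
  case (Suc k)
  have "\<exists>T. open T \<and> x \<in> T \<and> Ck_on k T (\<lambda>x. frechet_derivative f (at x) v)" if "x \<in> S" for x v
    using Suc.prems[OF that] by (metis Ck_on.simps(2))
  then have "Ck_on k S (\<lambda>x. frechet_derivative f (at x) v)" for v
    using Suc.IH by blast
  then show ?case
    using Suc.prems by (metis Ck_on.simps(2))
qed

text \<open>Derivatives at a point are unique, so an explicitly computed \<open>f'\<close> may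
  replace the choice operator \<open>frechet_derivative\<close>. The differentiation rules below
  enter through this form.\<close>

lemma Ck_on_SucI:
  assumes "open S"
    and "\<And>x. x \<in> S \<Longrightarrow> (f has_derivative f' x) (at x)"
    and "\<And>v. Ck_on k S (\<lambda>x. f' x v)"
  shows "Ck_on (Suc k) S f"
proof -
  have "frechet_derivative f (at x) = f' x" if "x \<in> S" for x
    using frechet_derivative_at[OF assms(2)[OF that]] by simp
  then have "Ck_on k S (\<lambda>x. frechet_derivative f (at x) v)" for v
    using Ck_on_cong[OF assms(1) _ assms(3)[of v]] by simp
  then show ?thesis
    using assms(2) by (auto simp: differentiable_def)
qed

lemma Ck_on_Suc_has_derivative:
  "Ck_on (Suc k) S f \<Longrightarrow> x \<in> S \<Longrightarrow> (f has_derivative frechet_derivative f (at x)) (at x)"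
  by (simp add: frechet_derivative_works[symmetric])

lemma has_real_derivative_scaleR:
  "(f has_real_derivative D) (at x) \<longleftrightarrow> (f has_derivative (\<lambda>v. v *\<^sub>R D)) (at x)"
proof -
  have "(*) D = (\<lambda>v. v *\<^sub>R D)" by (auto simp: fun_eq_iff)
  then show ?thesis by (simp add: has_field_derivative_def)
qed

lemma Ck_on_const: "Ck_on k S (\<lambda>x. c)"
  by (induction k arbitrary: c) auto

lemma Ck_on_bounded_linear:
  assumes "bounded_linear L" "open S" "Ck_on k S f"
  shows "Ck_on k S (\<lambda>x. L (f x))"
  using assms(3)
proof (induction k arbitrary: f)
  case 0
  then show ?case by (simp add: bounded_linear.continuous_on[OF assms(1)])
next
  case (Suc k)
  have "(f has_derivative frechet_derivative f (at x)) (at x)" if "x \<in> S" for x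
    using Suc.prems that by (auto intro: Ck_on_Suc_has_derivative simp del: Ck_on.simps)
  then show ?case
    using Suc
    by (intro Ck_on_SucI[OF assms(2) bounded_linear.has_derivative[OF assms(1)]]) auto
qed

lemma Ck_on_add:
  assumes "open S" "Ck_on k S f" "Ck_on k S g"
  shows "Ck_on k S (\<lambda>x. f x + g x)"
  using assms(2,3)
proof (induction k arbitrary: f g)
  case 0
  then show ?case by (simp add: continuous_on_add)
next
  case (Suc k)
  have "(f has_derivative frechet_derivative f (at x)) (at x)"
    "(g has_derivative frechet_derivative g (at x)) (at x)" if "x \<in> S" for x
    using Suc.prems that by (auto intro: Ck_on_Suc_has_derivative simp del: Ck_on.simps)
  then show ?case
    using Suc
    by (intro Ck_on_SucI[OF assms(1) has_derivative_add]) auto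
qed

lemma Ck_on_sum:
  assumes "open S" "\<And>i. i \<in> I \<Longrightarrow> Ck_on k S (f i)"
  shows "Ck_on k S (\<lambda>x. \<Sum>i\<in>I. f i x)"
proof (cases "finite I")
  case True
  then show ?thesis using assms(2)
    by (induction I) (auto intro: Ck_on_const Ck_on_add[OF assms(1)])
qed (simp add: Ck_on_const)

lemma Ck_on_bounded_bilinear:
  assumes "bounded_bilinear P" "open S" "Ck_on k S f" "Ck_on k S g"
  shows "Ck_on k S (\<lambda>x. P (f x) (g x))"
  using assms(3,4)
proof (induction k arbitrary: f g)
  case 0
  then show ?case by (simp add: bounded_bilinear.continuous_on[OF assms(1)])
next
  case (Suc k)
  have "(f has_derivative frechet_derivative f (at x)) (at x)"
    "(g has_derivative frechet_derivative g (at x)) (at x)" if "x \<in> S" for x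
    using Suc.prems that by (auto intro: Ck_on_Suc_has_derivative simp del: Ck_on.simps)
  \<comment> \<open>The product rule leaves one factor undifferentiated, so both factors are also
    needed one order lower.\<close>
  moreover have "Ck_on k S f" "Ck_on k S g"
    using Suc.prems Ck_on_Suc_imp by blast+
  ultimately show ?case
    using Suc
    by (intro Ck_on_SucI[OF assms(2) bounded_bilinear.FDERIV[OF assms(1)]]
          Ck_on_add[OF assms(2)]) auto
qed

lemma linear_frechet_Basis:
  fixes v :: "'a::euclidean_space"
  assumes "f differentiable at x"
  shows "frechet_derivative f (at x) v = (\<Sum>b\<in>Basis. (v \<bullet> b) *\<^sub>R frechet_derivative f (at x) b)"
proof -
  have "frechet_derivative f (at x) v = frechet_derivative f (at x) (\<Sum>b\<in>Basis. (v \<bullet> b) *\<^sub>R b)"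
    by (simp add: euclidean_representation)
  then show ?thesis
    using linear_frechet_derivative[OF assms] by (simp add: linear_sum linear_cmul)
qed

lemma Ck_on_compose:
  fixes g :: "'a::euclidean_space \<Rightarrow> 'b::euclidean_space" and f :: "'b \<Rightarrow> 'c::real_normed_vector"
  assumes "open S" "open T" "\<And>x. x \<in> S \<Longrightarrow> g x \<in> T" "Ck_on k T f" "Ck_on k S g"
  shows "Ck_on k S (\<lambda>x. f (g x))"
  using assms(4,5)
proof (induction k arbitrary: f)
  case 0
  then show ?case
    using continuous_on_compose2[of T f S g] assms(3) by auto
next
  case (Suc k)
  have f: "f differentiable at (g x)" and g: "g differentiable at x" if "x \<in> S" for x
    using Suc.prems that assms(3) by auto
  have gk: "Ck_on k S g"
    using Suc.prems Ck_on_Suc_imp by blast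
  \<comment> \<open>The direction in which \<open>f\<close> is differentiated moves with
    \<open>x\<close>, whereas \<open>Ck_on\<close> speaks of fixed directions. Expanding it in
    \<open>Basis\<close> leaves fixed directions \<open>b\<close>, to which the induction hypothesis
    applies.\<close>
  let ?f' = "\<lambda>x v. \<Sum>b\<in>Basis. (frechet_derivative g (at x) v \<bullet> b) *\<^sub>R frechet_derivative f (at (g x)) b"
  have "((\<lambda>x. f (g x)) has_derivative ?f' x) (at x)" if "x \<in> S" for x
  proof -
    have "((\<lambda>x. f (g x)) has_derivative (\<lambda>v. frechet_derivative f (at (g x)) (frechet_derivative g (at x) v))) (at x)"
      using f[OF that] g[OF that] unfolding frechet_derivative_works
      by (metis (no_types, lifting) ext diff_chain_at o_def)
    then show ?thesis
      unfolding linear_frechet_Basis[OF f[OF that], of "frechet_derivative g _ _"] .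
  qed
  moreover have "Ck_on k S (\<lambda>x. ?f' x v)" for v
    using Suc assms(1) gk
    by (intro Ck_on_sum Ck_on_bounded_bilinear[OF bounded_bilinear_scaleR]
         Ck_on_bounded_linear[OF bounded_linear_inner_left] Suc.IH) auto
  ultimately show ?case
    by (intro Ck_on_SucI[OF assms(1)])
qed

lemma Ck_on_id: "open S \<Longrightarrow> Ck_on k S (\<lambda>x. x)"
  by (cases k) (auto intro!: Ck_on_SucI[OF _ has_derivative_ident] Ck_on_const)

section \<open>The same calculus at all orders at once\<close>

lemma smooth_on_subset: "smooth_on S f \<Longrightarrow> T \<subseteq> S \<Longrightarrow> smooth_on T f"
  unfolding smooth_on_def using Ck_on_subset by blast

lemma smooth_on_cong:
  "open S \<Longrightarrow> (\<And>x. x \<in> S \<Longrightarrow> f x = g x) \<Longrightarrow> smooth_on S f \<Longrightarrow> smooth_on S g"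
  unfolding smooth_on_def using Ck_on_cong by blast

lemma smooth_on_locally:
  "(\<And>x. x \<in> S \<Longrightarrow> \<exists>T. open T \<and> x \<in> T \<and> smooth_on T f) \<Longrightarrow> smooth_on S f"
  unfolding smooth_on_def by (meson Ck_on_locally)

lemma smooth_on_imp_differentiable: "smooth_on S f \<Longrightarrow> x \<in> S \<Longrightarrow> f differentiable at x"
  unfolding smooth_on_def by (metis Ck_on.simps(2))

lemma smooth_on_frechet_derivative:
  "smooth_on S f \<Longrightarrow> smooth_on S (\<lambda>x. frechet_derivative f (at x) v)"
  unfolding smooth_on_def by (metis Ck_on.simps(2))

lemma smooth_on_imp_continuous_on: "smooth_on S f \<Longrightarrow> continuous_on S f"
  unfolding smooth_on_def by (metis Ck_on.simps(1))

lemma smooth_on_const: "smooth_on S (\<lambda>x. c)"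
  by (simp add: smooth_on_def Ck_on_const)

lemma smooth_on_bounded_linear:
  "bounded_linear L \<Longrightarrow> open S \<Longrightarrow> smooth_on S f \<Longrightarrow> smooth_on S (\<lambda>x. L (f x))"
  by (simp add: smooth_on_def Ck_on_bounded_linear)

lemma smooth_on_sum:
  "open S \<Longrightarrow> (\<And>i. i \<in> I \<Longrightarrow> smooth_on S (f i)) \<Longrightarrow> smooth_on S (\<lambda>x. \<Sum>i\<in>I. f i x)"
  by (simp add: smooth_on_def Ck_on_sum)

lemma smooth_on_add:
  "open S \<Longrightarrow> smooth_on S f \<Longrightarrow> smooth_on S g \<Longrightarrow> smooth_on S (\<lambda>x. f x + g x)"
  by (simp add: smooth_on_def Ck_on_add)

lemma smooth_on_bounded_bilinear:
  "bounded_bilinear P \<Longrightarrow> open S \<Longrightarrow> smooth_on S f \<Longrightarrow> smooth_on S g \<Longrightarrow>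
    smooth_on S (\<lambda>x. P (f x) (g x))"
  by (simp add: smooth_on_def Ck_on_bounded_bilinear)

lemma smooth_on_compose:
  fixes g :: "'a::euclidean_space \<Rightarrow> 'b::euclidean_space" and f :: "'b \<Rightarrow> 'c::real_normed_vector"
  shows "open S \<Longrightarrow> open T \<Longrightarrow> (\<And>x. x \<in> S \<Longrightarrow> g x \<in> T) \<Longrightarrow> smooth_on T f \<Longrightarrow> smooth_on S g \<Longrightarrow>
    smooth_on S (\<lambda>x. f (g x))"
  unfolding smooth_on_def using Ck_on_compose[of S T g] by blast

lemma smooth_on_id: "open S \<Longrightarrow> smooth_on S (\<lambda>x. x)"
  by (simp add: smooth_on_def Ck_on_id)

text \<open>The exponent is general because differentiation lowers it by one. With exponent -1/2
  this normalises vectors when frames are built.\<close>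

lemma smooth_on_powr: "smooth_on {0<..} (\<lambda>x::real. x powr a)"
  unfolding smooth_on_def
proof
  fix k
  have *: "Ck_on k {0<..} (\<lambda>x::real. x powr a)" for a
  proof (induction k arbitrary: a)
    case 0
    show ?case by (auto intro!: continuous_intros)
  next
    case (Suc k)
    have "((\<lambda>x. x powr a) has_derivative (\<lambda>v. v *\<^sub>R (a * x powr (a - 1)))) (at x)"
      if "x \<in> {0<..}" for x :: real
      using has_real_derivative_powr[of x a] that by (simp add: has_real_derivative_scaleR)
    then show ?case
      by (rule Ck_on_SucI[rotated]) (auto intro!: Ck_on_bounded_linear[OF bounded_linear_scaleR_right] Ck_on_bounded_linear[OF bounded_linear_mult_right] Suc.IH)
  qed
  then show "Ck_on k {0<..} (\<lambda>x::real. x powr a)" .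
qed

text \<open>The factor \<open>1 / t ^ m\<close> makes this family of flat functions closed under differentiation.\<close>

definition flat :: "nat \<Rightarrow> real \<Rightarrow> real" where
  "flat m t = (if t > 0 then exp (- 1 / t) / t ^ m else 0)"

text \<open>With \<open>t = 1 / u\<close> this is \<open>u ^ m / exp u\<close> tending to 0 at
  infinity.\<close>

lemma flat_tendsto_0: "((\<lambda>t. exp (- 1 / t) / t ^ m) \<longlongrightarrow> 0) (at_right (0::real))"
proof -
  have "((\<lambda>u::real. u ^ m / exp u) \<longlongrightarrow> 0) at_top"
    by (rule tendsto_power_div_exp_0)
  then have "((\<lambda>t::real. (inverse t) ^ m / exp (inverse t)) \<longlongrightarrow> 0) (at_right 0)"
    by (rule filterlim_compose[OF _ filterlim_inverse_at_top_right])
  then show ?thesis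
    by (simp add: field_simps exp_minus power_inverse)
qed

lemma flat_has_real_derivative:
  "(flat m has_real_derivative (flat (m + 2) t - real m * flat (m + 1) t)) (at t)"
proof -
  consider "t > 0" | "t < 0" | "t = 0" by linarith
  then show ?thesis
  proof cases
    case 1
    have "((\<lambda>t. exp (- 1 / t) / t ^ m) has_real_derivative
        (flat (m + 2) t - real m * flat (m + 1) t)) (at t)"
      using 1 
      apply (auto intro!: derivative_eq_intros simp: flat_def divide_simps power2_eq_square)
      \<comment> \<open>The derivative of \<open>t ^ m\<close> contains \<open>m - 1\<close> on
        naturals.\<close>
      apply (cases m)
      apply (auto simp: algebra_simps)
      done
    then show ?thesis
      by (rule has_field_derivative_transform_within_open[of _ _ _ "{0<..}"])
        (use 1 in \<open>auto simp: flat_def\<close>)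
  next
    case 2
    have "((\<lambda>t. 0) has_real_derivative (flat (m + 2) t - real m * flat (m + 1) t)) (at t)"
      using 2 by (simp add: flat_def)
    then show ?thesis
      by (rule has_field_derivative_transform_within_open[of _ _ _ "{..<0}"])
        (use 2 in \<open>auto simp: flat_def\<close>)
  next
    case 3
    \<comment> \<open>From the right, dividing by \<open>y\<close> turns \<open>flat m\<close> into
      \<open>flat (Suc m)\<close>, so the limit above gives slope 0; from the left everything
      vanishes.\<close>
    have "((\<lambda>y. (flat m y - flat m 0) / (y - 0)) \<longlongrightarrow> 0) (at_right 0)"
      by (rule Lim_transform_eventually[OF flat_tendsto_0[of "Suc m"]])
        (auto simp: flat_def eventually_at_right_less intro!: eventually_mono[OF eventually_at_right_less[of 0]])
    moreover have "((\<lambda>y. (flat m y - flat m 0) / (y - 0)) \<longlongrightarrow> 0) (at_left 0)"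
      by (rule Lim_transform_eventually[OF tendsto_const])
        (auto simp: flat_def eventually_at_left_field intro!: exI[of _ "-1"])
    ultimately have "(flat m has_real_derivative 0) (at 0)"
      unfolding has_field_derivative_iff by (rule filterlim_split_at[rotated])
    then show ?thesis using 3 by (simp add: flat_def)
  qed
qed

lemma smooth_on_flat: "smooth_on UNIV (flat m)"
  unfolding smooth_on_def
proof
  fix k
  show "Ck_on k UNIV (flat m)"
  proof (induction k arbitrary: m)
    case 0
    show ?case
      by (auto intro!: DERIV_continuous_on flat_has_real_derivative)
  next
    case (Suc k)
    have "(flat m has_derivative (\<lambda>v. v *\<^sub>R (flat (m + 2) t + (- real m) *\<^sub>R flat (m + 1) t))) (at t)" for t
      using flat_has_real_derivative[of m t] by (simp add: has_real_derivative_scaleR)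
    then show ?case
      by (rule Ck_on_SucI[rotated])
       (intro open_UNIV Ck_on_add Ck_on_bounded_linear[OF bounded_linear_scaleR_right] Suc.IH)+
  qed
qed

text \<open>Mean value theorem twice: along \<open>v\<close> for the difference of \<open>f\<close>
  between two opposite sides of the parallelogram, then along \<open>w\<close> for the difference of
  derivatives so obtained.\<close>

lemma second_difference_mvt:
  fixes f :: "'a::euclidean_space \<Rightarrow> real"
  assumes S: "open S" "Ck_on 2 S f" and h: "h > 0"
    and sub: "\<And>s t. 0 \<le> s \<Longrightarrow> s \<le> h \<Longrightarrow> 0 \<le> t \<Longrightarrow> t \<le> h \<Longrightarrow> x + s *\<^sub>R v + t *\<^sub>R w \<in> S"
  shows "\<exists>s t. 0 \<le> s \<and> s \<le> h \<and> 0 \<le> t \<and> t \<le> h \<and>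
    f (x + h *\<^sub>R v + h *\<^sub>R w) - f (x + h *\<^sub>R v) - f (x + h *\<^sub>R w) + f x =
      h * h * frechet_derivative (\<lambda>y. frechet_derivative f (at y) v) (at (x + s *\<^sub>R v + t *\<^sub>R w)) w"
proof -
  let ?f1 = "\<lambda>y. frechet_derivative f (at y) v"
  have f: "f differentiable at y" and f1: "?f1 differentiable at y" if "y \<in> S" for y
    using S(2) that by (auto simp: numeral_2_eq_2)
  have line: "((\<lambda>s. F (y + s *\<^sub>R u)) has_real_derivative frechet_derivative F (at (y + s *\<^sub>R u)) u) (at s)"
    if "F differentiable at (y + s *\<^sub>R u)" for F :: "'a \<Rightarrow> real" and y u s
  proof -
    have "((\<lambda>s. y + s *\<^sub>R u) has_derivative (\<lambda>r. r *\<^sub>R u)) (at s)"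
      by (auto intro!: derivative_eq_intros)
    moreover have "(F has_derivative frechet_derivative F (at (y + s *\<^sub>R u))) (at (y + s *\<^sub>R u))"
      using that frechet_derivative_works by blast
    ultimately have "((\<lambda>s. F (y + s *\<^sub>R u)) has_derivative
        (\<lambda>r. frechet_derivative F (at (y + s *\<^sub>R u)) (r *\<^sub>R u))) (at s)"
      using has_derivative_compose by blast
    then show ?thesis
      using linear_cmul[OF linear_frechet_derivative[OF that]]
      by (simp add: has_real_derivative_scaleR)
  qed
  let ?G = "\<lambda>s. f ((x + h *\<^sub>R w) + s *\<^sub>R v) - f (x + s *\<^sub>R v)"
  have "(?G has_real_derivative ?f1 ((x + h *\<^sub>R w) + s *\<^sub>R v) - ?f1 (x + s *\<^sub>R v)) (at s)"
    if "0 \<le> s" "s \<le> h" for s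
    using sub[of s 0] sub[of s h] that h
    by (intro DERIV_diff line f) (auto simp: algebra_simps)
  then obtain s where s: "0 < s" "s < h"
    "?G h - ?G 0 = (h - 0) * (?f1 ((x + h *\<^sub>R w) + s *\<^sub>R v) - ?f1 (x + s *\<^sub>R v))"
    using MVT2[OF h, of ?G "\<lambda>s. ?f1 ((x + h *\<^sub>R w) + s *\<^sub>R v) - ?f1 (x + s *\<^sub>R v)"] by auto
  have "((\<lambda>t. ?f1 ((x + s *\<^sub>R v) + t *\<^sub>R w)) has_real_derivative
      frechet_derivative ?f1 (at ((x + s *\<^sub>R v) + t *\<^sub>R w)) w) (at t)"
    if "0 \<le> t" "t \<le> h" for t
    using sub[of s t] that s by (intro line f1) auto
  then obtain t where t: "0 < t" "t < h"
    "?f1 ((x + s *\<^sub>R v) + h *\<^sub>R w) - ?f1 ((x + s *\<^sub>R v) + 0 *\<^sub>R w) =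
      (h - 0) * frechet_derivative ?f1 (at ((x + s *\<^sub>R v) + t *\<^sub>R w)) w"
    using MVT2[OF h, of "\<lambda>t. ?f1 ((x + s *\<^sub>R v) + t *\<^sub>R w)"
        "\<lambda>t. frechet_derivative ?f1 (at ((x + s *\<^sub>R v) + t *\<^sub>R w)) w"] by auto
  have "f (x + h *\<^sub>R v + h *\<^sub>R w) - f (x + h *\<^sub>R v) - f (x + h *\<^sub>R w) + f x = ?G h - ?G 0"
    by (simp add: algebra_simps)
  also have "\<dots> = h * (?f1 ((x + s *\<^sub>R v) + h *\<^sub>R w) - ?f1 ((x + s *\<^sub>R v) + 0 *\<^sub>R w))"
    using s(3) by (simp add: add.commute add.left_commute)
  also have "\<dots> = h * h * frechet_derivative ?f1 (at ((x + s *\<^sub>R v) + t *\<^sub>R w)) w"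
    using t(3) by simp
  finally show ?thesis
    using s t by (intro exI[of _ s] exI[of _ t]) auto
qed

text \<open>The second difference is symmetric in \<open>v\<close> and \<open>w\<close>. Hence the
  two mixed derivatives agree when taken at two suitable points of an arbitrarily small
  parallelogram, and continuity moves both points to \<open>x\<close>.\<close>

lemma second_derivative_symmetric:
  fixes f :: "'a::euclidean_space \<Rightarrow> real"
  assumes S: "open S" "smooth_on S f" and x: "x \<in> S"
  shows "frechet_derivative (\<lambda>y. frechet_derivative f (at y) v) (at x) w =
    frechet_derivative (\<lambda>y. frechet_derivative f (at y) w) (at x) v"
proof -
  have C: "Ck_on 2 S f" using S by (auto simp: smooth_on_def)
  let ?d = "\<lambda>v w y. frechet_derivative (\<lambda>y. frechet_derivative f (at y) v) (at y) w"
  have cont: "continuous_on S (?d v w)" for v w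
    using smooth_on_imp_continuous_on smooth_on_frechet_derivative S(2) by blast
  obtain r where r: "r > 0" "ball x r \<subseteq> S"
    using S(1) x openE by blast
  \<comment> \<open>The summand 1 keeps \<open>N\<close> positive even for \<open>v = w = 0\<close>
    and makes the bound \<open>dist\<close> strict.\<close>
  define N where "N = norm v + norm w + 1"
  have N: "N > 0" unfolding N_def by (smt (verit) norm_ge_zero)
  have dist: "dist x (x + s *\<^sub>R v + t *\<^sub>R w) < h * N" 
    if "0 \<le> s" "s \<le> h" "0 \<le> t" "t \<le> h" "0 < h" for s t h
  proof -
    have "norm (s *\<^sub>R v + t *\<^sub>R w) \<le> s * norm v + t * norm w"
      using norm_triangle_ineq[of "s *\<^sub>R v" "t *\<^sub>R w"] that by simp
    also have "\<dots> \<le> h * norm v + h * norm w"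
      using that by (intro add_mono mult_right_mono) auto
    also have "\<dots> < h * N" using that by (simp add: N_def algebra_simps)
    finally have "norm (- (s *\<^sub>R v + t *\<^sub>R w)) < h * N" by (simp only: norm_minus_cancel)
    then show ?thesis by (simp add: dist_norm)
  qed
  have close: "\<bar>?d v w x - ?d w v x\<bar> \<le> e" if e: "e > 0" for e
  proof -
    obtain d1 where d1: "d1 > 0" "\<And>y. y \<in> S \<Longrightarrow> dist y x < d1 \<Longrightarrow> dist (?d v w y) (?d v w x) < e / 2"
      using cont[of v w] x half_gt_zero[OF e] unfolding continuous_on_iff by metis
    obtain d2 where d2: "d2 > 0" "\<And>y. y \<in> S \<Longrightarrow> dist y x < d2 \<Longrightarrow> dist (?d w v y) (?d w v x) < e / 2"
      using cont[of w v] x half_gt_zero[OF e] unfolding continuous_on_iff by metis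
    \<comment> \<open>With this side the whole parallelogram lies in \<open>S\<close> and in both
      continuity neighbourhoods.\<close>
    define h where "h = min r (min d1 d2) / N"
    have h: "h > 0" "h * N \<le> r" "h * N \<le> d1" "h * N \<le> d2"
      using r d1 d2 N by (auto simp: h_def)
    have near: "x + s *\<^sub>R v + t *\<^sub>R w \<in> S" "dist (x + s *\<^sub>R v + t *\<^sub>R w) x < d1"
       "dist (x + s *\<^sub>R v + t *\<^sub>R w) x < d2"
      if "0 \<le> s" "s \<le> h" "0 \<le> t" "t \<le> h" for s t
      using dist[OF that h(1)] h r by (auto simp: dist_commute subset_iff)
    have near': "x + t *\<^sub>R w + s *\<^sub>R v \<in> S"
      if "0 \<le> t" "t \<le> h" "0 \<le> s" "s \<le> h" for s t
      using near(1)[of s t] that by (simp add: add_ac)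
    obtain s t where st: "0 \<le> s" "s \<le> h" "0 \<le> t" "t \<le> h"
      "f (x + h *\<^sub>R v + h *\<^sub>R w) - f (x + h *\<^sub>R v) - f (x + h *\<^sub>R w) + f x =
        h * h * ?d v w (x + s *\<^sub>R v + t *\<^sub>R w)"
      using second_difference_mvt[OF S(1) C h(1), of x v w] near by blast
    obtain s' t' where st': "0 \<le> s'" "s' \<le> h" "0 \<le> t'" "t' \<le> h"
      "f (x + h *\<^sub>R w + h *\<^sub>R v) - f (x + h *\<^sub>R w) - f (x + h *\<^sub>R v) + f x =
        h * h * ?d w v (x + s' *\<^sub>R w + t' *\<^sub>R v)"
      using second_difference_mvt[OF S(1) C h(1), of x w v] near'(1) by blast
    have "h * h * ?d v w (x + s *\<^sub>R v + t *\<^sub>R w) = h * h * ?d w v (x + t' *\<^sub>R v + s' *\<^sub>R w)"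
      using st(5) st'(5) by (simp add: algebra_simps)
    then have "?d v w (x + s *\<^sub>R v + t *\<^sub>R w) = ?d w v (x + t' *\<^sub>R v + s' *\<^sub>R w)"
      using h(1) by simp
    moreover have "dist (?d v w (x + s *\<^sub>R v + t *\<^sub>R w)) (?d v w x) < e / 2"
      using near[of s t] st d1(2) by blast
    moreover have "dist (?d w v (x + t' *\<^sub>R v + s' *\<^sub>R w)) (?d w v x) < e / 2"
      using near[of t' s'] st' d2(2) by blast
    ultimately show ?thesis unfolding dist_real_def by linarith
  qed
  then have "\<bar>?d v w x - ?d w v x\<bar> \<le> 0"
    by (rule field_le_epsilon[of _ 0, simplified])
  then show ?thesis by simp
qed

section \<open>Charts and derivatives\<close>

lemma chart_props:
  assumes "smooth_atlas \<A>" "c \<in> \<A>"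
  shows "open (fst c)" "open (snd c ` fst c)"
    "homeomorphism (fst c) (snd c ` fst c) (snd c) (chart_inv c)"
  using assms unfolding smooth_atlas_def by blast+

lemma chart_inv_chart [simp]:
  assumes "smooth_atlas \<A>" "c \<in> \<A>" "q \<in> fst c"
  shows "chart_inv c (snd c q) = q"
  using chart_props(3)[OF assms(1,2)] assms(3) by (simp add: homeomorphism_def)

lemma open_chart_image:
  assumes "smooth_atlas \<A>" "c \<in> \<A>" "open U"
  shows "open (snd c ` (U \<inter> fst c))"
proof -
  have "openin (top_of_set (fst c)) (U \<inter> fst c)"
    using assms(3) by (auto simp: openin_open)
  then have "openin (top_of_set (snd c ` fst c)) (snd c ` (U \<inter> fst c))"
    using homeomorphism_imp_open_map[OF chart_props(3)[OF assms(1,2)]] by blast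
  then show ?thesis
    using chart_props(2)[OF assms(1,2)] openin_open_trans by blast
qed

lemma chart_at_props:
  assumes "smooth_atlas \<A>"
  shows "chart_at \<A> p \<in> \<A>" "p \<in> fst (chart_at \<A> p)"
proof -
  have "\<exists>c. c \<in> \<A> \<and> p \<in> fst c"
    using assms unfolding smooth_atlas_def by blast
  from someI_ex[OF this] show "chart_at \<A> p \<in> \<A>" "p \<in> fst (chart_at \<A> p)"
    unfolding chart_at_def by blast+
qed

lemma smooth_on_transition:
  assumes "smooth_atlas \<A>" "c \<in> \<A>" "d \<in> \<A>"
  shows "smooth_on (snd c ` (fst c \<inter> fst d)) (snd d \<circ> chart_inv c)"
  using assms unfolding smooth_atlas_def transition_def by blast

lemma smooth_funD:
  "smooth_fun \<A> U f \<Longrightarrow> c \<in> \<A> \<Longrightarrow> smooth_on (snd c ` (U \<inter> fst c)) (f \<circ> chart_inv c)"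
  by (simp add: smooth_fun_def)

text \<open>\<open>smooth_fun\<close> tests every chart of the atlas; since transitions are smooth,
  one chart around each point already decides.\<close>

lemma smooth_fun_chartI:
  assumes A: "smooth_atlas \<A>"
    and loc: "\<And>p. p \<in> U \<Longrightarrow> \<exists>V c. open V \<and> p \<in> V \<and> c \<in> \<A> \<and> V \<subseteq> fst c \<and>
      smooth_on (snd c ` V) (f \<circ> chart_inv c)"
  shows "smooth_fun \<A> U f"
  unfolding smooth_fun_def
proof (intro ballI smooth_on_locally)
  fix d x assume d: "d \<in> \<A>" and "x \<in> snd d ` (U \<inter> fst d)"
  then obtain p where p: "p \<in> U" "p \<in> fst d" "x = snd d p" by blast
  obtain V c where V: "open V" "p \<in> V" "c \<in> \<A>" "V \<subseteq> fst c"
    "smooth_on (snd c ` V) (f \<circ> chart_inv c)"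
    using loc[OF p(1)] by blast
  let ?T = "snd d ` (V \<inter> fst d)"
  have T: "open ?T" "x \<in> ?T"
    using open_chart_image[OF A d V(1)] p V(2) by auto
  have oV: "open (snd c ` V)"
    using open_chart_image[OF A V(3,1)] V(4) by (simp add: Int_absorb2)
  have tr: "smooth_on ?T (snd c \<circ> chart_inv d)"
    by (rule smooth_on_subset[OF smooth_on_transition[OF A d V(3)]]) (use V(4) in auto)
  have "smooth_on ?T (\<lambda>x. (f \<circ> chart_inv c) ((snd c \<circ> chart_inv d) x))"
    by (rule smooth_on_compose[OF T(1) oV _ V(5) tr]) (use A d in auto)
  then have "smooth_on ?T (f \<circ> chart_inv d)"
    by (rule smooth_on_cong[OF T(1), rotated]) (use A d V in auto)
  then show "\<exists>T. open T \<and> x \<in> T \<and> smooth_on T (f \<circ> chart_inv d)"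
    using T by blast
qed

lemma smooth_fun_subset: "smooth_fun \<A> U f \<Longrightarrow> V \<subseteq> U \<Longrightarrow> smooth_fun \<A> V f"
  unfolding smooth_fun_def by (meson Int_mono image_mono order_refl smooth_on_subset)

lemma smooth_fun_locally:
  assumes A: "smooth_atlas \<A>"
    and loc: "\<And>p. p \<in> U \<Longrightarrow> \<exists>V. open V \<and> p \<in> V \<and> smooth_fun \<A> V f"
  shows "smooth_fun \<A> U f"
proof (rule smooth_fun_chartI[OF A])
  fix p assume "p \<in> U"
  then obtain V where V: "open V" "p \<in> V" "smooth_fun \<A> V f" using loc by blast
  let ?c = "chart_at \<A> p"
  show "\<exists>V c. open V \<and> p \<in> V \<and> c \<in> \<A> \<and> V \<subseteq> fst c \<and> smooth_on (snd c ` V) (f \<circ> chart_inv c)"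
    using V chart_at_props[OF A, of p] chart_props(1)[OF A, of ?c] smooth_funD[OF V(3), of ?c]
    by (intro exI[of _ "V \<inter> fst ?c"] exI[of _ ?c]) auto
qed

lemma smooth_fun_cong:
  assumes A: "smooth_atlas \<A>" and U: "open U" "\<And>p. p \<in> U \<Longrightarrow> f p = g p"
    and f: "smooth_fun \<A> U f"
  shows "smooth_fun \<A> U g"
  unfolding smooth_fun_def
proof
  fix c assume c: "c \<in> \<A>"
  show "smooth_on (snd c ` (U \<inter> fst c)) (g \<circ> chart_inv c)"
    by (rule smooth_on_cong[OF open_chart_image[OF A c U(1)] _ smooth_funD[OF f c]])
      (use A c U(2) in auto)
qed

lemma smooth_fun_const: "smooth_fun \<A> U (\<lambda>p. a)"
  by (simp add: smooth_fun_def smooth_on_const o_def)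

lemma smooth_fun_bounded_linear:
  assumes "smooth_atlas \<A>" "bounded_linear L" "open U" "smooth_fun \<A> U f"
  shows "smooth_fun \<A> U (\<lambda>p. L (f p))"
  using smooth_on_bounded_linear[OF assms(2) open_chart_image[OF assms(1) _ assms(3)]] assms(4)
  by (simp add: smooth_fun_def o_def)

lemma smooth_fun_add:
  assumes "smooth_atlas \<A>" "open U" "smooth_fun \<A> U f" "smooth_fun \<A> U g"
  shows "smooth_fun \<A> U (\<lambda>p. f p + g p)"
  using smooth_on_add[OF open_chart_image[OF assms(1) _ assms(2)] smooth_funD[OF assms(3)] smooth_funD[OF assms(4)]]
  by (simp add: smooth_fun_def o_def)

lemma smooth_fun_sum:
  assumes "smooth_atlas \<A>" "open U" "\<And>i. i \<in> I \<Longrightarrow> smooth_fun \<A> U (f i)"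
  shows "smooth_fun \<A> U (\<lambda>p. \<Sum>i\<in>I. f i p)"
  using smooth_on_sum[OF open_chart_image[OF assms(1) _ assms(2)], of _ I "\<lambda>i. f i \<circ> chart_inv _"] assms(3)
  by (simp add: smooth_fun_def o_def)

lemma smooth_fun_bounded_bilinear:
  assumes "smooth_atlas \<A>" "bounded_bilinear P" "open U" "smooth_fun \<A> U f" "smooth_fun \<A> U g"
  shows "smooth_fun \<A> U (\<lambda>p. P (f p) (g p))"
  using smooth_on_bounded_bilinear[OF assms(2) open_chart_image[OF assms(1) _ assms(3)]] assms(4,5)
  by (simp add: smooth_fun_def o_def)

lemmas smooth_fun_scaleR = smooth_fun_bounded_bilinear[OF _ bounded_bilinear_scaleR]
lemmas smooth_fun_mult =
  smooth_fun_bounded_bilinear[OF _ bounded_bilinear_mult[where 'a = real]]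
lemmas smooth_fun_inner_left = smooth_fun_bounded_linear[OF _ bounded_linear_inner_left]

lemma smooth_fun_compose:
  fixes f :: "'m::{t2_space,second_countable_topology} \<Rightarrow> 'b::euclidean_space"
  assumes A: "smooth_atlas \<A>" and U: "open U" and T: "open T" "\<And>p. p \<in> U \<Longrightarrow> f p \<in> T"
    and h: "smooth_on T h" and f: "smooth_fun \<A> U f"
  shows "smooth_fun \<A> U (\<lambda>p. h (f p))"
  unfolding smooth_fun_def
proof
  fix c assume c: "c \<in> \<A>"
  have "smooth_on (snd c ` (U \<inter> fst c)) (\<lambda>x. h ((f \<circ> chart_inv c) x))"
    using A c T(2)
    by (intro smooth_on_compose[OF open_chart_image[OF A c U] T(1) _ h smooth_funD[OF f c]]) auto
  then show "smooth_on (snd c ` (U \<inter> fst c)) ((\<lambda>p. h (f p)) \<circ> chart_inv c)"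
    by (simp add: o_def)
qed

lemma smooth_fun_imp_continuous_on:
  assumes A: "smooth_atlas \<A>" and U: "open U" and f: "smooth_fun \<A> U f"
  shows "continuous_on U f"
proof (rule continuous_at_imp_continuous_on, rule ballI)
  fix p assume p: "p \<in> U"
  let ?c = "chart_at \<A> p"
  note c = chart_at_props[OF A, of p]
  let ?V = "U \<inter> fst ?c"
  have "continuous_on ?V (snd ?c)"
    using chart_props(3)[OF A c(1)] unfolding homeomorphism_def
    by (meson continuous_on_subset inf_le2)
  then have "continuous_on ?V ((f \<circ> chart_inv ?c) \<circ> snd ?c)"
    using smooth_on_imp_continuous_on[OF smooth_funD[OF f c(1)]] continuous_on_compose by blast
  then have "continuous_on ?V f"
    by (rule continuous_on_eq) (use A c in auto)
  then show "isCont f p"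
    using continuous_on_interior[of ?V f p] p c U chart_props(1)[OF A c(1)]
    by (simp add: interior_open open_Int)
qed

text \<open>Common form of \<open>tcomp\<close>, \<open>differential\<close> and
  \<open>tangent_map\<close>, which all differentiate in the preferred chart of the point. Here the
  chart is a parameter, so it can stay fixed while \<open>q\<close> varies; otherwise the result
  could not be differentiated again.\<close>

definition chart_deriv ::
    "('m, 'e::euclidean_space) chart \<Rightarrow> ('m \<Rightarrow> 'b::real_normed_vector) \<Rightarrow> 'm \<Rightarrow> 'e \<Rightarrow> 'b" where
  "chart_deriv c f q v = frechet_derivative (f \<circ> chart_inv c) (at (snd c q)) v"

lemma tcomp_chart_deriv: "tcomp \<A> d p v = chart_deriv (chart_at \<A> p) (snd d) p v"
  by (simp add: tcomp_def chart_deriv_def transition_def)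

lemma differential_chart_deriv: "differential \<A> f p v = chart_deriv (chart_at \<A> p) f p v"
  by (simp add: differential_def chart_deriv_def)

lemma tangent_map_chart_deriv:
  "tangent_map \<A> \<B> F p v = chart_deriv (chart_at \<A> p) (snd (chart_at \<B> (F p)) \<circ> F) p v"
  by (simp add: tangent_map_def chart_deriv_def)

lemma chart_deriv_works:
  assumes A: "smooth_atlas \<A>" and U: "open U" "q \<in> U" and f: "smooth_fun \<A> U f"
    and c: "c \<in> \<A>" "q \<in> fst c"
  shows "(f \<circ> chart_inv c has_derivative chart_deriv c f q) (at (snd c q))"
proof -
  have "f \<circ> chart_inv c differentiable at (snd c q)"
    using smooth_on_imp_differentiable[OF smooth_funD[OF f c(1)]] U c by blast
  moreover have "chart_deriv c f q = frechet_derivative (f \<circ> chart_inv c) (at (snd c q))"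
    by (auto simp: chart_deriv_def)
  ultimately show ?thesis
    using frechet_derivative_works by auto
qed

lemma chart_deriv_linear:
  assumes "smooth_atlas \<A>" "open U" "q \<in> U" "smooth_fun \<A> U f" "c \<in> \<A>" "q \<in> fst c"
  shows "linear (chart_deriv c f q)"
  using chart_deriv_works[OF assms] has_derivative_linear by blast

lemma chart_deriv_Basis:
  assumes "smooth_atlas \<A>" "open U" "q \<in> U" "smooth_fun \<A> U f" "c \<in> \<A>" "q \<in> fst c"
  shows "chart_deriv c f q v = (\<Sum>b\<in>Basis. (v \<bullet> b) *\<^sub>R chart_deriv c f q b)"
  using chart_deriv_linear[OF assms]
  by (subst euclidean_representation[symmetric, of v]) (simp add: linear_sum linear_cmul)

lemma chart_deriv_eqI:
  "(f \<circ> chart_inv c has_derivative D) (at (snd c q)) \<Longrightarrow> chart_deriv c f q = D"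
  using frechet_derivative_at by (fastforce simp: chart_deriv_def)

lemma chart_deriv_cong:
  assumes A: "smooth_atlas \<A>" and U: "open U" "q \<in> U" and f: "smooth_fun \<A> U f"
    and c: "c \<in> \<A>" "q \<in> fst c" and eq: "\<And>p. p \<in> U \<Longrightarrow> f p = g p"
  shows "chart_deriv c g q = chart_deriv c f q"
proof (rule chart_deriv_eqI)
  show "(g \<circ> chart_inv c has_derivative chart_deriv c f q) (at (snd c q))"
    by (rule has_derivative_transform_within_open[OF chart_deriv_works[OF A U f c]
          open_chart_image[OF A c(1) U(1)]])
      (use A U c eq in auto)
qed

lemma chart_deriv_const: "chart_deriv c (\<lambda>p. a) q v = 0"
  by (simp add: chart_deriv_def o_def)

lemma chart_deriv_bounded_linear:
  assumes "bounded_linear L" "smooth_atlas \<A>" "open U" "q \<in> U" "smooth_fun \<A> U f" "c \<in> \<A>" "q \<in> fst c"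
  shows "chart_deriv c (\<lambda>p. L (f p)) q v = L (chart_deriv c f q v)"
  using chart_deriv_eqI[of "\<lambda>p. L (f p)" c "\<lambda>v. L (chart_deriv c f q v)"]
    bounded_linear.has_derivative[OF assms(1) chart_deriv_works[OF assms(2-)]]
  by (simp add: o_def)

lemma chart_deriv_sum:
  assumes "smooth_atlas \<A>" "open U" "q \<in> U" "\<And>i. i \<in> I \<Longrightarrow> smooth_fun \<A> U (f i)" "c \<in> \<A>" "q \<in> fst c"
  shows "chart_deriv c (\<lambda>p. \<Sum>i\<in>I. f i p) q v = (\<Sum>i\<in>I. chart_deriv c (f i) q v)"
proof -
  have "((\<lambda>x. \<Sum>i\<in>I. (f i \<circ> chart_inv c) x) has_derivative (\<lambda>v. \<Sum>i\<in>I. chart_deriv c (f i) q v)) (at (snd c q))"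
    by (intro has_derivative_sum chart_deriv_works[OF assms(1-4) assms(5,6)])
  then show ?thesis
    using chart_deriv_eqI[of "\<lambda>p. \<Sum>i\<in>I. f i p" c "\<lambda>v. \<Sum>i\<in>I. chart_deriv c (f i) q v"]
    by (simp add: o_def)
qed

lemma chart_deriv_add:
  assumes "smooth_atlas \<A>" "open U" "q \<in> U" "smooth_fun \<A> U f" "smooth_fun \<A> U g" "c \<in> \<A>" "q \<in> fst c"
  shows "chart_deriv c (\<lambda>p. f p + g p) q v = chart_deriv c f q v + chart_deriv c g q v"
  using chart_deriv_eqI[of "\<lambda>p. f p + g p" c "\<lambda>v. chart_deriv c f q v + chart_deriv c g q v"]
    has_derivative_add[OF chart_deriv_works[OF assms(1-4,6,7)] chart_deriv_works[OF assms(1-3,5-7)]]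
  by (simp add: o_def)

lemma chart_deriv_bounded_bilinear:
  assumes "bounded_bilinear P"
    and "smooth_atlas \<A>" "open U" "q \<in> U" "smooth_fun \<A> U f" "smooth_fun \<A> U g" "c \<in> \<A>" "q \<in> fst c"
  shows "chart_deriv c (\<lambda>p. P (f p) (g p)) q v =
    P (f q) (chart_deriv c g q v) + P (chart_deriv c f q v) (g q)"
proof -
  have "((\<lambda>p. P (f p) (g p)) \<circ> chart_inv c has_derivative
    (\<lambda>v. P (f q) (chart_deriv c g q v) + P (chart_deriv c f q v) (g q))) (at (snd c q))"
    using bounded_bilinear.FDERIV[OF assms(1) chart_deriv_works[OF assms(2-5,7,8)]
      chart_deriv_works[OF assms(2-4,6-8)]] assms
    by (simp add: o_def)
  from chart_deriv_eqI[OF this] show ?thesis by simp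
qed

lemma smooth_map_smooth_fun:
  "smooth_map \<A> \<B> F \<Longrightarrow> d \<in> \<B> \<Longrightarrow> smooth_fun \<A> (F -` fst d) (snd d \<circ> F)"
  by (simp add: smooth_map_def)

lemma smooth_map_open_vimage: "smooth_map \<A> \<B> F \<Longrightarrow> open V \<Longrightarrow> open (F -` V)"
  by (simp add: smooth_map_def open_vimage)

lemma smooth_map_ident:
  assumes "smooth_atlas \<A>"
  shows "smooth_map \<A> \<A> (\<lambda>p. p)"
proof -
  have "smooth_on (snd c ` (fst d \<inter> fst c)) (\<lambda>x. snd d (chart_inv c x))"
    if "c \<in> \<A>" "d \<in> \<A>" for c d
    using smooth_on_transition[OF assms that] by (simp add: o_def Int_commute)
  then show ?thesis
    by (simp add: smooth_map_def smooth_fun_def o_def continuous_on_id)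
qed

lemma smooth_fun_chart:
  assumes "smooth_atlas \<A>" "d \<in> \<A>"
  shows "smooth_fun \<A> (fst d) (snd d)"
  using smooth_map_smooth_fun[OF smooth_map_ident[OF assms(1)] assms(2)] by (simp add: o_def)

text \<open>Chain rule for \<open>h \<circ> chart_inv d\<close> after the coordinate expression of
  \<open>F\<close>. With \<open>F\<close> the identity it becomes the rule for changing
  charts.\<close>

lemma chart_deriv_compose_map:
  assumes A: "smooth_atlas \<A>" and B: "smooth_atlas \<B>" and F: "smooth_map \<A> \<B> F"
    and V: "open V" "F q \<in> V" and h: "smooth_fun \<B> V h"
    and c: "c \<in> \<A>" "q \<in> fst c" and d: "d \<in> \<B>" "F q \<in> fst d"
  shows "chart_deriv c (h \<circ> F) q v = chart_deriv d h (F q) (chart_deriv c (snd d \<circ> F) q v)"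
proof -
  note o = smooth_map_open_vimage[OF F chart_props(1)[OF B d(1)]]
  have 1: "(snd d \<circ> F \<circ> chart_inv c has_derivative chart_deriv c (snd d \<circ> F) q) (at (snd c q))"
    using chart_deriv_works[OF A o _ smooth_map_smooth_fun[OF F d(1)] c] d by simp
  have 2: "(h \<circ> chart_inv d has_derivative chart_deriv d h (F q)) (at ((snd d \<circ> F \<circ> chart_inv c) (snd c q)))"
    using chart_deriv_works[OF B V h d] A c by simp
  have "((h \<circ> chart_inv d) \<circ> (snd d \<circ> F \<circ> chart_inv c) has_derivative
      chart_deriv d h (F q) \<circ> chart_deriv c (snd d \<circ> F) q) (at (snd c q))"
    by (rule diff_chain_at[OF 1 2])
  then have "(h \<circ> F \<circ> chart_inv c has_derivative
      chart_deriv d h (F q) \<circ> chart_deriv c (snd d \<circ> F) q) (at (snd c q))"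
    by (rule has_derivative_transform_within_open[OF _ open_chart_image[OF A c(1) o]])
      (use A B c d in auto)
  from chart_deriv_eqI[OF this] show ?thesis by simp
qed

lemma smooth_fun_compose_map:
  assumes A: "smooth_atlas \<A>" and B: "smooth_atlas \<B>" and F: "smooth_map \<A> \<B> F"
    and V: "open V" and h: "smooth_fun \<B> V h"
  shows "smooth_fun \<A> (F -` V) (h \<circ> F)"
proof (rule smooth_fun_locally[OF A])
  fix p assume p: "p \<in> F -` V"
  let ?d = "chart_at \<B> (F p)"
  note d = chart_at_props[OF B, of "F p"]
  let ?W = "F -` (V \<inter> fst ?d)"
  have W: "open ?W"
    using smooth_map_open_vimage[OF F] V chart_props(1)[OF B d(1)] by blast
  have "smooth_fun \<A> ?W (\<lambda>p. (h \<circ> chart_inv ?d) ((snd ?d \<circ> F) p))"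
    by (rule smooth_fun_compose[OF A W open_chart_image[OF B d(1) V] _ smooth_funD[OF h d(1)]
          smooth_fun_subset[OF smooth_map_smooth_fun[OF F d(1)]]]) auto
  then have "smooth_fun \<A> ?W (h \<circ> F)"
    by (rule smooth_fun_cong[OF A W, rotated]) (use B d in auto)
  then show "\<exists>V'. open V' \<and> p \<in> V' \<and> smooth_fun \<A> V' (h \<circ> F)"
    using W p d by auto
qed

lemma chart_deriv_change:
  assumes "smooth_atlas \<A>" "open U" "q \<in> U" "smooth_fun \<A> U f" "c \<in> \<A>" "q \<in> fst c" "d \<in> \<A>" "q \<in> fst d"
  shows "chart_deriv c f q v = chart_deriv d f q (chart_deriv c (snd d) q v)"
  using chart_deriv_compose_map[OF assms(1,1) smooth_map_ident[OF assms(1)] assms(2-)]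
  by (simp add: o_def)

lemma chart_deriv_chart:
  assumes A: "smooth_atlas \<A>" and c: "c \<in> \<A>" "q \<in> fst c"
  shows "chart_deriv c (snd c) q v = v"
proof -
  have "(snd c \<circ> chart_inv c has_derivative (\<lambda>v. v)) (at (snd c q))"
    by (rule has_derivative_transform_within_open[OF has_derivative_ident chart_props(2)[OF A c(1)]])
      (use A c in \<open>auto\<close>)
  from chart_deriv_eqI[OF this] show ?thesis by simp
qed

lemma smooth_fun_chart_deriv:
  assumes A: "smooth_atlas \<A>" and U: "open U" and f: "smooth_fun \<A> U f" and c: "c \<in> \<A>"
  shows "smooth_fun \<A> (U \<inter> fst c) (\<lambda>q. chart_deriv c f q v)"
proof (rule smooth_fun_chartI[OF A])
  fix p assume p: "p \<in> U \<inter> fst c"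
  have "smooth_on (snd c ` (U \<inter> fst c)) ((\<lambda>q. chart_deriv c f q v) \<circ> chart_inv c)"
    by (rule smooth_on_cong[OF open_chart_image[OF A c U] _
          smooth_on_frechet_derivative[OF smooth_funD[OF f c], of v]])
      (use A c in \<open>auto simp: chart_deriv_def\<close>)
  then show "\<exists>V d. open V \<and> p \<in> V \<and> d \<in> \<A> \<and> V \<subseteq> fst d \<and>
      smooth_on (snd d ` V) ((\<lambda>q. chart_deriv c f q v) \<circ> chart_inv d)"
    using p U c chart_props(1)[OF A c]
    by (intro exI[of _ "U \<inter> fst c"] exI[of _ c]) auto
qed

text \<open>In one fixed chart the coordinate expression of \<open>chart_deriv c f\<close> is the
  Frechet derivative of \<open>f \<circ> chart_inv c\<close> near the point, so the Euclidean
  symmetry transfers.\<close>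

lemma chart_deriv_symmetric:
  fixes f :: "'m::{t2_space,second_countable_topology} \<Rightarrow> real"
  assumes A: "smooth_atlas \<A>" and U: "open U" "p \<in> U" and f: "smooth_fun \<A> U f"
    and c: "c \<in> \<A>" "p \<in> fst c"
  shows "chart_deriv c (\<lambda>q. chart_deriv c f q v) p w = chart_deriv c (\<lambda>q. chart_deriv c f q w) p v"
proof -
  let ?S = "snd c ` (U \<inter> fst c)"
  have S: "open ?S" "snd c p \<in> ?S"
    using open_chart_image[OF A c(1) U(1)] U c by auto
  have "chart_deriv c (\<lambda>q. chart_deriv c f q v) p w =
      frechet_derivative (\<lambda>y. frechet_derivative (f \<circ> chart_inv c) (at y) v) (at (snd c p)) w" for v w
  proof -
    have "((\<lambda>q. chart_deriv c f q v) \<circ> chart_inv c has_derivative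
        chart_deriv c (\<lambda>q. chart_deriv c f q v) p) (at (snd c p))"
      using chart_deriv_works[OF A _ _ smooth_fun_chart_deriv[OF A U(1) f c(1)] c] U c chart_props(1)[OF A c(1)] by auto
    then have "((\<lambda>y. frechet_derivative (f \<circ> chart_inv c) (at y) v) has_derivative
        chart_deriv c (\<lambda>q. chart_deriv c f q v) p) (at (snd c p))"
      by (rule has_derivative_transform_within_open[OF _ S])
        (use A c in \<open>auto simp: chart_deriv_def\<close>)
    from frechet_derivative_at[OF this] show ?thesis by simp
  qed
  then show ?thesis
    using second_derivative_symmetric[OF S(1) smooth_funD[OF f c(1)] S(2)] by simp
qed

section \<open>Vector fields and frames\<close>

lemma linear_tcomp:
  assumes "smooth_atlas \<A>" "d \<in> \<A>" "p \<in> fst d"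
  shows "linear (tcomp \<A> d p)"
proof -
  have "tcomp \<A> d p = chart_deriv (chart_at \<A> p) (snd d) p"
    by (auto simp: tcomp_chart_deriv)
  then show ?thesis
    using chart_deriv_linear[OF assms(1) chart_props(1)[OF assms(1,2)] assms(3)
      smooth_fun_chart[OF assms(1,2)] chart_at_props[OF assms(1)]] by simp
qed

lemma tcomp_change:
  assumes "smooth_atlas \<A>" "c \<in> \<A>" "p \<in> fst c" "d \<in> \<A>" "p \<in> fst d"
  shows "tcomp \<A> d p v = chart_deriv c (snd d) p (tcomp \<A> c p v)"
  using chart_deriv_change[OF assms(1) chart_props(1)[OF assms(1,4)] assms(5)
      smooth_fun_chart[OF assms(1,4)] chart_at_props[OF assms(1)] assms(2,3)]
  by (simp add: tcomp_chart_deriv)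

lemma tcomp_chart_at: "smooth_atlas \<A> \<Longrightarrow> tcomp \<A> (chart_at \<A> p) p v = v"
  using chart_deriv_chart[OF _ chart_at_props] by (simp add: tcomp_chart_deriv)

text \<open>The coordinate vector field of \<open>c\<close> with constant components
  \<open>v\<close>, rewritten at each \<open>q\<close> in the preferred chart there, as the encoding
  of vector fields demands.\<close>

definition chart_field ::
    "('m, 'e::euclidean_space) chart set \<Rightarrow> ('m, 'e) chart \<Rightarrow> 'e \<Rightarrow> 'm \<Rightarrow> 'e" where
  "chart_field \<A> c v q = chart_deriv c (snd (chart_at \<A> q)) q v"

text \<open>The Jacobians from \<open>c\<close> to the preferred chart and back compose to the
  identity by the chain rule.\<close>

lemma tcomp_chart_field:
  assumes A: "smooth_atlas \<A>" and c: "c \<in> \<A>" "q \<in> fst c"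
  shows "tcomp \<A> c q (chart_field \<A> c v q) = v"
  using chart_deriv_change[OF A chart_props(1)[OF A c(1)] c(2) smooth_fun_chart[OF A c(1)] c
      chart_at_props[OF A]] chart_deriv_chart[OF A c]
  by (simp add: tcomp_chart_deriv chart_field_def)

lemma chart_field_tcomp:
  assumes A: "smooth_atlas \<A>" and c: "c \<in> \<A>" "q \<in> fst c"
  shows "chart_field \<A> c (tcomp \<A> c q u) q = u"
proof -
  note c0 = chart_at_props[OF A, of q]
  show ?thesis
    using chart_deriv_change[OF A chart_props(1)[OF A c0(1)] c0(2) smooth_fun_chart[OF A c0(1)] c0 c]
      chart_deriv_chart[OF A c0]
    by (simp add: tcomp_chart_deriv chart_field_def)
qed

lemma chart_field_Basis:
  assumes A: "smooth_atlas \<A>" and c: "c \<in> \<A>" "q \<in> fst c"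
  shows "u = (\<Sum>b\<in>Basis. (tcomp \<A> c q u \<bullet> b) *\<^sub>R chart_field \<A> c b q)"
proof -
  note c0 = chart_at_props[OF A, of q]
  show ?thesis
    using chart_deriv_Basis[OF A chart_props(1)[OF A c0(1)] c0(2) smooth_fun_chart[OF A c0(1)] c,
        of "tcomp \<A> c q u"]
      chart_field_tcomp[OF A c, of u]
    by (simp add: chart_field_def)
qed

lemma chart_field_chart_at: "smooth_atlas \<A> \<Longrightarrow> chart_field \<A> (chart_at \<A> p) v p = v"
  by (metis chart_field_tcomp tcomp_chart_at chart_at_props)

lemma differential_tcomp:
  assumes "smooth_atlas \<A>" "open U" "q \<in> U" "smooth_fun \<A> U f" "c \<in> \<A>" "q \<in> fst c"
  shows "differential \<A> f q u = chart_deriv c f q (tcomp \<A> c q u)"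
  using chart_deriv_change[OF assms(1-4) chart_at_props[OF assms(1)] assms(5,6)]
  by (simp add: differential_chart_deriv tcomp_chart_deriv)

lemma differential_cong:
  assumes "smooth_atlas \<A>" "open U" "q \<in> U" "smooth_fun \<A> U f" "\<And>p. p \<in> U \<Longrightarrow> f p = g p"
  shows "differential \<A> g q u = differential \<A> f q u"
  using chart_deriv_cong[OF assms(1-4) chart_at_props[OF assms(1)] assms(5)]
  by (simp add: differential_chart_deriv)

lemma differential_const: "differential \<A> (\<lambda>p. a) q u = 0"
  by (simp add: differential_chart_deriv chart_deriv_const)

lemma differential_add:
  assumes "smooth_atlas \<A>" "open U" "q \<in> U" "smooth_fun \<A> U f" "smooth_fun \<A> U g"
  shows "differential \<A> (\<lambda>p. f p + g p) q u = differential \<A> f q u + differential \<A> g q u"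
  using chart_deriv_add[OF assms chart_at_props[OF assms(1)]]
  by (simp add: differential_chart_deriv)

lemma differential_sum:
  assumes "smooth_atlas \<A>" "open U" "q \<in> U" "\<And>i. i \<in> I \<Longrightarrow> smooth_fun \<A> U (f i)"
  shows "differential \<A> (\<lambda>p. \<Sum>i\<in>I. f i p) q u = (\<Sum>i\<in>I. differential \<A> (f i) q u)"
  using chart_deriv_sum[OF assms chart_at_props[OF assms(1)]]
  by (simp add: differential_chart_deriv)

lemma differential_mult:
  assumes "smooth_atlas \<A>" "open U" "q \<in> U" "smooth_fun \<A> U f" "smooth_fun \<A> U g"
  shows "differential \<A> (\<lambda>p. f p * g p) q u = f q * differential \<A> g q u + differential \<A> f q u * g q"
  using chart_deriv_bounded_bilinear[OF bounded_bilinear_mult assms chart_at_props[OF assms(1)]]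
  by (simp add: differential_chart_deriv)

lemma tcomp_tangent_map:
  assumes A: "smooth_atlas \<A>" and B: "smooth_atlas \<B>" and F: "smooth_map \<A> \<B> F"
    and c: "c \<in> \<A>" "q \<in> fst c" and d: "d \<in> \<B>" "F q \<in> fst d"
  shows "tcomp \<B> d (F q) (tangent_map \<A> \<B> F q u) = chart_deriv c (snd d \<circ> F) q (tcomp \<A> c q u)"
proof -
  note c0 = chart_at_props[OF A, of q] and d0 = chart_at_props[OF B, of "F q"]
  have "tcomp \<B> d (F q) (tangent_map \<A> \<B> F q u) = chart_deriv (chart_at \<A> q) (snd d \<circ> F) q u"
    using chart_deriv_compose_map[OF A B F chart_props(1)[OF B d(1)] d(2) smooth_fun_chart[OF B d(1)] c0 d0, of u]
    by (simp add: tcomp_chart_deriv tangent_map_chart_deriv)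
  also have "\<dots> = chart_deriv c (snd d \<circ> F) q (tcomp \<A> c q u)"
    using chart_deriv_change[OF A smooth_map_open_vimage[OF F chart_props(1)[OF B d(1)]] _
        smooth_map_smooth_fun[OF F d(1)] c0 c] d
    by (simp add: tcomp_chart_deriv)
  finally show ?thesis .
qed

lemma linear_tangent_map:
  assumes A: "smooth_atlas \<A>" and B: "smooth_atlas \<B>" and F: "smooth_map \<A> \<B> F"
  shows "linear (tangent_map \<A> \<B> F q)"
proof -
  note c0 = chart_at_props[OF A, of q] and d0 = chart_at_props[OF B, of "F q"]
  have "tangent_map \<A> \<B> F q = chart_deriv (chart_at \<A> q) (snd (chart_at \<B> (F q)) \<circ> F) q"
    by (auto simp: tangent_map_chart_deriv)
  then show ?thesis
    using chart_deriv_linear[OF A smooth_map_open_vimage[OF F chart_props(1)[OF B d0(1)]] _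
        smooth_map_smooth_fun[OF F d0(1)] c0] d0 by simp
qed

lemma differential_compose_map:
  assumes A: "smooth_atlas \<A>" and B: "smooth_atlas \<B>" and F: "smooth_map \<A> \<B> F"
    and V: "open V" "F q \<in> V" and h: "smooth_fun \<B> V h"
  shows "differential \<A> (h \<circ> F) q v = differential \<B> h (F q) (tangent_map \<A> \<B> F q v)"
  using chart_deriv_compose_map[OF A B F V h chart_at_props[OF A] chart_at_props[OF B]]
  by (simp add: differential_chart_deriv tangent_map_chart_deriv)

section \<open>Vector fields along a map\<close>

lemma fields_alongD:
  "Z \<in> fields_along \<A> \<B> F U \<Longrightarrow> d \<in> \<B> \<Longrightarrow>
    smooth_fun \<A> (U \<inter> F -` fst d) (\<lambda>p. tcomp \<B> d (F p) (Z p))"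
  by (simp add: fields_along_def)

text \<open>Components in another target chart are linear combinations of the given ones, with the
  Jacobian entries of the chart change as smooth coefficients. One chart around each image point
  therefore decides.\<close>

lemma fields_alongI:
  assumes A: "smooth_atlas \<A>" and B: "smooth_atlas \<B>" and F: "smooth_map \<A> \<B> F"
    and loc: "\<And>p. p \<in> U \<Longrightarrow> \<exists>V d. open V \<and> p \<in> V \<and> d \<in> \<B> \<and> V \<subseteq> F -` fst d \<and>
      smooth_fun \<A> V (\<lambda>p. tcomp \<B> d (F p) (Z p))"
  shows "Z \<in> fields_along \<A> \<B> F U"
  unfolding fields_along_def
proof (intro CollectI ballI smooth_fun_locally[OF A])
  fix d' p assume d': "d' \<in> \<B>" and p: "p \<in> U \<inter> F -` fst d'"
  then obtain V d where V: "open V" "p \<in> V" "V \<subseteq> F -` fst d" and d: "d \<in> \<B>"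
    and Z: "smooth_fun \<A> V (\<lambda>p. tcomp \<B> d (F p) (Z p))"
    using loc by blast
  let ?W = "V \<inter> F -` (fst d' \<inter> fst d)"
  have o: "open (fst d' \<inter> fst d)" using chart_props(1)[OF B] d d' by blast
  have W: "open ?W" "p \<in> ?W"
    using V p smooth_map_open_vimage[OF F o] by auto
  have coeff: "smooth_fun \<A> ?W ((\<lambda>q. chart_deriv d (snd d') q b) \<circ> F)" for b
    using smooth_fun_compose_map[OF A B F o
        smooth_fun_chart_deriv[OF B chart_props(1)[OF B d'] smooth_fun_chart[OF B d'] d]]
    by (rule smooth_fun_subset) auto
  have "smooth_fun \<A> ?W (\<lambda>q. \<Sum>b\<in>Basis. (tcomp \<B> d (F q) (Z q) \<bullet> b) *\<^sub>R
      ((\<lambda>q. chart_deriv d (snd d') q b) \<circ> F) q)"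
    by (intro smooth_fun_sum[OF A W(1)] smooth_fun_scaleR[OF A W(1)]
          smooth_fun_inner_left[OF A W(1)] smooth_fun_subset[OF Z] coeff) auto
  moreover have "(\<Sum>b\<in>Basis. (tcomp \<B> d (F q) (Z q) \<bullet> b) *\<^sub>R
      ((\<lambda>q. chart_deriv d (snd d') q b) \<circ> F) q) = tcomp \<B> d' (F q) (Z q)" if q: "q \<in> ?W" for q
  proof -
    have "F q \<in> fst d" "F q \<in> fst d'" using q by auto
    then show ?thesis
      using tcomp_change[OF B d _ d', of "F q" "Z q"]
        chart_deriv_Basis[OF B chart_props(1)[OF B d'] _ smooth_fun_chart[OF B d'] d, of "F q" "tcomp \<B> d (F q) (Z q)"]
      by simp
  qed
  ultimately have "smooth_fun \<A> ?W (\<lambda>p. tcomp \<B> d' (F p) (Z p))"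
    using smooth_fun_cong[OF A W(1)] by (metis (no_types, lifting))
  then show "\<exists>V. open V \<and> p \<in> V \<and> smooth_fun \<A> V (\<lambda>p. tcomp \<B> d' (F p) (Z p))"
    using W by blast
qed

lemma fields_along_subset: "Z \<in> fields_along \<A> \<B> F U \<Longrightarrow> V \<subseteq> U \<Longrightarrow> Z \<in> fields_along \<A> \<B> F V"
  unfolding fields_along_def by (blast intro: smooth_fun_subset)

context
  fixes \<A> :: "('m::{t2_space,second_countable_topology}, 'e::euclidean_space) chart set"
    and \<B> :: "('w::{t2_space,second_countable_topology}, 'f::euclidean_space) chart set"
    and F :: "'m \<Rightarrow> 'w"
  assumes A: "smooth_atlas \<A>" and B: "smooth_atlas \<B>" and F: "smooth_map \<A> \<B> F"
begin

lemma open_vimage_chart: "d \<in> \<B> \<Longrightarrow> open (F -` fst d)"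
  using smooth_map_open_vimage[OF F chart_props(1)[OF B]] .

lemma fields_along_cong:
  assumes U: "open U" "\<And>p. p \<in> U \<Longrightarrow> Z p = Z' p" and Z: "Z \<in> fields_along \<A> \<B> F U"
  shows "Z' \<in> fields_along \<A> \<B> F U"
  unfolding fields_along_def
proof (intro CollectI ballI)
  fix d assume d: "d \<in> \<B>"
  show "smooth_fun \<A> (U \<inter> F -` fst d) (\<lambda>p. tcomp \<B> d (F p) (Z' p))"
    by (rule smooth_fun_cong[OF A _ _ fields_alongD[OF Z d]])
      (use U open_vimage_chart[OF d] in auto)
qed

lemma fields_along_add:
  assumes U: "open U" and Z: "Z \<in> fields_along \<A> \<B> F U" "Z' \<in> fields_along \<A> \<B> F U"
  shows "(\<lambda>p. Z p + Z' p) \<in> fields_along \<A> \<B> F U"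
  unfolding fields_along_def
proof (intro CollectI ballI)
  fix d assume d: "d \<in> \<B>"
  have o: "open (U \<inter> F -` fst d)" using U open_vimage_chart[OF d] by blast
  show "smooth_fun \<A> (U \<inter> F -` fst d) (\<lambda>p. tcomp \<B> d (F p) (Z p + Z' p))"
    by (rule smooth_fun_cong[OF A o _ smooth_fun_add[OF A o fields_alongD[OF Z(1) d] fields_alongD[OF Z(2) d]]])
      (use linear_tcomp[OF B d] in \<open>auto simp: linear_add\<close>)
qed

lemma fields_along_scaleR:
  assumes U: "open U" and f: "smooth_fun \<A> U f" and Z: "Z \<in> fields_along \<A> \<B> F U"
  shows "(\<lambda>p. f p *\<^sub>R Z p) \<in> fields_along \<A> \<B> F U"
  unfolding fields_along_def
proof (intro CollectI ballI)
  fix d assume d: "d \<in> \<B>"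
  have o: "open (U \<inter> F -` fst d)" using U open_vimage_chart[OF d] by blast
  show "smooth_fun \<A> (U \<inter> F -` fst d) (\<lambda>p. tcomp \<B> d (F p) (f p *\<^sub>R Z p))"
    by (rule smooth_fun_cong[OF A o _ smooth_fun_scaleR[OF A o smooth_fun_subset[OF f] fields_alongD[OF Z d]]])
      (use linear_tcomp[OF B d] in \<open>auto simp: linear_cmul\<close>)
qed

lemma fields_along_zero: "(\<lambda>p. 0) \<in> fields_along \<A> \<B> F U"
  unfolding fields_along_def
proof (intro CollectI ballI)
  fix d assume d: "d \<in> \<B>"
  show "smooth_fun \<A> (U \<inter> F -` fst d) (\<lambda>p. tcomp \<B> d (F p) 0)"
  proof (rule smooth_fun_subset)
    show "smooth_fun \<A> (F -` fst d) (\<lambda>p. tcomp \<B> d (F p) 0)"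
      by (rule smooth_fun_cong[OF A open_vimage_chart[OF d] _ smooth_fun_const])
        (use linear_tcomp[OF B d] in \<open>auto simp: linear_0\<close>)
  qed auto
qed

lemma fields_along_sum:
  assumes U: "open U" and Z: "\<And>i. i \<in> I \<Longrightarrow> Z i \<in> fields_along \<A> \<B> F U"
  shows "(\<lambda>p. \<Sum>i\<in>I. Z i p) \<in> fields_along \<A> \<B> F U"
proof (cases "finite I")
  case True
  then show ?thesis using Z
    by (induction I) (auto intro: fields_along_zero fields_along_add[OF U])
qed (simp add: fields_along_zero)

lemma fields_along_minus:
  assumes U: "open U" and Z: "Z \<in> fields_along \<A> \<B> F U" "Z' \<in> fields_along \<A> \<B> F U"
  shows "(\<lambda>p. Z p - Z' p) \<in> fields_along \<A> \<B> F U"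
  using fields_along_add[OF U Z(1) fields_along_scaleR[OF U smooth_fun_const[of _ _ "-1"] Z(2)]]
  by simp

lemma chart_field_along:
  assumes d: "d \<in> \<B>"
  shows "(\<lambda>p. chart_field \<B> d v (F p)) \<in> fields_along \<A> \<B> F (F -` fst d)"
proof (rule fields_alongI[OF A B F])
  fix p assume p: "p \<in> F -` fst d"
  have "smooth_fun \<A> (F -` fst d) (\<lambda>p. tcomp \<B> d (F p) (chart_field \<B> d v (F p)))"
    by (rule smooth_fun_cong[OF A open_vimage_chart[OF d] _ smooth_fun_const])
      (use tcomp_chart_field[OF B d] in auto)
  then show "\<exists>V d'. open V \<and> p \<in> V \<and> d' \<in> \<B> \<and> V \<subseteq> F -` fst d' \<and>
      smooth_fun \<A> V (\<lambda>p. tcomp \<B> d' (F p) (chart_field \<B> d v (F p)))"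
    using d p open_vimage_chart[OF d] by blast
qed

lemma tangent_map_along:
  assumes U: "open U" and X: "X \<in> vector_fields \<A> U"
  shows "(\<lambda>q. tangent_map \<A> \<B> F q (X q)) \<in> fields_along \<A> \<B> F U"
proof (rule fields_alongI[OF A B F])
  fix p assume p: "p \<in> U"
  let ?c = "chart_at \<A> p" and ?d = "chart_at \<B> (F p)"
  note c = chart_at_props[OF A, of p] and d = chart_at_props[OF B, of "F p"]
  let ?W = "U \<inter> (F -` fst ?d \<inter> fst ?c)"
  have o: "open (F -` fst ?d)" using open_vimage_chart[OF d(1)] .
  have W: "open ?W" using U chart_props(1)[OF A c(1)] o by blast
  have x: "smooth_fun \<A> (U \<inter> fst ?c) (\<lambda>q. tcomp \<A> ?c q (X q))"
    using fields_alongD[of X \<A> \<A> "\<lambda>p. p" U, OF _ c(1)] X by (simp add: vector_fields_def)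
  have "smooth_fun \<A> ?W (\<lambda>q. \<Sum>b\<in>Basis. (tcomp \<A> ?c q (X q) \<bullet> b) *\<^sub>R chart_deriv ?c (snd ?d \<circ> F) q b)"
    by (intro smooth_fun_sum[OF A W] smooth_fun_scaleR[OF A W] smooth_fun_inner_left[OF A W]
         smooth_fun_subset[OF x]
         smooth_fun_subset[OF smooth_fun_chart_deriv[OF A o smooth_map_smooth_fun[OF F d(1)] c(1)]]) auto
  then have "smooth_fun \<A> ?W (\<lambda>q. tcomp \<B> ?d (F q) (tangent_map \<A> \<B> F q (X q)))"
  proof (rule smooth_fun_cong[OF A W, rotated])
    fix q assume "q \<in> ?W"
    then have q: "q \<in> fst ?c" "F q \<in> fst ?d" by auto
    show "(\<Sum>b\<in>Basis. (tcomp \<A> ?c q (X q) \<bullet> b) *\<^sub>R chart_deriv ?c (snd ?d \<circ> F) q b)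
        = tcomp \<B> ?d (F q) (tangent_map \<A> \<B> F q (X q))"
      using tcomp_tangent_map[OF A B F c(1) q(1) d(1) q(2)] q
        chart_deriv_Basis[OF A o _ smooth_map_smooth_fun[OF F d(1)] c(1) q(1), of "tcomp \<A> ?c q (X q)"]
      by simp
  qed
  then show "\<exists>V d. open V \<and> p \<in> V \<and> d \<in> \<B> \<and> V \<subseteq> F -` fst d \<and>
      smooth_fun \<A> V (\<lambda>q. tcomp \<B> d (F q) (tangent_map \<A> \<B> F q (X q)))"
    using W p c d by (intro exI[of _ ?W] exI[of _ ?d]) auto
qed

end

section \<open>Vector fields, Lie bracket, bump functions and tensoriality\<close>

context
  fixes \<A> :: "('m::{t2_space,second_countable_topology}, 'e::euclidean_space) chart set"
  assumes A: "smooth_atlas \<A>"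
begin

lemmas vector_fields_add = fields_along_add[OF A A smooth_map_ident[OF A], folded vector_fields_def]
lemmas vector_fields_scaleR = fields_along_scaleR[OF A A smooth_map_ident[OF A], folded vector_fields_def]
lemmas vector_fields_cong = fields_along_cong[OF A A smooth_map_ident[OF A], folded vector_fields_def]
lemmas vector_fields_minus = fields_along_minus[OF A A smooth_map_ident[OF A], folded vector_fields_def]
lemmas vector_fields_sum = fields_along_sum[OF A A smooth_map_ident[OF A], folded vector_fields_def]
lemmas vector_fields_zero = fields_along_zero[OF A A smooth_map_ident[OF A], folded vector_fields_def]

lemma vector_fields_subset: "X \<in> vector_fields \<A> U \<Longrightarrow> V \<subseteq> U \<Longrightarrow> X \<in> vector_fields \<A> V"
  unfolding vector_fields_def by (rule fields_along_subset)

lemma vector_fieldsD: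
  "X \<in> vector_fields \<A> U \<Longrightarrow> c \<in> \<A> \<Longrightarrow> smooth_fun \<A> (U \<inter> fst c) (\<lambda>q. tcomp \<A> c q (X q))"
  using fields_alongD[of X \<A> \<A> "\<lambda>p. p" U c] by (simp add: vector_fields_def)

lemma chart_field_vector_field:
  "c \<in> \<A> \<Longrightarrow> chart_field \<A> c v \<in> vector_fields \<A> (fst c)"
  using chart_field_along[OF A A smooth_map_ident[OF A], of c v] by (simp add: vector_fields_def)

lemma vector_fields_locally:
  assumes "\<And>p. p \<in> U \<Longrightarrow> \<exists>V. open V \<and> p \<in> V \<and> X \<in> vector_fields \<A> V"
  shows "X \<in> vector_fields \<A> U"
  unfolding vector_fields_def
proof (rule fields_alongI[OF A A smooth_map_ident[OF A]])
  fix p assume "p \<in> U"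
  then obtain V where V: "open V" "p \<in> V" "X \<in> vector_fields \<A> V" using assms by blast
  note c = chart_at_props[OF A, of p]
  show "\<exists>V d. open V \<and> p \<in> V \<and> d \<in> \<A> \<and> V \<subseteq> (\<lambda>p. p) -` fst d \<and> smooth_fun \<A> V (\<lambda>p. tcomp \<A> d p (X p))"
    using V c vector_fieldsD[OF V(3) c(1)] chart_props(1)[OF A c(1)]
    by (intro exI[of _ "V \<inter> fst (chart_at \<A> p)"] exI[of _ "chart_at \<A> p"]) auto
qed

lemma smooth_fun_differential:
  fixes f :: "'m \<Rightarrow> real"
  assumes U: "open U" and f: "smooth_fun \<A> U f" and X: "X \<in> vector_fields \<A> U"
  shows "smooth_fun \<A> U (\<lambda>q. differential \<A> f q (X q))"
proof (rule smooth_fun_locally[OF A])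
  fix p assume p: "p \<in> U"
  let ?c = "chart_at \<A> p"
  note c = chart_at_props[OF A, of p]
  let ?W = "U \<inter> fst ?c"
  have W: "open ?W" using U chart_props(1)[OF A c(1)] by blast
  have "smooth_fun \<A> ?W (\<lambda>q. \<Sum>b\<in>Basis. (tcomp \<A> ?c q (X q) \<bullet> b) *\<^sub>R chart_deriv ?c f q b)"
    by (intro smooth_fun_sum[OF A W] smooth_fun_scaleR[OF A W] smooth_fun_inner_left[OF A W]
         vector_fieldsD[OF X] smooth_fun_chart_deriv[OF A U f] c(1))
  then have "smooth_fun \<A> ?W (\<lambda>q. differential \<A> f q (X q))"
    by (rule smooth_fun_cong[OF A W, rotated])
      (use differential_tcomp[OF A U _ f c(1)]
          chart_deriv_Basis[OF A U _ f c(1), where v = "tcomp \<A> ?c _ (X _)"] in auto)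
  then show "\<exists>V. open V \<and> p \<in> V \<and> smooth_fun \<A> V (\<lambda>q. differential \<A> f q (X q))"
    using W p c by blast
qed

lemma lie_bracket_chart_deriv:
  "lie_bracket \<A> X Y p =
    chart_deriv (chart_at \<A> p) (\<lambda>q. tcomp \<A> (chart_at \<A> p) q (Y q)) p (X p)
    - chart_deriv (chart_at \<A> p) (\<lambda>q. tcomp \<A> (chart_at \<A> p) q (X q)) p (Y p)"
  by (simp add: lie_bracket_def chart_deriv_def o_def Let_def)

text \<open>Differentiating \<open>Y f\<close> along \<open>X\<close> gives the Hessian of
  \<open>f\<close> in the chart plus \<open>f\<close> differentiated along the derivative of the
  components of \<open>Y\<close>. The Hessian is symmetric and cancels; what is left is the
  coordinate formula of the bracket. Curvature being a tensor rests on this.\<close>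

lemma differential_lie_bracket:
  fixes f :: "'m \<Rightarrow> real"
  assumes U: "open U" "p \<in> U" and f: "smooth_fun \<A> U f"
    and X: "X \<in> vector_fields \<A> U" and Y: "Y \<in> vector_fields \<A> U"
  shows "differential \<A> f p (lie_bracket \<A> X Y p) =
    differential \<A> (\<lambda>q. differential \<A> f q (Y q)) p (X p)
    - differential \<A> (\<lambda>q. differential \<A> f q (X q)) p (Y p)"
proof -
  let ?c = "chart_at \<A> p"
  note c = chart_at_props[OF A, of p]
  let ?W = "U \<inter> fst ?c"
  have W: "open ?W" "p \<in> ?W" using U c chart_props(1)[OF A c(1)] by auto
  have fW: "smooth_fun \<A> ?W f" using f by (rule smooth_fun_subset) auto
  let ?H = "\<lambda>v w. chart_deriv ?c (\<lambda>q. chart_deriv ?c f q v) p w"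
  have H_sym: "?H v w = ?H w v" for v w
    by (rule chart_deriv_symmetric[OF A U f c])
  have df: "smooth_fun \<A> ?W (\<lambda>q. chart_deriv ?c f q b)" for b
    by (rule smooth_fun_chart_deriv[OF A U(1) f c(1)])
  have H_sum: "(\<Sum>b\<in>Basis. (v \<bullet> b) * ?H b w) = ?H v w" for v w
    using chart_deriv_Basis[OF A W df c, of w v] H_sym by simp
  have comp: "chart_deriv ?c f p (chart_deriv ?c (\<lambda>q. tcomp \<A> ?c q (Y q)) p w) + ?H (Y p) w =
      differential \<A> (\<lambda>q. differential \<A> f q (Y q)) p w"
    if Y: "Y \<in> vector_fields \<A> U" for Y w
  proof -
    let ?y = "\<lambda>q. tcomp \<A> ?c q (Y q)"
    have y: "smooth_fun \<A> ?W ?y" by (rule vector_fieldsD[OF Y c(1)])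
    have yb: "smooth_fun \<A> ?W (\<lambda>q. ?y q \<bullet> b)" for b
      by (rule smooth_fun_inner_left[OF A W(1) y])
    have prod: "smooth_fun \<A> ?W (\<lambda>q. (?y q \<bullet> b) * chart_deriv ?c f q b)" for b
      by (rule smooth_fun_mult[OF A W(1) yb df])
    have "differential \<A> (\<lambda>q. differential \<A> f q (Y q)) p w =
        differential \<A> (\<lambda>q. \<Sum>b\<in>Basis. (?y q \<bullet> b) * chart_deriv ?c f q b) p w"
      by (rule differential_cong[OF A W smooth_fun_sum[OF A W(1) prod]])
        (use differential_tcomp[OF A U(1) _ f c(1)]
          chart_deriv_Basis[OF A U(1) _ f c(1), where v = "?y _"] in auto)
    also have "\<dots> = (\<Sum>b\<in>Basis. differential \<A> (\<lambda>q. (?y q \<bullet> b) * chart_deriv ?c f q b) p w)"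
      by (rule differential_sum[OF A W prod])
    also have "\<dots> = (\<Sum>b\<in>Basis. (Y p \<bullet> b) * ?H b w + (chart_deriv ?c ?y p w \<bullet> b) * chart_deriv ?c f p b)"
      using differential_mult[OF A W yb df]
        chart_deriv_bounded_linear[OF bounded_linear_inner_left A W y c]
      by (simp add: tcomp_chart_at[OF A] differential_chart_deriv)
    also have "\<dots> = ?H (Y p) w + chart_deriv ?c f p (chart_deriv ?c ?y p w)"
      using chart_deriv_Basis[OF A U f c, of "chart_deriv ?c ?y p w"] H_sum
      by (simp add: sum.distrib)
    finally show ?thesis by simp
  qed
  show ?thesis
    using comp[OF X, of "Y p"] comp[OF Y, of "X p"] H_sym[of "X p" "Y p"]
      linear_diff[OF chart_deriv_linear[OF A U f c]]
    by (simp add: lie_bracket_chart_deriv differential_chart_deriv)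
qed

text \<open>The flat function of \<open>r^2 - |x - a|^2\<close> is positive inside a coordinate ball
  and vanishes outside it, smoothly across the sphere. The preimage \<open>K\<close> of the closed
  ball is compact, hence closed in a Hausdorff space, so extension by zero stays smooth at the edge
  of the chart domain.\<close>

lemma bump_function:
  assumes c: "c \<in> \<A>" "p \<in> fst c"
  shows "\<exists>b K. smooth_fun \<A> UNIV b \<and> b p = (1::real) \<and> closed K \<and> K \<subseteq> fst c \<and> (\<forall>q. q \<notin> K \<longrightarrow> b q = 0)"
proof -
  obtain r where r: "r > 0" "cball (snd c p) r \<subseteq> snd c ` fst c"
    using chart_props(2)[OF A c(1)] c(2) open_contains_cball by blast
  let ?a = "snd c p"
  define \<beta> where "\<beta> x = flat 0 (r\<^sup>2 - (x - ?a) \<bullet> (x - ?a)) / flat 0 (r\<^sup>2)" for x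
  define K where "K = chart_inv c ` cball ?a r"
  define b where "b q = (if q \<in> fst c then \<beta> (snd c q) else 0)" for q
  have hom: "homeomorphism (fst c) (snd c ` fst c) (snd c) (chart_inv c)"
    by (rule chart_props(3)[OF A c(1)])
  have "compact K"
    unfolding K_def using hom r(2)
    by (intro compact_continuous_image) (auto simp: homeomorphism_def intro: continuous_on_subset)
  then have K: "closed K" by (rule compact_imp_closed)
  have Kc: "K \<subseteq> fst c"
    using r(2) A c by (auto simp: K_def)
  have out: "b q = 0" if "q \<notin> K" for q
  proof (cases "q \<in> fst c")
    case True
    have "snd c q \<notin> cball ?a r"
      using that True chart_inv_chart[OF A c(1) True] unfolding K_def by force
    then have "r < norm (snd c q - ?a)"
      by (simp add: dist_norm norm_minus_commute)
    then have "r\<^sup>2 < (norm (snd c q - ?a))\<^sup>2"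
      using r(1) by (intro power_strict_mono) auto
    then show ?thesis
      by (simp add: b_def \<beta>_def flat_def power2_norm_eq_inner)
  qed (simp add: b_def)
  \<comment> \<open>The squared distance is written with sums and scalar multiples only, the shapes
    covered by the closure rules.\<close>
  have "smooth_on UNIV (\<lambda>x::'e. r\<^sup>2 + (- 1) *\<^sub>R ((x + (- ?a)) \<bullet> (x + (- ?a))))"
    by (intro smooth_on_add smooth_on_const open_UNIV smooth_on_id
       smooth_on_bounded_linear[OF bounded_linear_scaleR_right]
       smooth_on_bounded_bilinear[OF bounded_bilinear_inner])
  from smooth_on_compose[OF open_UNIV open_UNIV _ smooth_on_flat[of 0] this]
  have "smooth_on UNIV (\<lambda>x::'e. flat 0 (r\<^sup>2 + (- 1) *\<^sub>R ((x + (- ?a)) \<bullet> (x + (- ?a)))))"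
    by simp
  then have "smooth_on UNIV (\<lambda>x::'e. (1 / flat 0 (r\<^sup>2)) *\<^sub>R flat 0 (r\<^sup>2 + (- 1) *\<^sub>R ((x + (- ?a)) \<bullet> (x + (- ?a)))))"
    by (rule smooth_on_bounded_linear[OF bounded_linear_scaleR_right open_UNIV])
  then have \<beta>: "smooth_on UNIV \<beta>"
    by (rule smooth_on_cong[OF open_UNIV, rotated]) (simp add: \<beta>_def)
  have "smooth_fun \<A> (fst c) (\<lambda>q. \<beta> (snd c q))"
    by (rule smooth_fun_compose[OF A chart_props(1)[OF A c(1)] open_UNIV _ \<beta> smooth_fun_chart[OF A c(1)]]) simp
  then have b1: "smooth_fun \<A> (fst c) b"
    by (rule smooth_fun_cong[OF A chart_props(1)[OF A c(1)], rotated]) (simp add: b_def)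
  have b2: "smooth_fun \<A> (- K) b"
    using K out by (intro smooth_fun_cong[OF A _ _ smooth_fun_const[of _ _ 0]]) auto
  have "smooth_fun \<A> UNIV b"
  proof (rule smooth_fun_locally[OF A])
    fix q
    show "\<exists>V. open V \<and> q \<in> V \<and> smooth_fun \<A> V b"
      using b1 b2 Kc K chart_props(1)[OF A c(1)] by (cases "q \<in> K") blast+
  qed
  moreover have "b p = 1"
    using r c by (simp add: b_def \<beta>_def flat_def)
  ultimately show ?thesis using K Kc out by blast
qed

text \<open>Cut off a coordinate field by a bump function. Conditions stated for global fields can
  thereby be tested on arbitrary tangent vectors.\<close>

lemma vector_field_extension:
  shows "\<exists>X\<in>vector_fields \<A> UNIV. X p = v"
proof -
  let ?c = "chart_at \<A> p"
  note c = chart_at_props[OF A, of p]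
  obtain b K where b: "smooth_fun \<A> UNIV b" "b p = (1::real)" "closed K" "K \<subseteq> fst ?c"
    "\<And>q. q \<notin> K \<Longrightarrow> b q = 0"
    using bump_function[OF c] by blast
  let ?X = "\<lambda>q. b q *\<^sub>R chart_field \<A> ?c v q"
  have 1: "?X \<in> vector_fields \<A> (fst ?c)"
    by (rule vector_fields_scaleR[OF chart_props(1)[OF A c(1)] smooth_fun_subset[OF b(1)]
          chart_field_vector_field[OF c(1)]]) simp
  have 2: "?X \<in> vector_fields \<A> (- K)"
    by (rule vector_fields_cong[OF _ _ vector_fields_zero]) (use b in auto)
  have "?X \<in> vector_fields \<A> UNIV"
  proof (rule vector_fields_locally)
    fix q
    show "\<exists>V. open V \<and> q \<in> V \<and> ?X \<in> vector_fields \<A> V"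
      using 1 2 b(3,4) chart_props(1)[OF A c(1)] by (cases "q \<in> K") blast+
  qed
  then show ?thesis
    by (rule bexI[rotated]) (simp add: b(2) chart_field_chart_at[OF A])
qed

text \<open>Near \<open>p\<close> a field is a combination of coordinate fields with smooth
  coefficients; function-linearity evaluates these coefficients at \<open>p\<close>. The hypotheses
  range over all smaller neighbourhoods because the expansion exists only inside a chart, and one
  \<open>L\<close> serves all of them.\<close>

lemma tensorial_pointwise:
  fixes \<Phi> :: "('m \<Rightarrow> 'e) \<Rightarrow> 'b::real_vector"
  assumes U0: "open U\<^sub>0" "p \<in> U\<^sub>0"
    and add: "\<And>U X Y. open U \<Longrightarrow> p \<in> U \<Longrightarrow> U \<subseteq> U\<^sub>0 \<Longrightarrow> X \<in> vector_fields \<A> U \<Longrightarrow> Y \<in> vector_fields \<A> U \<Longrightarrow>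
        \<Phi> (\<lambda>q. X q + Y q) = \<Phi> X + \<Phi> Y"
    and scale: "\<And>U X f. open U \<Longrightarrow> p \<in> U \<Longrightarrow> U \<subseteq> U\<^sub>0 \<Longrightarrow> X \<in> vector_fields \<A> U \<Longrightarrow> smooth_fun \<A> U f \<Longrightarrow>
        \<Phi> (\<lambda>q. f q *\<^sub>R X q) = f p *\<^sub>R \<Phi> X"
    and cong: "\<And>U X Y. open U \<Longrightarrow> p \<in> U \<Longrightarrow> U \<subseteq> U\<^sub>0 \<Longrightarrow> X \<in> vector_fields \<A> U \<Longrightarrow> Y \<in> vector_fields \<A> U \<Longrightarrow>
        (\<And>q. q \<in> U \<Longrightarrow> X q = Y q) \<Longrightarrow> \<Phi> X = \<Phi> Y"
  shows "\<exists>L. linear L \<and> (\<forall>U X. open U \<longrightarrow> p \<in> U \<longrightarrow> U \<subseteq> U\<^sub>0 \<longrightarrow> X \<in> vector_fields \<A> U \<longrightarrow> \<Phi> X = L (X p))"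
proof (intro exI conjI allI impI)
  let ?c = "chart_at \<A> p"
  note c = chart_at_props[OF A, of p]
  let ?L = "\<lambda>v. \<Sum>b\<in>Basis. (v \<bullet> b) *\<^sub>R \<Phi> (chart_field \<A> ?c b)"
  show "linear ?L"
    by (auto intro!: linearI simp: inner_add_left scaleR_add_left sum.distrib scaleR_sum_right)
  fix U X assume U: "open U" "p \<in> U" "U \<subseteq> U\<^sub>0" and X: "X \<in> vector_fields \<A> U"
  let ?W = "U \<inter> fst ?c"
  have W: "open ?W" "p \<in> ?W" "?W \<subseteq> U\<^sub>0" using U c chart_props(1)[OF A c(1)] by auto
  let ?x = "\<lambda>q. tcomp \<A> ?c q (X q)"
  have x: "smooth_fun \<A> ?W (\<lambda>q. ?x q \<bullet> b)" for b
    by (rule smooth_fun_inner_left[OF A W(1) vector_fieldsD[OF X c(1)]])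
  have f: "chart_field \<A> ?c b \<in> vector_fields \<A> ?W" for b
    using chart_field_vector_field[OF c(1)] by (rule vector_fields_subset) auto
  have t: "(\<lambda>q. (?x q \<bullet> b) *\<^sub>R chart_field \<A> ?c b q) \<in> vector_fields \<A> ?W" for b
    by (rule vector_fields_scaleR[OF W(1) x f])
  have tS: "(\<lambda>q. \<Sum>b\<in>S. (?x q \<bullet> b) *\<^sub>R chart_field \<A> ?c b q) \<in> vector_fields \<A> ?W" for S
    by (rule vector_fields_sum[OF W(1) t])
  have zero: "\<Phi> (\<lambda>q. 0) = 0"
    using scale[OF W f smooth_fun_const[of _ _ "0::real"]] by simp
  have sum: "\<Phi> (\<lambda>q. \<Sum>b\<in>S. (?x q \<bullet> b) *\<^sub>R chart_field \<A> ?c b q) = (\<Sum>b\<in>S. (X p \<bullet> b) *\<^sub>R \<Phi> (chart_field \<A> ?c b))"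
    if "finite S" for S
    using that
  proof (induction S)
    case (insert a S)
    then show ?case
      using add[OF W t[of a] tS[of S]] scale[OF W f x, of a a]
      by (simp add: tcomp_chart_at[OF A])
  qed (simp add: zero)
  have "\<Phi> X = \<Phi> (\<lambda>q. \<Sum>b\<in>Basis. (?x q \<bullet> b) *\<^sub>R chart_field \<A> ?c b q)"
    using vector_fields_subset[OF X] chart_field_Basis[OF A c(1)]
    by (intro cong[OF W _ tS]) auto
  then show "\<Phi> X = ?L (X p)" using sum[OF finite_Basis] by simp
qed

end

text \<open>Functionals dual to the vectors \<open>v i\<close> force these to be independent, and
  \<open>DIM('a)\<close> independent vectors span; on the span the identity extends from the
  \<open>v i\<close> by linearity. This serves orthonormal bases as well as bases with a null pair,
  whose dual functionals are permuted.\<close>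

lemma dual_basis_expansion:
  fixes v :: "nat \<Rightarrow> 'a::euclidean_space"
  assumes lin: "\<And>i. i < DIM('a) \<Longrightarrow> linear (\<phi> i)"
    and dual: "\<And>i j. i < DIM('a) \<Longrightarrow> j < DIM('a) \<Longrightarrow> \<phi> i (v j) = (if i = j then 1 else 0::real)"
  shows "x = (\<Sum>i<DIM('a). \<phi> i x *\<^sub>R v i)"
proof -
  let ?N = "DIM('a)"
  have inj: "inj_on v {..<?N}"
    by (rule inj_onI) (metis dual lessThan_iff zero_neq_one)
  have ind: "independent (v ` {..<?N})"
  proof (rule independent_if_scalars_zero)
    fix f x assume s: "(\<Sum>x\<in>v ` {..<?N}. f x *\<^sub>R x) = 0" and "x \<in> v ` {..<?N}"
    then obtain i where i: "i < ?N" "x = v i" by blast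
    have "0 = \<phi> i (\<Sum>j<?N. f (v j) *\<^sub>R v j)"
      using s sum.reindex[OF inj, of "\<lambda>x. f x *\<^sub>R x"] linear_0[OF lin[OF i(1)]] by simp
    also have "\<dots> = (\<Sum>j<?N. f (v j) * \<phi> i (v j))"
      using lin[OF i(1)] by (simp add: linear_sum linear_cmul)
    also have "\<dots> = (\<Sum>j<?N. if j = i then f (v j) else 0)"
      using dual i by (intro sum.cong) auto
    also have "\<dots> = f x" using i by simp
    finally show "f x = 0" by simp
  qed simp
  have "dim (UNIV::'a set) \<le> card (v ` {..<?N})"
    using card_image[OF inj] by simp
  then have "UNIV \<subseteq> span (v ` {..<?N})"
    using ind by (intro card_ge_dim_independent) auto
  then have "x \<in> span (v ` {..<?N})" by auto
  then show ?thesis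
  proof (induction rule: span_induct)
    case (step y)
    then obtain j where j: "j < ?N" "y = v j" by blast
    have "(\<Sum>i<?N. \<phi> i y *\<^sub>R v i) = (\<Sum>i<?N. if i = j then v i else 0)"
      using dual j by (intro sum.cong) auto
    also have "\<dots> = y" using j by simp
    finally show ?case by simp
  next
    case base
    have "(\<Sum>i<?N. \<phi> i (x + y) *\<^sub>R v i) = (\<Sum>i<?N. \<phi> i x *\<^sub>R v i) + (\<Sum>i<?N. \<phi> i y *\<^sub>R v i)" for x y
      using lin by (simp add: linear_add scaleR_add_left sum.distrib)
    moreover have "(\<Sum>i<?N. \<phi> i (c *\<^sub>R x) *\<^sub>R v i) = c *\<^sub>R (\<Sum>i<?N. \<phi> i x *\<^sub>R v i)" for c x
      using lin by (simp add: linear_cmul scaleR_sum_right)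
    moreover have "(\<Sum>i<?N. \<phi> i 0 *\<^sub>R v i) = 0"
      using lin by (simp add: linear_0)
    ultimately show ?case
      by (simp add: subspace_def)
  qed
qed

lemma bilinear_sum_left: "bilinear B \<Longrightarrow> B (\<Sum>i\<in>I. f i) y = (\<Sum>i\<in>I. B (f i) y)"
  using linear_sum[of "\<lambda>x. B x y"] by (simp add: bilinear_def)

lemma bilinear_sum_right: "bilinear B \<Longrightarrow> B x (\<Sum>i\<in>I. f i) = (\<Sum>i\<in>I. B x (f i))"
  using linear_sum[of "B x"] by (simp add: bilinear_def)

lemma orthonormal_expansion:
  fixes e :: "nat \<Rightarrow> 'a::euclidean_space"
  assumes h: "bilinear h"
    and e: "\<And>i j. i < DIM('a) \<Longrightarrow> j < DIM('a) \<Longrightarrow> h (e i) (e j) = (if i = j then 1 else 0::real)"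
  shows "x = (\<Sum>i<DIM('a). h x (e i) *\<^sub>R e i)"
  by (rule dual_basis_expansion[of "\<lambda>i x. h x (e i)"]) (use h e in \<open>auto simp: bilinear_def\<close>)

text \<open>Expand one argument in the other basis, exchange the sums, and collect the coefficients
  in the remaining argument. Thus different frames give \<open>frame_trace\<close> the same
  value.\<close>

lemma orthonormal_trace_unique:
  fixes e e' :: "nat \<Rightarrow> 'a::euclidean_space"
  assumes h: "bilinear h" "\<And>x y. h x y = h y x" and B: "bilinear B"
    and e: "\<And>i j. i < DIM('a) \<Longrightarrow> j < DIM('a) \<Longrightarrow> h (e i) (e j) = (if i = j then 1 else 0::real)"
    and e': "\<And>i j. i < DIM('a) \<Longrightarrow> j < DIM('a) \<Longrightarrow> h (e' i) (e' j) = (if i = j then 1 else 0::real)"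
  shows "(\<Sum>i<DIM('a). B (e i) (e i)) = (\<Sum>i<DIM('a). B (e' i) (e' i))"
proof -
  let ?N = "DIM('a)"
  have "(\<Sum>i<?N. B (e i) (e i)) = (\<Sum>i<?N. B (\<Sum>j<?N. h (e i) (e' j) *\<^sub>R e' j) (e i))"
    using orthonormal_expansion[OF h(1) e'] by simp
  also have "\<dots> = (\<Sum>i<?N. \<Sum>j<?N. h (e i) (e' j) *\<^sub>R B (e' j) (e i))"
    by (simp add: bilinear_sum_left[OF B] bilinear_lmul[OF B])
  also have "\<dots> = (\<Sum>j<?N. \<Sum>i<?N. h (e i) (e' j) *\<^sub>R B (e' j) (e i))"
    by (rule sum.swap)
  also have "\<dots> = (\<Sum>j<?N. B (e' j) (\<Sum>i<?N. h (e' j) (e i) *\<^sub>R e i))"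
    by (simp add: bilinear_sum_right[OF B] bilinear_rmul[OF B] h(2)[of "e _"])
  also have "\<dots> = (\<Sum>j<?N. B (e' j) (e' j))"
    using orthonormal_expansion[OF h(1) e] by simp
  finally show ?thesis .
qed

text \<open>Turns the description into a finite sum. Some local frame must exist, since otherwise
  every value would satisfy the description, but the sum itself may use any basis \<open>e\<close>
  at the single point \<open>p\<close>. \<open>G\<close> and \<open>T\<close> act on fields, so
  \<open>h\<close> and \<open>B\<close> record what they do to values at \<open>p\<close>.\<close>

lemma frame_trace_eq:
  fixes e :: "nat \<Rightarrow> 'e::euclidean_space" and \<A> :: "('m::topological_space, 'e) chart set"
  assumes frame: "\<exists>U E. open U \<and> p \<in> U \<and> orthonormal_frame \<A> G U E"
    and h: "bilinear h" "\<And>x y. h x y = h y x" and B: "bilinear B"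
    and e: "\<And>i j. i < DIM('e) \<Longrightarrow> j < DIM('e) \<Longrightarrow> h (e i) (e j) = (if i = j then 1 else 0::real)"
    and G: "\<And>U X Y. open U \<Longrightarrow> p \<in> U \<Longrightarrow> X \<in> vector_fields \<A> U \<Longrightarrow> Y \<in> vector_fields \<A> U \<Longrightarrow>
      G X Y p = h (X p) (Y p)"
    and T: "\<And>U X Y. open U \<Longrightarrow> p \<in> U \<Longrightarrow> X \<in> vector_fields \<A> U \<Longrightarrow> Y \<in> vector_fields \<A> U \<Longrightarrow>
      T X Y p = B (X p) (Y p)"
  shows "frame_trace \<A> G T p = (\<Sum>i<DIM('e). B (e i) (e i))"
proof -
  have eq: "(\<Sum>i<DIM('e). T (E i) (E i) p) = (\<Sum>i<DIM('e). B (e i) (e i))"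
    if U: "open U" "p \<in> U" and E: "orthonormal_frame \<A> G U E" for U E
  proof -
    have E': "E i \<in> vector_fields \<A> U" if "i < DIM('e)" for i
      using E that by (simp add: orthonormal_frame_def)
    then have "h (E i p) (E j p) = (if i = j then 1 else 0)" if "i < DIM('e)" "j < DIM('e)" for i j
      using G[OF U E' E'] E that U(2) by (simp add: orthonormal_frame_def)
    from orthonormal_trace_unique[OF h B this e]
    show ?thesis using T[OF U E' E'] by simp
  qed
  show ?thesis
    unfolding frame_trace_def using frame eq by (intro the_equality) (metis, metis)
qed

lemma symmetric_2tensorD:
  assumes "symmetric_2tensor \<A> g"
  shows "bilinear (g p)" "g p v w = g p w v"
    "open U \<Longrightarrow> X \<in> vector_fields \<A> U \<Longrightarrow> Y \<in> vector_fields \<A> U \<Longrightarrow>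
      smooth_fun \<A> U (\<lambda>p. g p (X p) (Y p))"
  using assms by (simp_all add: symmetric_2tensor_def)

text \<open>Gram--Schmidt, one vector at a time. The new vector only has to be independent of the
  previous ones at \<open>p\<close>; the neighbourhood shrinks at every step.\<close>

lemma partial_orthonormal_frame:
  fixes \<A> :: "('m::{t2_space,second_countable_topology}, 'e::euclidean_space) chart set"
  assumes A: "smooth_atlas \<A>" and g: "riemannian_metric \<A> g"
  shows "k \<le> DIM('e) \<Longrightarrow> \<exists>U E. open U \<and> p \<in> U \<and> (\<forall>i<k. E i \<in> vector_fields \<A> U) \<and>
    (\<forall>q\<in>U. \<forall>i<k. \<forall>j<k. g q (E i q) (E j q) = (if i = j then 1 else 0))"
proof (induction k)
  case 0
  show ?case by (intro exI[of _ UNIV]) auto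
next
  case (Suc k)
  have "k \<le> DIM('e)" using Suc.prems by simp
  from Suc.IH[OF this] obtain U E where U: "open U" "p \<in> U"
    and "(\<forall>i<k. E i \<in> vector_fields \<A> U) \<and>
      (\<forall>q\<in>U. \<forall>i<k. \<forall>j<k. g q (E i q) (E j q) = (if i = j then 1 else 0))"
    by (elim exE conjE) blast
  then have E: "\<And>i. i < k \<Longrightarrow> E i \<in> vector_fields \<A> U"
    and on: "\<And>q i j. q \<in> U \<Longrightarrow> i < k \<Longrightarrow> j < k \<Longrightarrow> g q (E i q) (E j q) = (if i = j then 1 else 0)"
    by auto
  have sym: "symmetric_2tensor \<A> g" and pos: "\<And>q v. v \<noteq> 0 \<Longrightarrow> g q v v > 0"
    using g by (auto simp: riemannian_metric_def)
  note g1 = symmetric_2tensorD(1)[OF sym] and g2 = symmetric_2tensorD(2)[OF sym]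
    and g3 = symmetric_2tensorD(3)[OF sym]
  let ?S = "(\<lambda>i. E i p) ` {..<k}"
  \<comment> \<open>Fewer than \<open>DIM('e)\<close> vectors cannot span, so some \<open>v\<close>
    is left for the next step.\<close>
  have "dim (span ?S) \<le> k"
    using dim_le_card[of ?S ?S] card_image_le[of "{..<k}" "\<lambda>i. E i p"] by (simp add: span_superset)
  then have "span ?S \<noteq> UNIV"
    using Suc.prems by (metis dim_UNIV not_less_eq_eq)
  then obtain v where v: "v \<notin> span ?S" by blast
  obtain V where V: "V \<in> vector_fields \<A> UNIV" "V p = v"
    using vector_field_extension[OF A, of p v] by blast
  have VU: "V \<in> vector_fields \<A> U" using vector_fields_subset[OF A V(1)] by simp
  define Fl where "Fl q = V q - (\<Sum>i<k. g q (V q) (E i q) *\<^sub>R E i q)" for q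
  have F: "Fl \<in> vector_fields \<A> U"
    unfolding Fl_def
    by (intro vector_fields_minus[OF A U(1) VU] vector_fields_sum[OF A U(1)]
        vector_fields_scaleR[OF A U(1)] g3[OF U(1) VU] E) auto
  have FE: "g q (Fl q) (E j q) = 0" if "q \<in> U" "j < k" for q j
  proof -
    have "g q (Fl q) (E j q) = g q (V q) (E j q) - (\<Sum>i<k. g q (V q) (E i q) * g q (E i q) (E j q))"
      by (simp add: Fl_def bilinear_lsub[OF g1] bilinear_sum_left[OF g1] bilinear_lmul[OF g1])
    also have "(\<Sum>i<k. g q (V q) (E i q) * g q (E i q) (E j q)) =
        (\<Sum>i<k. if i = j then g q (V q) (E i q) else 0)"
      using on[OF that(1) _ that(2)] by (intro sum.cong) auto
    finally show ?thesis using that by simp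
  qed
  have "Fl p \<noteq> 0"
  proof
    assume "Fl p = 0"
    then have "v = (\<Sum>i<k. g p v (E i p) *\<^sub>R E i p)" by (simp add: Fl_def V(2))
    moreover have "(\<Sum>i<k. g p v (E i p) *\<^sub>R E i p) \<in> span ?S"
      by (intro span_sum span_scale span_base) auto
    ultimately show False using v by simp
  qed
  define N where "N q = g q (Fl q) (Fl q)" for q
  have N: "smooth_fun \<A> U N" unfolding N_def by (rule g3[OF U(1) F F])
  \<comment> \<open>\<open>Fl\<close> is nonzero at \<open>p\<close> only; by continuity its norm
    stays positive on this neighbourhood, where it can be normalised smoothly.\<close>
  define W where "W = N -` {0<..} \<inter> U"
  have "open W"
    using smooth_fun_imp_continuous_on[OF A U(1) N] open_greaterThan
    unfolding W_def continuous_on_open_vimage[OF U(1)] by blast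
  moreover have "p \<in> W"
    using U(2) pos[OF \<open>Fl p \<noteq> 0\<close>] by (simp add: W_def N_def)
  ultimately have W: "open W" "p \<in> W" "W \<subseteq> U" "\<And>q. q \<in> W \<Longrightarrow> N q > 0"
    by (auto simp: W_def)
  have r: "smooth_fun \<A> W (\<lambda>q. N q powr (- 1 / 2))"
    by (rule smooth_fun_compose[OF A W(1) open_greaterThan _ smooth_on_powr smooth_fun_subset[OF N W(3)]])
      (use W(4) in auto)
  define E' where "E' i = (if i < k then E i else (\<lambda>q. N q powr (- 1 / 2) *\<^sub>R Fl q))" for i
  have "E' i \<in> vector_fields \<A> W" if "i < Suc k" for i
    using vector_fields_scaleR[OF A W(1) r vector_fields_subset[OF A F W(3)]]
      vector_fields_subset[OF A E W(3)] by (auto simp: E'_def)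
  moreover have "g q (E' i q) (E' j q) = (if i = j then 1 else 0)"
    if q: "q \<in> W" and ij: "i < Suc k" "j < Suc k" for q i j
  proof -
    have q': "q \<in> U" using q W(3) by blast
    have "N q powr (- 1 / 2) * (N q powr (- 1 / 2) * N q) = N q powr (- 1 / 2 + - 1 / 2) * N q powr 1"
      using W(4)[OF q] by (simp only: powr_add) simp
    also have "\<dots> = 1"
      using W(4)[OF q] by (simp add: powr_minus)
    finally have n: "N q powr (- 1 / 2) * (N q powr (- 1 / 2) * N q) = 1" .
    show ?thesis
      using ij on[OF q'] FE[OF q'] n g2[of q "E i q" "Fl q"]
      by (cases "i < k"; cases "j < k")
        (auto simp: E'_def N_def bilinear_lmul[OF g1] bilinear_rmul[OF g1] less_Suc_eq)
  qed
  ultimately show ?case using W(1,2) by blast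
qed

lemma orthonormal_frame_exists:
  fixes \<A> :: "('m::{t2_space,second_countable_topology}, 'e::euclidean_space) chart set"
  assumes "smooth_atlas \<A>" "riemannian_metric \<A> g"
  shows "\<exists>U E. open U \<and> p \<in> U \<and> orthonormal_frame \<A> (on_fields g) U E"
  using partial_orthonormal_frame[OF assms order_refl, of p]
  by (auto simp: orthonormal_frame_def on_fields_def)

section \<open>Pull-back connections\<close>

context
  fixes \<A> :: "('m::{t2_space,second_countable_topology}, 'e::euclidean_space) chart set"
    and \<Gamma> :: "'m set \<Rightarrow> ('m \<Rightarrow> 'f::real_vector) set" and D
    and U :: "'m set"
  assumes D: "linear_connection \<A> \<Gamma> D" and U: "open U"
begin

lemma connection_closed:
  assumes "X \<in> vector_fields \<A> U" "Z \<in> \<Gamma> U"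
  shows "D X Z \<in> \<Gamma> U"
  using D U assms smooth_fun_const[of \<A> U "0::real"] unfolding linear_connection_def by blast

lemma connection_add_left:
  assumes "X \<in> vector_fields \<A> U" "X' \<in> vector_fields \<A> U" "Z \<in> \<Gamma> U" "p \<in> U"
  shows "D (\<lambda>q. X q + X' q) Z p = D X Z p + D X' Z p"
  using D U assms smooth_fun_const[of \<A> U "0::real"] unfolding linear_connection_def by blast

lemma connection_scaleR_left:
  assumes "X \<in> vector_fields \<A> U" "Z \<in> \<Gamma> U" "smooth_fun \<A> U f" "p \<in> U"
  shows "D (\<lambda>q. f q *\<^sub>R X q) Z p = f p *\<^sub>R D X Z p"
  using D U assms unfolding linear_connection_def by blast

lemma connection_add:
  assumes "X \<in> vector_fields \<A> U" "Z \<in> \<Gamma> U" "Z' \<in> \<Gamma> U" "p \<in> U"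
  shows "D X (\<lambda>q. Z q + Z' q) p = D X Z p + D X Z' p"
  using D U assms smooth_fun_const[of \<A> U "0::real"] unfolding linear_connection_def by blast

lemma connection_scaleR:
  assumes "X \<in> vector_fields \<A> U" "Z \<in> \<Gamma> U" "smooth_fun \<A> U f" "p \<in> U"
  shows "D X (\<lambda>q. f q *\<^sub>R Z q) p = differential \<A> f p (X p) *\<^sub>R Z p + f p *\<^sub>R D X Z p"
  using D U assms unfolding linear_connection_def by blast

lemma connection_cong:
  assumes "X \<in> vector_fields \<A> U" "X' \<in> vector_fields \<A> U" "Z \<in> \<Gamma> U" "Z' \<in> \<Gamma> U"
    and "\<And>q. q \<in> U \<Longrightarrow> X q = X' q" "\<And>q. q \<in> U \<Longrightarrow> Z q = Z' q" "p \<in> U"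
  shows "D X Z p = D X' Z' p"
proof -
  have "\<forall>p\<in>U. X p = X' p \<and> Z p = Z' p" using assms by blast
  then show ?thesis
    using D U assms(1-4,7) smooth_fun_const[of \<A> U "0::real"] unfolding linear_connection_def by blast
qed

lemma connection_scaleR_const:
  assumes "X \<in> vector_fields \<A> U" "Z \<in> \<Gamma> U" "p \<in> U"
  shows "D X (\<lambda>q. a *\<^sub>R Z q) p = a *\<^sub>R D X Z p"
  using connection_scaleR[OF assms(1,2) smooth_fun_const assms(3), of a] by (simp add: differential_const)

lemma connection_zero:
  assumes "X \<in> vector_fields \<A> U" "Z \<in> \<Gamma> U" "p \<in> U"
  shows "D X (\<lambda>q. 0) p = 0"
  using connection_scaleR_const[OF assms, of 0] by simp

end

text \<open>The clauses of \<open>linear_connection\<close> for the first argument are exactly the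
  hypotheses of tensoriality. \<open>Z\<close> is asked to be a section over every smaller set
  because those clauses are stated separately for each open set.\<close>

lemma connection_pointwise:
  fixes \<A> :: "('m::{t2_space,second_countable_topology}, 'e::euclidean_space) chart set"
  assumes A: "smooth_atlas \<A>" and D: "linear_connection \<A> \<Gamma> D" and U: "open U" "p \<in> U"
    and Z: "\<And>V. V \<subseteq> U \<Longrightarrow> Z \<in> \<Gamma> V"
  shows "\<exists>L. linear L \<and>
    (\<forall>V X. open V \<longrightarrow> p \<in> V \<longrightarrow> V \<subseteq> U \<longrightarrow> X \<in> vector_fields \<A> V \<longrightarrow> D X Z p = L (X p))"
proof (rule tensorial_pointwise[OF A U])
  fix V X Y assume V: "open V" "p \<in> V" "V \<subseteq> U" and X: "X \<in> vector_fields \<A> V"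
    and Y: "Y \<in> vector_fields \<A> V"
  show "D (\<lambda>q. X q + Y q) Z p = D X Z p + D Y Z p"
    by (rule connection_add_left[OF D V(1) X Y Z[OF V(3)] V(2)])
  show "D X Z p = D Y Z p" if "\<And>q. q \<in> V \<Longrightarrow> X q = Y q"
    by (rule connection_cong[OF D V(1) X Y Z[OF V(3)] Z[OF V(3)] that refl V(2)])
next
  fix V X and f :: "'m \<Rightarrow> real" assume V: "open V" "p \<in> V" "V \<subseteq> U" and X: "X \<in> vector_fields \<A> V"
    and f: "smooth_fun \<A> V f"
  show "D (\<lambda>q. f q *\<^sub>R X q) Z p = f p *\<^sub>R D X Z p"
    by (rule connection_scaleR_left[OF D V(1) X Z[OF V(3)] f V(2)])
qed

text \<open>Over a coordinate patch the pulled-back coordinate fields generate all fields along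
  \<open>F\<close> over the smooth functions. These generators are compositions with
  \<open>F\<close>, the only fields on which a pull-back connection is prescribed.\<close>

lemma fields_along_induct:
  fixes \<A> :: "('m::{t2_space,second_countable_topology}, 'e::euclidean_space) chart set"
    and \<B> :: "('w::{t2_space,second_countable_topology}, 'f::euclidean_space) chart set"
  assumes A: "smooth_atlas \<A>" and B: "smooth_atlas \<B>" and F: "smooth_map \<A> \<B> F"
    and d: "d \<in> \<B>" and U: "open U" "U \<subseteq> F -` fst d" and Z: "Z \<in> fields_along \<A> \<B> F U"
    and base: "\<And>b. b \<in> Basis \<Longrightarrow> P (\<lambda>q. chart_field \<B> d b (F q))"
    and zero: "P (\<lambda>q. 0)"
    and add: "\<And>Z Z'. Z \<in> fields_along \<A> \<B> F U \<Longrightarrow> Z' \<in> fields_along \<A> \<B> F U \<Longrightarrow> P Z \<Longrightarrow> P Z' \<Longrightarrow>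
      P (\<lambda>q. Z q + Z' q)"
    and scale: "\<And>f Z. smooth_fun \<A> U f \<Longrightarrow> Z \<in> fields_along \<A> \<B> F U \<Longrightarrow> P Z \<Longrightarrow> P (\<lambda>q. f q *\<^sub>R Z q)"
    and cong: "\<And>Z Z'. Z \<in> fields_along \<A> \<B> F U \<Longrightarrow> Z' \<in> fields_along \<A> \<B> F U \<Longrightarrow>
      (\<And>q. q \<in> U \<Longrightarrow> Z q = Z' q) \<Longrightarrow> P Z \<Longrightarrow> P Z'"
  shows "P Z"
proof -
  let ?z = "\<lambda>b q. tcomp \<B> d (F q) (Z q) \<bullet> b"
  let ?t = "\<lambda>b q. ?z b q *\<^sub>R chart_field \<B> d b (F q)"
  have "smooth_fun \<A> U (\<lambda>q. tcomp \<B> d (F q) (Z q))"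
    using fields_alongD[OF Z d] U(2) by (simp add: Int_absorb2)
  then have z: "smooth_fun \<A> U (?z b)" for b
    by (rule smooth_fun_inner_left[OF A U(1)])
  have w: "(\<lambda>q. chart_field \<B> d b (F q)) \<in> fields_along \<A> \<B> F U" for b
    by (rule fields_along_subset[OF chart_field_along[OF A B F d] U(2)])
  have t: "?t b \<in> fields_along \<A> \<B> F U" for b
    by (rule fields_along_scaleR[OF A B F U(1) z w])
  have tS: "(\<lambda>q. \<Sum>b\<in>S. ?t b q) \<in> fields_along \<A> \<B> F U" for S
    by (rule fields_along_sum[OF A B F U(1) t])
  have "finite S \<Longrightarrow> S \<subseteq> Basis \<Longrightarrow> P (\<lambda>q. \<Sum>b\<in>S. ?t b q)" for S
  proof (induction S rule: finite_induct)
    case (insert a S)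
    then show ?case
      using add[OF t tS scale[OF z w base]] by simp
  qed (simp add: zero)
  then have "P (\<lambda>q. \<Sum>b\<in>Basis. ?t b q)" by simp
  moreover have "(\<Sum>b\<in>Basis. ?t b q) = Z q" if "q \<in> U" for q
    using chart_field_Basis[OF B d, of "F q" "Z q"] U(2) that by auto
  ultimately show ?thesis using cong[OF tS Z] by blast
qed

locale pullback_metric_connection =
  fixes \<A> :: "('m::{t2_space,second_countable_topology}, 'e::euclidean_space) chart set"
    and \<B> :: "('w::{t2_space,second_countable_topology}, 'f::euclidean_space) chart set"
    and F :: "'m \<Rightarrow> 'w"
    and gt :: "'w \<Rightarrow> 'f \<Rightarrow> 'f \<Rightarrow> real"
    and nabt :: "('w \<Rightarrow> 'f) \<Rightarrow> ('w \<Rightarrow> 'f) \<Rightarrow> ('w \<Rightarrow> 'f)"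
    and D :: "('m \<Rightarrow> 'e) \<Rightarrow> ('m \<Rightarrow> 'f) \<Rightarrow> ('m \<Rightarrow> 'f)"
  assumes A: "smooth_atlas \<A>" and B: "smooth_atlas \<B>" and F: "smooth_map \<A> \<B> F"
    and gt: "symmetric_2tensor \<B> gt"
    and nabt: "levi_civita \<B> gt nabt"
    and D: "pullback_connection \<A> \<B> F nabt D"
begin

abbreviation "VF \<equiv> vector_fields \<A>"
abbreviation "FA \<equiv> fields_along \<A> \<B> F"
abbreviation "dF \<equiv> tangent_map \<A> \<B> F"

lemmas gt_bilinear = symmetric_2tensorD(1)[OF gt]
lemmas gt_sym = symmetric_2tensorD(2)[OF gt]
lemmas gt_simps = bilinear_ladd[OF gt_bilinear] bilinear_radd[OF gt_bilinear]
  bilinear_lsub[OF gt_bilinear] bilinear_rsub[OF gt_bilinear]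
  bilinear_lmul[OF gt_bilinear] bilinear_rmul[OF gt_bilinear]
  bilinear_lzero[OF gt_bilinear] bilinear_rzero[OF gt_bilinear]
  bilinear_lneg[OF gt_bilinear] bilinear_rneg[OF gt_bilinear]

lemma D_connection: "linear_connection \<A> FA D"
  using D by (simp add: pullback_connection_def)

lemma nabt_connection: "linear_connection \<B> (vector_fields \<B>) nabt"
  using nabt by (simp add: levi_civita_def)

lemmas FA_add = fields_along_add[OF A B F] and FA_scaleR = fields_along_scaleR[OF A B F]
  and FA_minus = fields_along_minus[OF A B F] and FA_sum = fields_along_sum[OF A B F]
  and FA_subset = fields_along_subset[of _ \<A> \<B> F]
  and FA_dF = tangent_map_along[OF A B F]
  and FA_chart_field = chart_field_along[OF A B F]
lemmas D_closed = connection_closed[OF D_connection] and D_add_left = connection_add_left[OF D_connection]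
  and D_scaleR_left = connection_scaleR_left[OF D_connection] and D_add = connection_add[OF D_connection]
  and D_scaleR = connection_scaleR[OF D_connection] and D_cong = connection_cong[OF D_connection]
  and D_zero = connection_zero[OF D_connection]

text \<open>Smoothness of \<open>gt\<close> is given for vector fields on the target only, and a
  field along \<open>F\<close> need not come from one. Expanding both arguments in pulled-back
  coordinate fields reduces to that case.\<close>

lemma smooth_gt:
  assumes U: "open U" and Z: "Z \<in> FA U" and W: "W \<in> FA U"
  shows "smooth_fun \<A> U (\<lambda>q. gt (F q) (Z q) (W q))"
proof (rule smooth_fun_locally[OF A])
  fix p assume p: "p \<in> U"
  let ?d = "chart_at \<B> (F p)"
  note d = chart_at_props[OF B, of "F p"]
  let ?U = "U \<inter> F -` fst ?d"
  have U': "open ?U" "p \<in> ?U" "?U \<subseteq> F -` fst ?d"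
    using U open_vimage_chart[OF A B F d(1)] p d by auto
  have comp: "smooth_fun \<A> ?U (\<lambda>q. tcomp \<B> ?d (F q) (Z q) \<bullet> b)" if "Z \<in> FA U" for Z b
    by (rule smooth_fun_inner_left[OF A U'(1) fields_alongD[OF that d(1)]])
  have G: "smooth_fun \<A> ?U (\<lambda>q. gt (F q) (chart_field \<B> ?d b (F q)) (chart_field \<B> ?d b' (F q)))" for b b'
    using smooth_fun_subset[OF smooth_fun_compose_map[OF A B F chart_props(1)[OF B d(1)]
      symmetric_2tensorD(3)[OF gt chart_props(1)[OF B d(1)] chart_field_vector_field[OF B d(1)] chart_field_vector_field[OF B d(1)]]] U'(3), of b b']
    by (simp add: o_def)
  have "smooth_fun \<A> ?U (\<lambda>q. \<Sum>b\<in>Basis. \<Sum>b'\<in>Basis. (tcomp \<B> ?d (F q) (Z q) \<bullet> b) *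
      ((tcomp \<B> ?d (F q) (W q) \<bullet> b') * gt (F q) (chart_field \<B> ?d b (F q)) (chart_field \<B> ?d b' (F q))))"
    by (rule smooth_fun_sum[OF A U'(1)] smooth_fun_mult[OF A U'(1)] comp[OF Z] comp[OF W] G)+
  then have "smooth_fun \<A> ?U (\<lambda>q. gt (F q) (Z q) (W q))"
  proof (rule smooth_fun_cong[OF A U'(1), rotated])
    fix q assume q: "q \<in> ?U"
    then have "gt (F q) (Z q) (W q) =
      gt (F q) (\<Sum>b\<in>Basis. (tcomp \<B> ?d (F q) (Z q) \<bullet> b) *\<^sub>R chart_field \<B> ?d b (F q))
        (\<Sum>b'\<in>Basis. (tcomp \<B> ?d (F q) (W q) \<bullet> b') *\<^sub>R chart_field \<B> ?d b' (F q))"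
      using chart_field_Basis[OF B d(1), of "F q" "Z q"] chart_field_Basis[OF B d(1), of "F q" "W q"] by simp
    then show "(\<Sum>b\<in>Basis. \<Sum>b'\<in>Basis. (tcomp \<B> ?d (F q) (Z q) \<bullet> b) *
      ((tcomp \<B> ?d (F q) (W q) \<bullet> b') * gt (F q) (chart_field \<B> ?d b (F q)) (chart_field \<B> ?d b' (F q))))
      = gt (F q) (Z q) (W q)"
      by (subst sum.swap)
        (simp add: bilinear_sum_left[OF gt_bilinear] bilinear_sum_right[OF gt_bilinear] gt_simps
          sum_distrib_left mult.left_commute)
  qed
  then show "\<exists>V. open V \<and> p \<in> V \<and> smooth_fun \<A> V (\<lambda>q. gt (F q) (Z q) (W q))"
    using U' by blast
qed

text \<open>\<open>pullback_connection\<close> asks for an ambient field with value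
  \<open>dF p (X p)\<close>; the coordinate field with those constant components is a canonical
  choice.\<close>

lemma D_chart_field:
  assumes U: "open U" "p \<in> U" and d: "d \<in> \<B>" "U \<subseteq> F -` fst d" and X: "X \<in> VF U"
  shows "D X (\<lambda>q. chart_field \<B> d v (F q)) p = nabt (chart_field \<B> d (tcomp \<B> d (F p) (dF p (X p)))) (chart_field \<B> d v) (F p)"
proof -
  have "chart_field \<B> d (tcomp \<B> d (F p) (dF p (X p))) (F p) = dF p (X p)"
    using chart_field_tcomp[OF B d(1)] d(2) U(2) by blast
  then have "D X (chart_field \<B> d v \<circ> F) p = nabt (chart_field \<B> d (tcomp \<B> d (F p) (dF p (X p)))) (chart_field \<B> d v) (F p)"
    using D U d(2) X chart_props(1)[OF B d(1)] chart_field_vector_field[OF B d(1)]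
    unfolding pullback_connection_def by (metis image_subset_iff_subset_vimage)
  then show ?thesis by (simp add: o_def)
qed

text \<open>On pulled-back coordinate fields this is metric compatibility of \<open>nabt\<close>
  combined with the chain rule. Both sides obey the same Leibniz rule in each slot, which extends it
  to all fields.\<close>

lemma D_metric:
  assumes U: "open U" "p \<in> U" and X: "X \<in> VF U" and Z: "Z \<in> FA U" and W: "W \<in> FA U"
  shows "differential \<A> (\<lambda>q. gt (F q) (Z q) (W q)) p (X p) = gt (F p) (D X Z p) (W p) + gt (F p) (Z p) (D X W p)"
proof -
  let ?d = "chart_at \<B> (F p)"
  note d = chart_at_props[OF B, of "F p"]
  let ?U = "U \<inter> F -` fst ?d"
  have U': "open ?U" "p \<in> ?U" "?U \<subseteq> F -` fst ?d"
    using U open_vimage_chart[OF A B F d(1)] d by auto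
  have X': "X \<in> VF ?U" and Z': "Z \<in> FA ?U" and W': "W \<in> FA ?U"
    using vector_fields_subset[OF A X] FA_subset[OF Z] FA_subset[OF W] by auto
  let ?C = "\<lambda>Z W. differential \<A> (\<lambda>q. gt (F q) (Z q) (W q)) p (X p)
      = gt (F p) (D X Z p) (W p) + gt (F p) (Z p) (D X W p)"
  have sym: "?C W Z" if "?C Z W" for Z W
    using that gt_sym by (metis (no_types, lifting) ext add.commute)
  have cf: "(\<lambda>q. chart_field \<B> ?d b (F q)) \<in> FA ?U" for b
    by (rule FA_subset[OF FA_chart_field[OF d(1)] U'(3)])
  \<comment> \<open>Generation in the first slot with the second one held fixed; symmetry of
    \<open>gt\<close> makes it usable for the second slot as well.\<close>
  have ind: "?C Z W"
    if Z: "Z \<in> FA ?U" and W: "W \<in> FA ?U" and base: "\<And>b. b \<in> Basis \<Longrightarrow> ?C (\<lambda>q. chart_field \<B> ?d b (F q)) W" for Z W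
  proof (rule fields_along_induct[OF A B F d(1) U'(1,3) Z, of "\<lambda>Z. ?C Z W"])
    show "?C (\<lambda>q. 0) W"
      using D_zero[OF U'(1) X' Z U'(2)] by (simp add: gt_simps differential_const)
  next
    fix Z Z' assume Z: "Z \<in> FA ?U" "Z' \<in> FA ?U" and C: "?C Z W" "?C Z' W"
    have "(\<lambda>q. gt (F q) (Z q + Z' q) (W q)) = (\<lambda>q. gt (F q) (Z q) (W q) + gt (F q) (Z' q) (W q))"
      by (simp add: gt_simps)
    then show "?C (\<lambda>q. Z q + Z' q) W"
      using C D_add[OF U'(1) X' Z U'(2)]
        differential_add[OF A U'(1,2) smooth_gt[OF U'(1) Z(1) W] smooth_gt[OF U'(1) Z(2) W], of "X p"]
      by (simp add: gt_simps)
  next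
    fix f :: "'m \<Rightarrow> real" and Z assume f: "smooth_fun \<A> ?U f" and Z: "Z \<in> FA ?U" and C: "?C Z W"
    have "(\<lambda>q. gt (F q) (f q *\<^sub>R Z q) (W q)) = (\<lambda>q. f q * gt (F q) (Z q) (W q))"
      by (simp add: gt_simps)
    then show "?C (\<lambda>q. f q *\<^sub>R Z q) W"
      using C D_scaleR[OF U'(1) X' Z f U'(2)]
        differential_mult[OF A U'(1,2) f smooth_gt[OF U'(1) Z W], of "X p"]
      by (simp add: gt_simps algebra_simps)
  next
    fix Z Z' assume Z: "Z \<in> FA ?U" "Z' \<in> FA ?U" and eq: "\<And>q. q \<in> ?U \<Longrightarrow> Z q = Z' q" and C: "?C Z W"
    have "differential \<A> (\<lambda>q. gt (F q) (Z' q) (W q)) p (X p) = differential \<A> (\<lambda>q. gt (F q) (Z q) (W q)) p (X p)"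
      by (rule differential_cong[OF A U'(1,2) smooth_gt[OF U'(1) Z(1) W]]) (simp add: eq)
    then show "?C Z' W"
      using C D_cong[OF U'(1) X' X' Z refl eq U'(2)] eq[OF U'(2)] by simp
  qed (rule base)
  have base: "?C (\<lambda>q. chart_field \<B> ?d b (F q)) (\<lambda>q. chart_field \<B> ?d b' (F q))" for b b'
  proof -
    let ?V = "fst ?d" and ?b = "chart_field \<B> ?d b" and ?b' = "chart_field \<B> ?d b'"
    let ?X = "chart_field \<B> ?d (tcomp \<B> ?d (F p) (dF p (X p)))"
    have V: "open ?V" by (rule chart_props(1)[OF B d(1)])
    note cv = chart_field_vector_field[OF B d(1)]
    have Xp: "?X (F p) = dF p (X p)" by (rule chart_field_tcomp[OF B d])
    have "differential \<A> ((\<lambda>y. gt y (?b y) (?b' y)) \<circ> F) p (X p) =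
        differential \<B> (\<lambda>y. gt y (?b y) (?b' y)) (F p) (?X (F p))"
      unfolding Xp by (rule differential_compose_map[OF A B F V d(2) symmetric_2tensorD(3)[OF gt V cv cv]])
    also have "\<dots> = gt (F p) (nabt ?X ?b (F p)) (?b' (F p)) + gt (F p) (?b (F p)) (nabt ?X ?b' (F p))"
      using nabt V cv d(2) unfolding levi_civita_def by blast
    finally show ?thesis
      using D_chart_field[OF U'(1,2) d(1) U'(3) X'] by (simp add: o_def)
  qed
  show ?thesis
    using ind[OF Z' W' sym[OF ind[OF W' cf base]]] .
qed

text \<open>Both fields have constant components in this chart. It has to be the preferred chart of
  \<open>y\<close>, because that is where \<open>lie_bracket\<close> takes its derivatives.\<close>

lemma lie_bracket_chart_field:
  "lie_bracket \<B> (chart_field \<B> (chart_at \<B> y) v) (chart_field \<B> (chart_at \<B> y) w) y = 0"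
proof -
  note d = chart_at_props[OF B, of y]
  have "chart_deriv (chart_at \<B> y) (\<lambda>q. tcomp \<B> (chart_at \<B> y) q (chart_field \<B> (chart_at \<B> y) v q)) y u = 0" for v u
    using chart_deriv_cong[OF B chart_props(1)[OF B d(1)] d(2) smooth_fun_const d, of v
        "\<lambda>q. tcomp \<B> (chart_at \<B> y) q (chart_field \<B> (chart_at \<B> y) v q)"]
      tcomp_chart_field[OF B d(1)]
    by (simp add: chart_deriv_const)
  then show ?thesis
    by (simp add: lie_bracket_chart_deriv[OF B])
qed

text \<open>The coordinate expression of a covariant derivative: differentiated components plus the
  Christoffel term, which is carried by \<open>nabt\<close> on coordinate fields.\<close>

lemma D_formula:
  assumes U: "open U" "p \<in> U" and X: "X \<in> VF U" and Z: "Z \<in> FA U"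
  defines "d \<equiv> chart_at \<B> (F p)"
  shows "D X Z p = (\<Sum>b\<in>Basis. differential \<A> (\<lambda>q. tcomp \<B> d (F q) (Z q) \<bullet> b) p (X p) *\<^sub>R chart_field \<B> d b (F p))
    + nabt (chart_field \<B> d (dF p (X p))) (chart_field \<B> d (Z p)) (F p)"
proof -
  note d = chart_at_props[OF B, of "F p", folded d_def]
  let ?U = "U \<inter> F -` fst d" and ?V = "fst d"
  have U': "open ?U" "p \<in> ?U" "?U \<subseteq> F -` fst d"
    using U open_vimage_chart[OF A B F d(1)] d by auto
  have V: "open ?V" by (rule chart_props(1)[OF B d(1)])
  have X': "X \<in> VF ?U" and Z': "Z \<in> FA ?U"
    using vector_fields_subset[OF A X] FA_subset[OF Z] by auto
  let ?z = "\<lambda>b q. tcomp \<B> d (F q) (Z q) \<bullet> b"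
  let ?w = "\<lambda>b q. chart_field \<B> d b (F q)"
  let ?t = "\<lambda>b q. ?z b q *\<^sub>R ?w b q"
  have z: "smooth_fun \<A> ?U (?z b)" for b
    by (rule smooth_fun_inner_left[OF A U'(1) fields_alongD[OF Z d(1)]])
  have w: "?w b \<in> FA ?U" for b
    by (rule FA_subset[OF FA_chart_field[OF d(1)] U'(3)])
  have t: "?t b \<in> FA ?U" for b by (rule FA_scaleR[OF U'(1) z w])
  have tS: "(\<lambda>q. \<Sum>b\<in>S. ?t b q) \<in> FA ?U" for S by (rule FA_sum[OF U'(1) t])
  have tc: "tcomp \<B> d (F p) v = v" for v by (simp add: d_def tcomp_chart_at[OF B])
  let ?X = "chart_field \<B> d (dF p (X p))"
  have Dt: "D X (?t b) p = differential \<A> (?z b) p (X p) *\<^sub>R ?w b p + (Z p \<bullet> b) *\<^sub>R nabt ?X (chart_field \<B> d b) (F p)" for b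
    using D_scaleR[OF U'(1) X' w z U'(2)] D_chart_field[OF U'(1,2) d(1) U'(3) X'] by (simp add: tc)
  have sum: "D X (\<lambda>q. \<Sum>b\<in>S. ?t b q) p = (\<Sum>b\<in>S. D X (?t b) p)" if "finite S" for S
    using that
  proof (induction S)
    case (insert a S)
    then show ?case using D_add[OF U'(1) X' t tS U'(2), of a S] by simp
  qed (simp add: D_zero[OF U'(1) X' Z' U'(2)])
  note cv = chart_field_vector_field[OF B d(1)]
  \<comment> \<open>With coefficients frozen at \<open>p\<close> the Christoffel terms collect into
    one coordinate field, whose components are those of \<open>Z p\<close>.\<close>
  have cS: "(\<lambda>y. \<Sum>b\<in>S. (Z p \<bullet> b) *\<^sub>R chart_field \<B> d b y) \<in> vector_fields \<B> ?V" for S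
    by (rule vector_fields_sum[OF B V vector_fields_scaleR[OF B V smooth_fun_const cv]])
  have sum': "nabt ?X (\<lambda>y. \<Sum>b\<in>S. (Z p \<bullet> b) *\<^sub>R chart_field \<B> d b y) (F p)
      = (\<Sum>b\<in>S. (Z p \<bullet> b) *\<^sub>R nabt ?X (chart_field \<B> d b) (F p))" if "finite S" for S
    using that
  proof (induction S)
    case (insert a S)
    then show ?case
      using connection_add[OF nabt_connection V cv vector_fields_scaleR[OF B V smooth_fun_const cv] cS d(2), of "dF p (X p)" "Z p \<bullet> a" a S]
        connection_scaleR_const[OF nabt_connection V cv cv d(2)] by simp
  qed (simp add: connection_zero[OF nabt_connection V cv cv d(2)])
  have "D X Z p = D X (\<lambda>q. \<Sum>b\<in>Basis. ?t b q) p"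
    using chart_field_Basis[OF B d(1)] by (intro D_cong[OF U'(1) X' X' Z' tS refl _ U'(2)]) auto
  also have "\<dots> = (\<Sum>b\<in>Basis. differential \<A> (?z b) p (X p) *\<^sub>R ?w b p)
      + nabt ?X (\<lambda>y. \<Sum>b\<in>Basis. (Z p \<bullet> b) *\<^sub>R chart_field \<B> d b y) (F p)"
    unfolding sum[OF finite_Basis] sum'[OF finite_Basis] Dt sum.distrib ..
  also have "nabt ?X (\<lambda>y. \<Sum>b\<in>Basis. (Z p \<bullet> b) *\<^sub>R chart_field \<B> d b y) (F p) = nabt ?X (chart_field \<B> d (Z p)) (F p)"
  proof (rule connection_cong[OF nabt_connection V cv cv cS cv refl _ d(2)])
    fix y assume y: "y \<in> fst d"
    show "(\<Sum>b\<in>Basis. (Z p \<bullet> b) *\<^sub>R chart_field \<B> d b y) = chart_field \<B> d (Z p) y"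
      using chart_field_Basis[OF B d(1) y, of "chart_field \<B> d (Z p) y"]
        tcomp_chart_field[OF B d(1) y] by simp
  qed
  finally show ?thesis .
qed

text \<open>The Christoffel terms are symmetric because \<open>nabt\<close> is torsion-free and
  coordinate fields commute. What remains are iterated derivatives of the components of
  \<open>F\<close>, whose commutator is differentiation along the bracket.\<close>

lemma D_torsion_free:
  assumes U: "open U" "p \<in> U" and X: "X \<in> VF U" and Y: "Y \<in> VF U"
  shows "D X (\<lambda>q. dF q (Y q)) p - D Y (\<lambda>q. dF q (X q)) p = dF p (lie_bracket \<A> X Y p)"
proof -
  define d where "d = chart_at \<B> (F p)"
  note d = chart_at_props[OF B, of "F p", folded d_def]
  let ?U = "U \<inter> F -` fst d" and ?V = "fst d"
  have o: "open (F -` fst d)" using open_vimage_chart[OF A B F d(1)] .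
  have U': "open ?U" "p \<in> ?U" "?U \<subseteq> F -` fst d" using U o d by auto
  have X': "X \<in> VF ?U" and Y': "Y \<in> VF ?U"
    using vector_fields_subset[OF A X] vector_fields_subset[OF A Y] by auto
  \<comment> \<open>Scalar components of \<open>F\<close>: the components of
    \<open>dF q (Y q)\<close> are the derivatives of these functions along \<open>Y\<close>, so the
    bracket identity for functions applies.\<close>
  let ?\<psi> = "\<lambda>b q. snd d (F q) \<bullet> b"
  have Fd: "smooth_fun \<A> (F -` fst d) (snd d \<circ> F)" by (rule smooth_map_smooth_fun[OF F d(1)])
  have \<psi>: "smooth_fun \<A> ?U (?\<psi> b)" for b
    using smooth_fun_inner_left[OF A o Fd, of b] by (auto intro: smooth_fun_subset)
  have comp: "tcomp \<B> d (F q) (dF q v) \<bullet> b = differential \<A> (?\<psi> b) q v" if "q \<in> F -` fst d" for q v b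
    using tcomp_tangent_map[OF A B F chart_at_props[OF A] d(1), of q v]
      chart_deriv_bounded_linear[OF bounded_linear_inner_left A o that Fd chart_at_props[OF A]] that
    by (simp add: differential_chart_deriv tcomp_chart_at[OF A])
  have dd: "differential \<A> (\<lambda>q. tcomp \<B> d (F q) (dF q (Y q)) \<bullet> b) p v = differential \<A> (\<lambda>q. differential \<A> (?\<psi> b) q (Y q)) p v"
    if "Y \<in> VF ?U" for Y v b
    by (rule differential_cong[OF A U'(1,2) smooth_fun_differential[OF A U'(1) \<psi> that]]) (use comp in auto)
  let ?w = "\<lambda>b. chart_field \<B> d b (F p)"
  let ?X = "chart_field \<B> d (dF p (X p))" and ?Y = "chart_field \<B> d (dF p (Y p))"
  note cv = chart_field_vector_field[OF B d(1)]
  have "nabt ?X ?Y (F p) - nabt ?Y ?X (F p) = lie_bracket \<B> ?X ?Y (F p)"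
    using nabt cv d(2) chart_props(1)[OF B d(1)] unfolding levi_civita_def by blast
  then have nab0: "nabt ?X ?Y (F p) = nabt ?Y ?X (F p)"
    using lie_bracket_chart_field by (simp add: d_def)
  have "D X (\<lambda>q. dF q (Y q)) p - D Y (\<lambda>q. dF q (X q)) p =
     (\<Sum>b\<in>Basis. differential \<A> (\<lambda>q. differential \<A> (?\<psi> b) q (Y q)) p (X p) *\<^sub>R ?w b) -
     (\<Sum>b\<in>Basis. differential \<A> (\<lambda>q. differential \<A> (?\<psi> b) q (X q)) p (Y p) *\<^sub>R ?w b)"
    using D_formula[OF U'(1,2) X' FA_dF[OF U'(1) Y'], folded d_def]
      D_formula[OF U'(1,2) Y' FA_dF[OF U'(1) X'], folded d_def] nab0
    by (simp add: dd[OF X'] dd[OF Y'])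
  also have "\<dots> = (\<Sum>b\<in>Basis. differential \<A> (?\<psi> b) p (lie_bracket \<A> X Y p) *\<^sub>R ?w b)"
    using differential_lie_bracket[OF A U'(1,2) \<psi> X' Y']
    by (simp add: sum_subtractf[symmetric] scaleR_diff_left)
  also have "\<dots> = dF p (lie_bracket \<A> X Y p)"
    using chart_field_Basis[OF B d(1), of "F p" "dF p (lie_bracket \<A> X Y p)"] comp d(2) by simp
  finally show ?thesis .
qed

end

section \<open>Umbilical lightlike directions\<close>

locale umbilical_immersion = pullback_metric_connection \<A> \<B> \<Psi> gt nabt D
  for \<A> :: "('m::{t2_space,second_countable_topology}, 'e::euclidean_space) chart set"
    and \<B> :: "('w::{t2_space,second_countable_topology}, 'f::euclidean_space) chart set"
    and \<Psi> :: "'m \<Rightarrow> 'w"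
    and gt :: "'w \<Rightarrow> 'f \<Rightarrow> 'f \<Rightarrow> real"
    and nabt :: "('w \<Rightarrow> 'f) \<Rightarrow> ('w \<Rightarrow> 'f) \<Rightarrow> ('w \<Rightarrow> 'f)"
    and D :: "('m \<Rightarrow> 'e) \<Rightarrow> ('m \<Rightarrow> 'f) \<Rightarrow> ('m \<Rightarrow> 'f)" +
  fixes g :: "'m \<Rightarrow> 'e \<Rightarrow> 'e \<Rightarrow> real"
    and nab :: "('m \<Rightarrow> 'e) \<Rightarrow> ('m \<Rightarrow> 'e) \<Rightarrow> ('m \<Rightarrow> 'e)"
    and \<xi> \<eta> :: "'m \<Rightarrow> 'f"
    and lam :: "'m \<Rightarrow> real"
    and \<omega> :: "'m \<Rightarrow> 'e \<Rightarrow> real"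
  assumes codim: "DIM('f) = DIM('e) + 2"
    and immersion: "spacelike_immersion \<A> \<B> gt \<Psi>"
    and g: "g = pullback_metric \<A> \<B> \<Psi> gt"
    and nab: "levi_civita \<A> g nab"
    and xi: "\<xi> \<in> normal_fields \<A> \<B> gt \<Psi>" "lightlike gt \<Psi> \<xi>"
    and lam: "smooth_fun \<A> UNIV lam" "\<forall>p. lam p > 0"
    and umbilical: "\<forall>X\<in>vector_fields \<A> UNIV. \<forall>p.
          shape_operator \<A> \<B> gt \<Psi> D \<xi> X p = lam p *\<^sub>R X p"
    and eta: "\<eta> \<in> normal_fields \<A> \<B> gt \<Psi>" "lightlike gt \<Psi> \<eta>"
          "\<forall>p. gt (\<Psi> p) (\<xi> p) (\<eta> p) = -1"
    and omega: "one_form \<A> \<omega>"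
          "\<forall>X\<in>vector_fields \<A> UNIV. \<forall>p.
             normal_connection \<A> \<B> gt \<Psi> D X \<xi> p = \<omega> p (X p) *\<^sub>R \<xi> p"
begin

abbreviation "lie \<equiv> lie_bracket \<A>"
abbreviation "R \<equiv> curvature \<A> D"

lemma riemannian: "riemannian_metric \<A> g"
  using immersion by (simp add: spacelike_immersion_def g)

lemma g_tensor: "symmetric_2tensor \<A> g"
  using riemannian by (simp add: riemannian_metric_def)

lemma g_pos: "v \<noteq> 0 \<Longrightarrow> g p v v > 0"
  using riemannian by (simp add: riemannian_metric_def)

lemmas g_bilinear = symmetric_2tensorD(1)[OF g_tensor]
lemmas g_sym = symmetric_2tensorD(2)[OF g_tensor]
lemmas g_smooth = symmetric_2tensorD(3)[OF g_tensor]
lemmas g_simps = bilinear_ladd[OF g_bilinear] bilinear_radd[OF g_bilinear]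
  bilinear_lsub[OF g_bilinear] bilinear_rsub[OF g_bilinear]
  bilinear_lmul[OF g_bilinear] bilinear_rmul[OF g_bilinear]
  bilinear_lzero[OF g_bilinear] bilinear_rzero[OF g_bilinear]

lemma gt_dF: "gt (\<Psi> p) (dF p v) (dF p w) = g p v w"
  by (simp add: g pullback_metric_def)

lemma dF_linear: "linear (dF p)"
  by (rule linear_tangent_map[OF A B F])

lemmas dF_simps = linear_add[OF dF_linear] linear_diff[OF dF_linear] linear_cmul[OF dF_linear]
  linear_0[OF dF_linear]

lemma nab_connection: "linear_connection \<A> VF nab"
  using nab by (simp add: levi_civita_def)

lemma nab_torsion_free:
  "open U \<Longrightarrow> X \<in> VF U \<Longrightarrow> Y \<in> VF U \<Longrightarrow> p \<in> U \<Longrightarrow> nab X Y p - nab Y X p = lie X Y p"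
  using nab unfolding levi_civita_def by blast

lemma nab_metric:
  "open U \<Longrightarrow> X \<in> VF U \<Longrightarrow> Y \<in> VF U \<Longrightarrow> Z \<in> VF U \<Longrightarrow> p \<in> U \<Longrightarrow>
    differential \<A> (\<lambda>q. g q (Y q) (Z q)) p (X p) = g p (nab X Y p) (Z p) + g p (Y p) (nab X Z p)"
  using nab unfolding levi_civita_def by blast

lemmas nab_closed = connection_closed[OF nab_connection]

text \<open>The bracket is a difference of two fields produced by \<open>nab\<close>, so its
  smoothness comes from the connection and avoids the jumping preferred charts of its
  definition.\<close>

lemma lie_closed:
  assumes "open U" "X \<in> VF U" "Y \<in> VF U"
  shows "lie X Y \<in> VF U"
  by (rule vector_fields_cong[OF A assms(1) _ vector_fields_minus[OF A assms(1)
        nab_closed[OF assms] nab_closed[OF assms(1,3,2)]]])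
    (use nab_torsion_free[OF assms] in auto)

lemma VF_UNIV: "X \<in> VF UNIV \<Longrightarrow> X \<in> VF U"
  by (rule vector_fields_subset[OF A]) auto

lemma FA_UNIV: "Z \<in> FA UNIV \<Longrightarrow> Z \<in> FA U"
  by (rule FA_subset) auto

lemma xi_along: "\<xi> \<in> FA U" and eta_along: "\<eta> \<in> FA U"
  using xi(1) eta(1) FA_UNIV by (simp_all add: normal_fields_def)

lemma lam_smooth: "smooth_fun \<A> U lam"
  by (rule smooth_fun_subset[OF lam(1)]) auto

lemma omega_smooth: "open U \<Longrightarrow> X \<in> VF U \<Longrightarrow> smooth_fun \<A> U (\<lambda>p. \<omega> p (X p))"
  using omega(1) by (simp add: one_form_def)

lemma gt_normal [simp]:
  "gt (\<Psi> p) (\<xi> p) (dF p v) = 0" "gt (\<Psi> p) (dF p v) (\<xi> p) = 0"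
  "gt (\<Psi> p) (\<eta> p) (dF p v) = 0" "gt (\<Psi> p) (dF p v) (\<eta> p) = 0"
  "gt (\<Psi> p) (\<xi> p) (\<xi> p) = 0" "gt (\<Psi> p) (\<eta> p) (\<eta> p) = 0"
  "gt (\<Psi> p) (\<xi> p) (\<eta> p) = -1" "gt (\<Psi> p) (\<eta> p) (\<xi> p) = -1"
  using xi eta gt_sym[of "\<Psi> p" "dF p v"] gt_sym[of "\<Psi> p" "\<eta> p" "\<xi> p"]
  by (simp_all add: normal_fields_def lightlike_def)

lemma orthonormal_basis_exists:
  "\<exists>e. \<forall>i<DIM('e). \<forall>j<DIM('e). g p (e i) (e j) = (if i = j then 1 else 0)"
proof -
  obtain U E where "p \<in> U" "orthonormal_frame \<A> (on_fields g) U E"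
    using orthonormal_frame_exists[OF A riemannian, of p] by blast
  then show ?thesis
    by (intro exI[of _ "\<lambda>i. E i p"]) (simp add: orthonormal_frame_def on_fields_def)
qed

lemma g_expansion:
  assumes "\<And>i j. i < DIM('e) \<Longrightarrow> j < DIM('e) \<Longrightarrow> g p (e i) (e j) = (if i = j then 1 else 0)"
  shows "x = (\<Sum>i<DIM('e). g p x (e i) *\<^sub>R e i)"
  by (rule orthonormal_expansion[OF g_bilinear assms])

text \<open>Nondegeneracy of \<open>gt\<close> in an adapted basis: a tangent orthonormal basis
  completed by \<open>\<xi>\<close> and \<open>\<eta>\<close>. Codimension two makes the number of
  vectors right.\<close>

lemma gt_eqI:
  assumes "\<And>w. gt (\<Psi> p) z (dF p w) = gt (\<Psi> p) z' (dF p w)"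
    and "gt (\<Psi> p) z (\<xi> p) = gt (\<Psi> p) z' (\<xi> p)" "gt (\<Psi> p) z (\<eta> p) = gt (\<Psi> p) z' (\<eta> p)"
  shows "z = z'"
proof -
  let ?n = "DIM('e)"
  obtain e where e: "\<And>i j. i < ?n \<Longrightarrow> j < ?n \<Longrightarrow> g p (e i) (e j) = (if i = j then 1 else 0)"
    using orthonormal_basis_exists[of p] by blast
  define v where "v i = (if i < ?n then dF p (e i) else if i = ?n then \<xi> p else \<eta> p)" for i
  \<comment> \<open>The dual family: for a null pair with product -1 the two vectors exchange roles
    and change sign.\<close>
  define u where "u i = (if i < ?n then dF p (e i) else if i = ?n then - \<eta> p else - \<xi> p)" for i
  have exp: "x = (\<Sum>i<DIM('f). gt (\<Psi> p) x (u i) *\<^sub>R v i)" for x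
  proof (rule dual_basis_expansion)
    show "linear (\<lambda>x. gt (\<Psi> p) x (u i))" for i
      using gt_bilinear by (simp add: bilinear_def)
    show "gt (\<Psi> p) (v j) (u i) = (if i = j then 1 else 0)" if "i < DIM('f)" "j < DIM('f)" for i j
    proof -
      have "i < ?n \<or> i = ?n \<or> i = ?n + 1" "j < ?n \<or> j = ?n \<or> j = ?n + 1"
        using that codim by auto
      then show ?thesis
        using e[of j i] by (auto simp: u_def v_def gt_simps gt_dF)
    qed
  qed
  have "gt (\<Psi> p) z (u i) = gt (\<Psi> p) z' (u i)" for i
    using assms by (simp add: u_def gt_simps)
  then show ?thesis
    by (intro trans[OF exp[of z]]) (simp only: exp[of z', symmetric])
qed

text \<open>The remaining component lies along \<open>\<xi>\<close> and is detected by
  \<open>\<eta>\<close>; the sign comes from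
  \<open>gt (\<Psi> p) (\<xi> p) (\<eta> p) = -1\<close>.\<close>

lemma line_eqI:
  assumes "\<And>w. gt (\<Psi> p) z (dF p w) = 0" "gt (\<Psi> p) z (\<xi> p) = 0"
  shows "z = (- gt (\<Psi> p) z (\<eta> p)) *\<^sub>R \<xi> p"
  by (rule gt_eqI[of p]) (use assms in \<open>simp_all add: gt_simps\<close>)

lemma D_pointwise:
  assumes U: "open U" "p \<in> U" and X: "X \<in> VF U" and V: "open V" "p \<in> V" and X': "X' \<in> VF V"
    and eq: "X p = X' p" and Z: "Z \<in> FA U" "Z \<in> FA V"
  shows "D X Z p = D X' Z p"
proof -
  have UV: "open (U \<inter> V)" "p \<in> U \<inter> V" using U V by auto
  obtain L where L: "\<And>V' X. open V' \<Longrightarrow> p \<in> V' \<Longrightarrow> V' \<subseteq> U \<inter> V \<Longrightarrow> X \<in> VF V' \<Longrightarrow> D X Z p = L (X p)"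
    using connection_pointwise[OF A D_connection UV, of Z] FA_subset[OF Z(1)] by auto
  show ?thesis
    using L[OF UV order_refl] vector_fields_subset[OF A X] vector_fields_subset[OF A X'] eq by simp
qed

lemma D_xi:
  assumes U: "open U" "p \<in> U" and X: "X \<in> VF U"
  shows "D X \<xi> p = \<omega> p (X p) *\<^sub>R \<xi> p - lam p *\<^sub>R dF p (X p)"
proof -
  \<comment> \<open>Umbilicity and the equation for \<open>\<omega>\<close> are given for global
    fields, so the local \<open>X\<close> is replaced by a global field with the same value at
    \<open>p\<close>.\<close>
  obtain X' where X': "X' \<in> VF UNIV" "X' p = X p"
    using vector_field_extension[OF A] by blast
  have "D X' \<xi> p + dF p (lam p *\<^sub>R X' p) = \<omega> p (X' p) *\<^sub>R \<xi> p"
    using umbilical omega(2) X'(1) unfolding normal_connection_def by metis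
  moreover have "D X \<xi> p = D X' \<xi> p"
    by (rule D_pointwise[OF U X open_UNIV UNIV_I X'(1) _ xi_along xi_along]) (simp add: X'(2))
  ultimately show ?thesis
    by (simp add: X'(2) dF_simps algebra_simps)
qed

text \<open>\<open>D X \<eta> p\<close> as a function of the vector \<open>X p\<close> alone. This
  turns the second fundamental form in direction \<open>\<eta>\<close> into a bilinear form on a
  tangent space, which a trace can act on.\<close>

definition eta_deriv :: "'m \<Rightarrow> 'e \<Rightarrow> 'f" where
  "eta_deriv p v = D (chart_field \<A> (chart_at \<A> p) v) \<eta> p"

lemma D_eta:
  assumes U: "open U" "p \<in> U" and X: "X \<in> VF U"
  shows "D X \<eta> p = eta_deriv p (X p)"
  unfolding eta_deriv_def
  by (rule D_pointwise[OF U X chart_props(1)[OF A chart_at_props(1)[OF A]] chart_at_props(2)[OF A]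
        chart_field_vector_field[OF A chart_at_props(1)[OF A]] _ eta_along eta_along])
    (simp add: chart_field_chart_at[OF A])

lemma linear_eta_deriv: "linear (eta_deriv p)"
proof -
  obtain L where L: "linear L" "\<And>V X. open V \<Longrightarrow> p \<in> V \<Longrightarrow> X \<in> VF V \<Longrightarrow> D X \<eta> p = L (X p)"
    using connection_pointwise[OF A D_connection open_UNIV UNIV_I, of \<eta> p] eta_along by auto
  have "eta_deriv p v = L v" for v
    unfolding eta_deriv_def
    using L(2)[OF chart_props(1)[OF A chart_at_props(1)[OF A]] chart_at_props(2)[OF A]
        chart_field_vector_field[OF A chart_at_props(1)[OF A]]]
    by (simp add: chart_field_chart_at[OF A])
  then show ?thesis using L(1) by (metis ext)
qed

text \<open>\<open>eta_form p v w\<close> is \<open>g(A\<^sub>\<eta> v, w) = gt(II(v, w), \<eta>)\<close>.\<close>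

definition eta_form :: "'m \<Rightarrow> 'e \<Rightarrow> 'e \<Rightarrow> real" where
  "eta_form p v w = - gt (\<Psi> p) (eta_deriv p v) (dF p w)"

lemma eta_form_bilinear: "bilinear (eta_form p)"
  unfolding bilinear_def eta_form_def
  by (auto intro!: linearI simp: linear_add[OF linear_eta_deriv] linear_cmul[OF linear_eta_deriv]
      gt_simps dF_simps)

text \<open>Differentiate the vanishing product of \<open>\<eta>\<close> with the tangential field
  \<open>dF q (Y q)\<close>.\<close>

lemma eta_form_eq:
  assumes U: "open U" "p \<in> U" and X: "X \<in> VF U" and Y: "Y \<in> VF U"
  shows "gt (\<Psi> p) (D X (\<lambda>q. dF q (Y q)) p) (\<eta> p) = eta_form p (X p) (Y p)"
  using D_metric[OF U X eta_along FA_dF[OF U(1) Y]] D_eta[OF U X] gt_sym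
  by (simp add: differential_const eta_form_def)

text \<open>The antisymmetric part pairs \<open>\<eta>\<close> with \<open>dF p (lie X Y p)\<close>,
  which is tangential.\<close>

lemma eta_form_sym: "eta_form p v w = eta_form p w v"
proof -
  obtain X Y where X: "X \<in> VF UNIV" "X p = v" and Y: "Y \<in> VF UNIV" "Y p = w"
    using vector_field_extension[OF A] by metis
  have "gt (\<Psi> p) (D X (\<lambda>q. dF q (Y q)) p - D Y (\<lambda>q. dF q (X q)) p) (\<eta> p) = 0"
    using D_torsion_free[OF open_UNIV UNIV_I X(1) Y(1)] by simp
  then show ?thesis
    using eta_form_eq[OF open_UNIV UNIV_I X(1) Y(1)] eta_form_eq[OF open_UNIV UNIV_I Y(1) X(1)]
    by (simp add: gt_simps X(2) Y(2))
qed

lemma eta_form_smooth: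
  assumes U: "open U" and X: "X \<in> VF U" and Y: "Y \<in> VF U"
  shows "smooth_fun \<A> U (\<lambda>p. eta_form p (X p) (Y p))"
  by (rule smooth_fun_cong[OF A U _ smooth_gt[OF U D_closed[OF U X FA_dF[OF U Y]] eta_along]])
    (rule eta_form_eq[OF U _ X Y])

text \<open>\<open>shape_operator\<close> is a definite description: Riesz representation in an
  orthonormal basis provides a vector, and positivity of \<open>g\<close> shows that there is only
  one.\<close>

lemma g_shape_eta: "g p v (shape_operator \<A> \<B> gt \<Psi> D \<eta> X p) = eta_form p (X p) v"
  if X: "X \<in> VF UNIV"
proof -
  let ?P = "\<lambda>u. \<forall>w. gt (\<Psi> p) (D X \<eta> p + dF p u) (dF p w) = 0"
  have P: "?P u \<longleftrightarrow> (\<forall>w. g p u w = eta_form p (X p) w)" for u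
    using D_eta[OF open_UNIV UNIV_I X, of p] by (simp add: gt_simps gt_dF eta_form_def add_eq_0_iff)
  obtain e where e: "\<And>i j. i < DIM('e) \<Longrightarrow> j < DIM('e) \<Longrightarrow> g p (e i) (e j) = (if i = j then 1 else 0)"
    using orthonormal_basis_exists[of p] by blast
  \<comment> \<open>The Riesz vector of the functional \<open>eta_form p (X p)\<close>.\<close>
  let ?u = "\<Sum>i<DIM('e). eta_form p (X p) (e i) *\<^sub>R e i"
  have u: "?P ?u"
    unfolding P
  proof
    fix w
    have "eta_form p (X p) w = eta_form p (X p) (\<Sum>i<DIM('e). g p w (e i) *\<^sub>R e i)"
      using g_expansion[OF e, of w] by simp
    also have "\<dots> = (\<Sum>i<DIM('e). g p w (e i) * eta_form p (X p) (e i))"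
      by (simp add: bilinear_sum_right[OF eta_form_bilinear] bilinear_rmul[OF eta_form_bilinear])
    finally show "g p ?u w = eta_form p (X p) w"
      by (simp add: bilinear_sum_left[OF g_bilinear] g_simps g_sym[of p w] mult.commute)
  qed
  have "x = ?u" if "?P x" for x
  proof (rule ccontr)
    assume "x \<noteq> ?u"
    then have "g p (x - ?u) (x - ?u) > 0" by (intro g_pos) simp
    then show False using that u unfolding P by (simp add: bilinear_lsub[OF g_bilinear])
  qed
  then have "?P (shape_operator \<A> \<B> gt \<Psi> D \<eta> X p)"
    unfolding shape_operator_def by (rule theI[of ?P, OF u])
  then show ?thesis
    unfolding P using g_sym by simp
qed

text \<open>The tangential part of \<open>D\<close> is metric and torsion-free, hence the Levi-Civita connection: the
  difference \<open>S\<close> of the two is symmetric in the first two and skew in the last two arguments.\<close>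

lemma gt_D_tangential:
  assumes U: "open U" "p \<in> U" and X: "X \<in> VF U" and Y: "Y \<in> VF U"
  shows "gt (\<Psi> p) (D X (\<lambda>q. dF q (Y q)) p) (dF p w) = g p (nab X Y p) w"
proof -
  let ?S = "\<lambda>X Y W. gt (\<Psi> p) (D X (\<lambda>q. dF q (Y q)) p) (dF p (W p)) - g p (nab X Y p) (W p)"
  have skew: "?S X Y W = - ?S X W Y" if "X \<in> VF U" "Y \<in> VF U" "W \<in> VF U" for X Y W
    using D_metric[OF U that(1) FA_dF[OF U(1) that(2)] FA_dF[OF U(1) that(3)]]
      nab_metric[OF U(1) that U(2)] gt_sym[of "\<Psi> p" "dF p (Y p)"] g_sym[of p "Y p"]
    by (simp add: gt_dF)
  have sym: "?S X Y W = ?S Y X W" if "X \<in> VF U" "Y \<in> VF U" "W \<in> VF U" for X Y W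
  proof -
    have "gt (\<Psi> p) (D X (\<lambda>q. dF q (Y q)) p - D Y (\<lambda>q. dF q (X q)) p) (dF p (W p))
        = g p (nab X Y p - nab Y X p) (W p)"
      using D_torsion_free[OF U that(1,2)] nab_torsion_free[OF U(1) that(1,2) U(2)] by (simp add: gt_dF)
    then show ?thesis by (simp add: gt_simps g_simps)
  qed
  obtain W where W: "W \<in> VF UNIV" "W p = w"
    using vector_field_extension[OF A] by blast
  note W' = VF_UNIV[OF W(1)]
  \<comment> \<open>Alternating the two symmetries six times returns to the original order of
    arguments with the opposite sign.\<close>
  have "?S X Y W = 0"
    using skew[OF X Y W'] sym[OF X W' Y] skew[OF W' X Y] sym[OF W' Y X] skew[OF Y W' X] sym[OF Y X W']
    by linarith
  then show ?thesis by (simp add: W(2))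
qed

text \<open>Differentiate the vanishing product of \<open>\<xi>\<close> with a tangential field; the
  \<open>\<omega>\<close> part of \<open>D X \<xi>\<close> is normal and drops out.\<close>

lemma gt_D_xi:
  assumes U: "open U" "p \<in> U" and X: "X \<in> VF U" and Y: "Y \<in> VF U"
  shows "gt (\<Psi> p) (D X (\<lambda>q. dF q (Y q)) p) (\<xi> p) = lam p * g p (X p) (Y p)"
  using D_metric[OF U X FA_dF[OF U(1) Y] xi_along] D_xi[OF U X] g_sym
  by (simp add: differential_const gt_simps gt_dF)

text \<open>Compare products with tangent vectors, \<open>\<xi>\<close> and \<open>\<eta>\<close>.
  Since the pair is null with product -1, the coefficient of \<open>\<eta>\<close> is minus the
  product with \<open>\<xi>\<close>, and conversely.\<close>

lemma gauss_formula:
  assumes U: "open U" "p \<in> U" and X: "X \<in> VF U" and Y: "Y \<in> VF U"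
  shows "D X (\<lambda>q. dF q (Y q)) p = dF p (nab X Y p)
    + ((- (lam p * g p (X p) (Y p))) *\<^sub>R \<eta> p + (- eta_form p (X p) (Y p)) *\<^sub>R \<xi> p)"
  by (rule gt_eqI[of p])
    (simp_all add: gt_simps gt_dF gt_D_tangential[OF U X Y] gt_D_xi[OF U X Y] eta_form_eq[OF U X Y])

text \<open>The \<open>\<eta>\<close> coefficient is the trace of \<open>- lam p * g p\<close>, that
  is \<open>- lam p\<close> times the dimension, and the dimension cancels against the normalising
  factor.\<close>

lemma mean_curvature_eq:
  assumes e: "\<And>i j. i < DIM('e) \<Longrightarrow> j < DIM('e) \<Longrightarrow> g p (e i) (e j) = (if i = j then 1 else 0)"
  shows "mean_curvature \<A> \<B> gt \<Psi> D nab p =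
    (- lam p) *\<^sub>R \<eta> p + (- (\<Sum>i<DIM('e). eta_form p (e i) (e i)) / real DIM('e)) *\<^sub>R \<xi> p"
proof -
  let ?B = "\<lambda>v w. (- (lam p * g p v w)) *\<^sub>R \<eta> p + (- eta_form p v w) *\<^sub>R \<xi> p"
  have B: "bilinear ?B"
    unfolding bilinear_def
    by (auto intro!: linearI simp: g_simps bilinear_ladd[OF eta_form_bilinear] bilinear_radd[OF eta_form_bilinear]
        bilinear_lmul[OF eta_form_bilinear] bilinear_rmul[OF eta_form_bilinear] algebra_simps)
  have "frame_trace \<A> (on_fields g) (second_fundamental_form \<A> \<B> \<Psi> D nab) p = (\<Sum>i<DIM('e). ?B (e i) (e i))"
    by (rule frame_trace_eq[OF orthonormal_frame_exists[OF A riemannian] g_bilinear g_sym B e])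
      (auto simp: on_fields_def second_fundamental_form_def gauss_formula)
  also have "\<dots> = (- (real DIM('e) * lam p)) *\<^sub>R \<eta> p + (- (\<Sum>i<DIM('e). eta_form p (e i) (e i))) *\<^sub>R \<xi> p"
    using e by (simp add: sum_subtractf sum_negf sum_constant_scaleR scaleR_sum_left)
  finally show ?thesis
    unfolding mean_curvature_def g[symmetric]
    by (simp add: scaleR_add_right scaleR_diff_right)
qed

section \<open>Tensoriality and skewness of the curvature of \<open>D\<close>\<close>

lemma R_closed:
  assumes U: "open U" and X: "X \<in> VF U" and Y: "Y \<in> VF U" and Z: "Z \<in> FA U"
  shows "R X Y Z \<in> FA U"
proof -
  have "(\<lambda>p. D X (D Y Z) p - D Y (D X Z) p - D (lie X Y) Z p) \<in> FA U"
    by (intro FA_minus[OF U] D_closed[OF U] lie_closed[OF U] X Y Z)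
  then show ?thesis by (simp add: curvature_def[abs_def])
qed

lemma R_cong:
  assumes U: "open U" "p \<in> U" and X: "X \<in> VF U" and Y: "Y \<in> VF U"
    and Z: "Z \<in> FA U" "Z' \<in> FA U" "\<And>q. q \<in> U \<Longrightarrow> Z q = Z' q"
  shows "R X Y Z p = R X Y Z' p"
proof -
  have DD: "D X (D Y Z) p = D X (D Y Z') p" if X: "X \<in> VF U" and Y: "Y \<in> VF U" for X Y
    by (rule D_cong[OF U(1) X X D_closed[OF U(1) Y Z(1)] D_closed[OF U(1) Y Z(2)] refl _ U(2)])
      (rule D_cong[OF U(1) Y Y Z(1,2) refl Z(3)])
  show ?thesis
    using DD[OF X Y] DD[OF Y X] D_cong[OF U(1) lie_closed[OF U(1) X Y] lie_closed[OF U(1) X Y] Z(1,2) refl Z(3) U(2)]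
    by (simp add: curvature_def)
qed

lemma R_add:
  assumes U: "open U" "p \<in> U" and X: "X \<in> VF U" and Y: "Y \<in> VF U" and Z: "Z \<in> FA U" "Z' \<in> FA U"
  shows "R X Y (\<lambda>q. Z q + Z' q) p = R X Y Z p + R X Y Z' p"
proof -
  have DD: "D X (D Y (\<lambda>q. Z q + Z' q)) p = D X (D Y Z) p + D X (D Y Z') p"
    if X: "X \<in> VF U" and Y: "Y \<in> VF U" for X Y
  proof -
    note YZ = D_closed[OF U(1) Y Z(1)] D_closed[OF U(1) Y Z(2)]
    have "D X (D Y (\<lambda>q. Z q + Z' q)) p = D X (\<lambda>q. D Y Z q + D Y Z' q) p"
      by (rule D_cong[OF U(1) X X D_closed[OF U(1) Y FA_add[OF U(1) Z]] FA_add[OF U(1) YZ] refl _ U(2)])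
        (rule D_add[OF U(1) Y Z])
    then show ?thesis using D_add[OF U(1) X YZ U(2)] by simp
  qed
  show ?thesis
    using DD[OF X Y] DD[OF Y X] D_add[OF U(1) lie_closed[OF U(1) X Y] Z U(2)]
    by (simp add: curvature_def)
qed

text \<open>The mixed first-order terms are symmetric in \<open>X\<close> and \<open>Y\<close> and
  cancel. The second-order terms give \<open>f\<close> differentiated along the bracket, which the
  last summand of the curvature removes.\<close>

lemma R_scaleR:
  assumes U: "open U" "p \<in> U" and X: "X \<in> VF U" and Y: "Y \<in> VF U" and Z: "Z \<in> FA U"
    and f: "smooth_fun \<A> U f"
  shows "R X Y (\<lambda>q. f q *\<^sub>R Z q) p = f p *\<^sub>R R X Y Z p"
proof -
  have DD: "D X (D Y (\<lambda>q. f q *\<^sub>R Z q)) p =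
      differential \<A> (\<lambda>q. differential \<A> f q (Y q)) p (X p) *\<^sub>R Z p + differential \<A> f p (Y p) *\<^sub>R D X Z p
      + differential \<A> f p (X p) *\<^sub>R D Y Z p + f p *\<^sub>R D X (D Y Z) p"
    if X: "X \<in> VF U" and Y: "Y \<in> VF U" for X Y
  proof -
    note YZ = D_closed[OF U(1) Y Z] and df = smooth_fun_differential[OF A U(1) f Y]
    note 1 = FA_scaleR[OF U(1) df Z] and 2 = FA_scaleR[OF U(1) f YZ]
    have "D X (D Y (\<lambda>q. f q *\<^sub>R Z q)) p = D X (\<lambda>q. differential \<A> f q (Y q) *\<^sub>R Z q + f q *\<^sub>R D Y Z q) p"
      by (rule D_cong[OF U(1) X X D_closed[OF U(1) Y FA_scaleR[OF U(1) f Z]] FA_add[OF U(1) 1 2] refl _ U(2)])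
        (rule D_scaleR[OF U(1) Y Z f])
    then show ?thesis
      using D_add[OF U(1) X 1 2 U(2)] D_scaleR[OF U(1) X Z df U(2)] D_scaleR[OF U(1) X YZ f U(2)] by simp
  qed
  show ?thesis
    using DD[OF X Y] DD[OF Y X] D_scaleR[OF U(1) lie_closed[OF U(1) X Y] Z f U(2)]
      differential_lie_bracket[OF A U f X Y]
    by (simp add: curvature_def algebra_simps)
qed

text \<open>Differentiate the function \<open>gt (\<Psi> q) (Z q) (W q)\<close> twice and
  antisymmetrise: its own second derivatives reduce to the derivative along the bracket, and the
  mixed products cancel.\<close>

lemma R_skew:
  assumes U: "open U" "p \<in> U" and X: "X \<in> VF U" and Y: "Y \<in> VF U" and Z: "Z \<in> FA U" and W: "W \<in> FA U"
  shows "gt (\<Psi> p) (R X Y Z p) (W p) = - gt (\<Psi> p) (Z p) (R X Y W p)"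
proof -
  let ?h = "\<lambda>Z W q. gt (\<Psi> q) (Z q) (W q)"
  have DD: "differential \<A> (\<lambda>q. differential \<A> (?h Z W) q (Y q)) p (X p) =
      gt (\<Psi> p) (D X (D Y Z) p) (W p) + gt (\<Psi> p) (D Y Z p) (D X W p)
      + gt (\<Psi> p) (D X Z p) (D Y W p) + gt (\<Psi> p) (Z p) (D X (D Y W) p)"
    if X: "X \<in> VF U" and Y: "Y \<in> VF U" for X Y
  proof -
    note YZ = D_closed[OF U(1) Y Z] and YW = D_closed[OF U(1) Y W]
    note s = smooth_gt[OF U(1) YZ W] smooth_gt[OF U(1) Z YW]
    have "differential \<A> (\<lambda>q. differential \<A> (?h Z W) q (Y q)) p (X p)
        = differential \<A> (\<lambda>q. ?h (D Y Z) W q + ?h Z (D Y W) q) p (X p)"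
      by (rule differential_cong[OF A U smooth_fun_add[OF A U(1) s]])
        (rule D_metric[OF U(1) _ Y Z W, symmetric])
    then show ?thesis
      using differential_add[OF A U s] D_metric[OF U X YZ W] D_metric[OF U X Z YW] by simp
  qed
  show ?thesis
    using DD[OF X Y] DD[OF Y X] differential_lie_bracket[OF A U smooth_gt[OF U(1) Z W] X Y]
      D_metric[OF U lie_closed[OF U(1) X Y] Z W]
    by (simp add: curvature_def gt_simps)
qed

text \<open>Only the first argument is summed over in the traces, so linearity is established for
  that slot with \<open>X\<close> and \<open>Z\<close> held fixed.\<close>

lemma R_pointwise:
  assumes U: "open U" "p \<in> U" and X: "X \<in> VF U" and Z: "Z \<in> FA U"
  shows "\<exists>L. linear L \<and> (\<forall>U' V. open U' \<longrightarrow> p \<in> U' \<longrightarrow> U' \<subseteq> U \<longrightarrow> V \<in> VF U' \<longrightarrow> R V X Z p = L (V p))"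
proof (rule tensorial_pointwise[OF A U])
  fix U' V V' assume U': "open U'" "p \<in> U'" "U' \<subseteq> U" and V: "V \<in> VF U'" and V': "V' \<in> VF U'"
  note o = U'(1) and p = U'(2)
  have X': "X \<in> VF U'" and Z': "Z \<in> FA U'"
    using vector_fields_subset[OF A X U'(3)] FA_subset[OF Z U'(3)] by auto
  note VV = vector_fields_add[OF A o V V']
  note XZ = D_closed[OF o X' Z'] and VZ = D_closed[OF o V Z'] and VZ' = D_closed[OF o V' Z']
  \<comment> \<open>The rules for the bracket are read off from the torsion-free connection
    \<open>nab\<close>.\<close>
  have lie_add: "lie (\<lambda>q. V q + V' q) X q = lie V X q + lie V' X q" if q: "q \<in> U'" for q
    using nab_torsion_free[OF o VV X' q] nab_torsion_free[OF o V X' q] nab_torsion_free[OF o V' X' q]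
      connection_add_left[OF nab_connection o V V' X' q] connection_add[OF nab_connection o X' V V' q]
    by (simp add: algebra_simps)
  note l = lie_closed[OF o V X'] and l' = lie_closed[OF o V' X']
  have "D (lie (\<lambda>q. V q + V' q) X) Z p = D (lie V X) Z p + D (lie V' X) Z p"
    using D_cong[OF o lie_closed[OF o VV X'] vector_fields_add[OF A o l l'] Z' Z' lie_add refl p]
      D_add_left[OF o l l' Z' p] by simp
  moreover have "D X (D (\<lambda>q. V q + V' q) Z) p = D X (D V Z) p + D X (D V' Z) p"
    using D_cong[OF o X' X' D_closed[OF o VV Z'] FA_add[OF o VZ VZ'] refl D_add_left[OF o V V' Z'] p]
      D_add[OF o X' VZ VZ' p] by simp
  ultimately show "R (\<lambda>q. V q + V' q) X Z p = R V X Z p + R V' X Z p"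
    using D_add_left[OF o V V' XZ p] by (simp add: curvature_def)
  show "R V X Z p = R V' X Z p" if eq: "\<And>q. q \<in> U' \<Longrightarrow> V q = V' q"
  proof -
    have lie_eq: "lie V X q = lie V' X q" if q: "q \<in> U'" for q
      using nab_torsion_free[OF o V X' q] nab_torsion_free[OF o V' X' q]
        connection_cong[OF nab_connection o V V' X' X' eq refl q]
        connection_cong[OF nab_connection o X' X' V V' refl eq q]
      by simp
    show ?thesis
      using D_cong[OF o V V' XZ XZ eq refl p] D_cong[OF o l l' Z' Z' lie_eq refl p]
        D_cong[OF o X' X' VZ VZ' refl D_cong[OF o V V' Z' Z' eq refl] p]
      by (simp add: curvature_def)
  qed
next
  fix U' V and f :: "'m \<Rightarrow> real"
  assume U': "open U'" "p \<in> U'" "U' \<subseteq> U" and V: "V \<in> VF U'" and f: "smooth_fun \<A> U' f"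
  note o = U'(1) and p = U'(2)
  have X': "X \<in> VF U'" and Z': "Z \<in> FA U'"
    using vector_fields_subset[OF A X U'(3)] FA_subset[OF Z U'(3)] by auto
  note fV = vector_fields_scaleR[OF A o f V]
  note XZ = D_closed[OF o X' Z'] and VZ = D_closed[OF o V Z']
  note l = lie_closed[OF o V X'] and df = smooth_fun_differential[OF A o f X']
  note fl = vector_fields_scaleR[OF A o f l] and dfV = vector_fields_scaleR[OF A o df V]
  \<comment> \<open>The extra term with the derivative of \<open>f\<close> along \<open>X\<close>
    cancels the one produced by the Leibniz rule in
    \<open>D X (D (\<lambda>q. f q *\<^sub>R V q) Z)\<close>.\<close>
  have lie_scale: "lie (\<lambda>q. f q *\<^sub>R V q) X q = f q *\<^sub>R lie V X q - differential \<A> f q (X q) *\<^sub>R V q"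
    if q: "q \<in> U'" for q
    using nab_torsion_free[OF o fV X' q, symmetric] nab_torsion_free[OF o V X' q, symmetric]
      connection_scaleR_left[OF nab_connection o V X' f q] connection_scaleR[OF nab_connection o X' V f q]
    by (simp add: scaleR_diff_right)
  have "D (lie (\<lambda>q. f q *\<^sub>R V q) X) Z p = D (\<lambda>q. f q *\<^sub>R lie V X q - differential \<A> f q (X q) *\<^sub>R V q) Z p"
    by (rule D_cong[OF o lie_closed[OF o fV X'] vector_fields_minus[OF A o fl dfV] Z' Z' lie_scale refl p])
  also have "\<dots> + D (\<lambda>q. differential \<A> f q (X q) *\<^sub>R V q) Z p = D (\<lambda>q. f q *\<^sub>R lie V X q) Z p"
    using D_add_left[OF o vector_fields_minus[OF A o fl dfV] dfV Z' p] by simp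
  finally have "D (lie (\<lambda>q. f q *\<^sub>R V q) X) Z p + differential \<A> f p (X p) *\<^sub>R D V Z p = f p *\<^sub>R D (lie V X) Z p"
    using D_scaleR_left[OF o V Z' df p] D_scaleR_left[OF o l Z' f p] by simp
  moreover have "D X (D (\<lambda>q. f q *\<^sub>R V q) Z) p = differential \<A> f p (X p) *\<^sub>R D V Z p + f p *\<^sub>R D X (D V Z) p"
    using D_cong[OF o X' X' D_closed[OF o fV Z'] FA_scaleR[OF o f VZ] refl D_scaleR_left[OF o V Z' f] p]
      D_scaleR[OF o X' VZ f p] by simp
  ultimately show "R (\<lambda>q. f q *\<^sub>R V q) X Z p = f p *\<^sub>R R V X Z p"
    using D_scaleR_left[OF o V XZ f p] by (simp add: curvature_def algebra_simps)
qed

end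

section \<open>Curvature and normality\<close>

context umbilical_immersion
begin

text \<open>Differentiate the Gauss formula. Derivatives of the two normal coefficients stay normal
  and disappear; \<open>\<eta>\<close> contributes \<open>eta_form\<close> and \<open>\<xi>\<close>
  contributes \<open>- lam\<close> times a tangent vector.\<close>

lemma gt_DD:
  assumes U: "open U" "p \<in> U" and V: "V \<in> VF U" and X: "X \<in> VF U" and Y: "Y \<in> VF U"
  shows "gt (\<Psi> p) (D V (D X (\<lambda>q. dF q (Y q))) p) (dF p w) =
    g p (nab V (nab X Y) p) w
    + lam p * (g p (X p) (Y p) * eta_form p (V p) w + eta_form p (X p) (Y p) * g p (V p) w)"
proof -
  let ?m = "\<lambda>q. - (lam q * g q (X q) (Y q))" and ?k = "\<lambda>q. - eta_form q (X q) (Y q)"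
  let ?N = "\<lambda>q. dF q (nab X Y q)"
  have m: "smooth_fun \<A> U ?m"
    using smooth_fun_bounded_linear[OF A bounded_linear_minus[OF bounded_linear_ident] U(1)
        smooth_fun_mult[OF A U(1) lam_smooth g_smooth[OF U(1) X Y]]] .
  have k: "smooth_fun \<A> U ?k"
    using smooth_fun_bounded_linear[OF A bounded_linear_minus[OF bounded_linear_ident] U(1)
        eta_form_smooth[OF U(1) X Y]] .
  note XY = nab_closed[OF U(1) X Y]
  note N = FA_dF[OF U(1) XY] and me = FA_scaleR[OF U(1) m eta_along] and kx = FA_scaleR[OF U(1) k xi_along]
  have "D V (D X (\<lambda>q. dF q (Y q))) p = D V (\<lambda>q. ?N q + (?m q *\<^sub>R \<eta> q + ?k q *\<^sub>R \<xi> q)) p"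
    by (rule D_cong[OF U(1) V V D_closed[OF U(1) X FA_dF[OF U(1) Y]]
          FA_add[OF U(1) N FA_add[OF U(1) me kx]] refl gauss_formula[OF U(1) _ X Y] U(2)])
  also have "\<dots> = D V ?N p + (differential \<A> ?m p (V p) *\<^sub>R \<eta> p + ?m p *\<^sub>R eta_deriv p (V p)
      + (differential \<A> ?k p (V p) *\<^sub>R \<xi> p + ?k p *\<^sub>R (\<omega> p (V p) *\<^sub>R \<xi> p - lam p *\<^sub>R dF p (V p))))"
    using D_add[OF U(1) V N FA_add[OF U(1) me kx] U(2)] D_add[OF U(1) V me kx U(2)]
      D_scaleR[OF U(1) V eta_along m U(2)] D_scaleR[OF U(1) V xi_along k U(2)]
      D_eta[OF U V] D_xi[OF U V]
    by simp
  finally have DD: "D V (D X (\<lambda>q. dF q (Y q))) p = \<dots>" .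
  show ?thesis
    unfolding DD using gt_D_tangential[OF U V XY]
    by (simp add: gt_simps gt_dF eta_form_def[of p "V p"] algebra_simps)
qed

text \<open>The Gauss equation: antisymmetrise the preceding formula in \<open>V\<close> and
  \<open>X\<close>, the bracket term supplying what completes the intrinsic curvature.\<close>

lemma gt_R_tangential:
  assumes U: "open U" "p \<in> U" and V: "V \<in> VF U" and X: "X \<in> VF U" and Y: "Y \<in> VF U"
  shows "gt (\<Psi> p) (R V X (\<lambda>q. dF q (Y q)) p) (dF p w) =
    g p (curvature \<A> nab V X Y p) w
    + lam p * (g p (X p) (Y p) * eta_form p (V p) w + eta_form p (X p) (Y p) * g p (V p) w
      - g p (V p) (Y p) * eta_form p (X p) w - eta_form p (V p) (Y p) * g p (X p) w)"
  using gt_DD[OF U V X Y] gt_DD[OF U X V Y] gt_D_tangential[OF U lie_closed[OF U(1) V X] Y]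
  by (simp add: curvature_def gt_simps g_simps algebra_simps)

text \<open>The derivative of \<open>\<omega>\<close> multiplies \<open>\<xi>\<close>, so no
  derivative of \<open>\<omega>\<close> survives tangentially; only the derivative of
  \<open>lam\<close> does.\<close>

lemma gt_DD_xi:
  assumes U: "open U" "p \<in> U" and X: "X \<in> VF U" and Y: "Y \<in> VF U"
  shows "gt (\<Psi> p) (D X (D Y \<xi>) p) (dF p w) =
    - (differential \<A> lam p (X p) * g p (Y p) w) - lam p * g p (nab X Y p) w
    - lam p * \<omega> p (Y p) * g p (X p) w"
proof -
  let ?k = "\<lambda>q. \<omega> q (Y q)" and ?m = "\<lambda>q. - lam q"
  have k: "smooth_fun \<A> U ?k" by (rule omega_smooth[OF U(1) Y])
  have m: "smooth_fun \<A> U ?m" 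
    by (rule smooth_fun_bounded_linear[OF A bounded_linear_minus[OF bounded_linear_ident] U(1) lam_smooth])
  have dm: "differential \<A> ?m p v = - differential \<A> lam p v" for v
    using differential_mult[OF A U smooth_fun_const lam_smooth, of "-1" v] by (simp add: differential_const)
  note dY = FA_dF[OF U(1) Y]
  note kx = FA_scaleR[OF U(1) k xi_along] and mY = FA_scaleR[OF U(1) m dY]
  have "D X (D Y \<xi>) p = D X (\<lambda>q. ?k q *\<^sub>R \<xi> q + ?m q *\<^sub>R dF q (Y q)) p"
    by (rule D_cong[OF U(1) X X D_closed[OF U(1) Y xi_along] FA_add[OF U(1) kx mY] refl _ U(2)])
      (simp add: D_xi[OF U(1) _ Y])
  also have "\<dots> = differential \<A> ?k p (X p) *\<^sub>R \<xi> p + ?k p *\<^sub>R (\<omega> p (X p) *\<^sub>R \<xi> p - lam p *\<^sub>R dF p (X p))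
      + (differential \<A> ?m p (X p) *\<^sub>R dF p (Y p) + ?m p *\<^sub>R D X (\<lambda>q. dF q (Y q)) p)"
    using D_add[OF U(1) X kx mY U(2)] D_scaleR[OF U(1) X xi_along k U(2)] D_scaleR[OF U(1) X dY m U(2)]
      D_xi[OF U X] by simp
  finally have DD: "D X (D Y \<xi>) p = \<dots>" .
  show ?thesis
    unfolding DD using gt_D_tangential[OF U X Y, of w]
    by (simp add: gt_simps gt_dF dm algebra_simps)
qed

text \<open>The Codazzi equation for \<open>\<xi>\<close>. The terms with \<open>nab\<close> combine
  to the bracket and cancel against the last summand of the curvature.\<close>

lemma gt_R_xi:
  assumes U: "open U" "p \<in> U" and X: "X \<in> VF U" and Y: "Y \<in> VF U"
  shows "gt (\<Psi> p) (R X Y \<xi> p) (dF p w) =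
    (lam p * \<omega> p (X p) - differential \<A> lam p (X p)) * g p (Y p) w
    - (lam p * \<omega> p (Y p) - differential \<A> lam p (Y p)) * g p (X p) w"
proof -
  have l: "g p (lie X Y p) w = g p (nab X Y p) w - g p (nab Y X p) w"
    using nab_torsion_free[OF U(1) X Y U(2), symmetric] by (simp add: g_simps)
  show ?thesis
    unfolding curvature_def gt_simps gt_DD_xi[OF U X Y] gt_DD_xi[OF U Y X]
      D_xi[OF U lie_closed[OF U(1) X Y]] gt_dF l
    by (simp add: algebra_simps)
qed

lemma R_xi_line:
  assumes om: "\<And>v. lam p * \<omega> p v = differential \<A> lam p v"
    and U: "open U" "p \<in> U" and X: "X \<in> VF U" and Y: "Y \<in> VF U"
  shows "\<exists>k. R X Y \<xi> p = k *\<^sub>R \<xi> p"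
proof -
  have "gt (\<Psi> p) (R X Y \<xi> p) (\<xi> p) = 0"
    using R_skew[OF U X Y xi_along xi_along] gt_sym[of "\<Psi> p" "\<xi> p"] by simp
  then show ?thesis
    using gt_R_xi[OF U X Y] om
    by (intro exI[of _ "- gt (\<Psi> p) (R X Y \<xi> p) (\<eta> p)"] line_eqI) simp_all
qed

section \<open>The associated tractor bundle and its quotient by the line\<close>

abbreviation "T \<equiv> associated_tractor \<A> \<B> gt \<Psi> D \<xi>"

lemma T_simps [simp]:
  "sections T = FA" "bundle_metric T p = gt (\<Psi> p)" "line_bundle T p = range (\<lambda>k. k *\<^sub>R \<xi> p)" "tractor_conn T = D"
  by (simp_all add: associated_tractor_def span_singleton)

lemma line_sections_iff: "\<sigma> \<in> line_sections T U \<longleftrightarrow> \<sigma> \<in> FA U \<and> (\<forall>p\<in>U. \<exists>k. \<sigma> p = k *\<^sub>R \<xi> p)"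
  by (auto simp: line_sections_def)

text \<open>Pairing with \<open>\<eta>\<close> recovers the coefficient up to sign, which is why it
  is smooth.\<close>

lemma line_section_coefficient:
  assumes U: "open U" and \<sigma>: "\<sigma> \<in> line_sections T U"
  shows "\<exists>f. smooth_fun \<A> U f \<and> (\<forall>p\<in>U. \<sigma> p = f p *\<^sub>R \<xi> p)"
proof (intro exI conjI ballI)
  let ?f = "\<lambda>p. (-1) * gt (\<Psi> p) (\<sigma> p) (\<eta> p)"
  show "smooth_fun \<A> U ?f"
    using \<sigma> by (intro smooth_fun_mult[OF A U smooth_fun_const] smooth_gt[OF U _ eta_along])
      (simp add: line_sections_iff)
  show "\<sigma> p = ?f p *\<^sub>R \<xi> p" if "p \<in> U" for p
    using \<sigma> that by (auto simp: line_sections_iff gt_simps)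
qed

lemma xi_nonzero: "\<xi> p \<noteq> 0"
  using xi(2) by (simp add: lightlike_def)

lemma R_line:
  assumes om: "\<And>v. lam p * \<omega> p v = differential \<A> lam p v"
    and U: "open U" "p \<in> U" and X: "X \<in> VF U" and Y: "Y \<in> VF U" and f: "smooth_fun \<A> U f"
  shows "\<exists>k. R X Y (\<lambda>q. f q *\<^sub>R \<xi> q) p = k *\<^sub>R \<xi> p"
  using R_xi_line[OF om U X Y] R_scaleR[OF U X Y xi_along f] by auto

lemma R_line_sections_iff:
  assumes dim: "DIM('e) \<ge> 2"
  shows "(\<forall>X\<in>VF UNIV. \<forall>Y\<in>VF UNIV. \<forall>\<sigma>\<in>line_sections T UNIV. R X Y \<sigma> \<in> line_sections T UNIV) \<longleftrightarrow>
    (\<forall>p v. lam p * \<omega> p v = differential \<A> lam p v)" (is "?L \<longleftrightarrow> ?R")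
proof
  assume L: ?L
  show ?R
  proof (intro allI)
    fix p v
    \<comment> \<open>A nonzero vector orthogonal to \<open>v\<close> exists since the dimension is
      at least 2. Testing the Codazzi equation on \<open>Y = w\<close> and on \<open>w\<close>
      itself isolates the coefficient belonging to \<open>v\<close>.\<close>
    obtain w where w: "w \<noteq> 0" "g p v w = 0"
    proof (cases "v = 0")
      case True
      then show thesis using that[of "SOME b. b \<in> Basis"] nonzero_Basis SOME_Basis by (auto simp: g_simps)
    next
      case False
      have "dim {v} < DIM('e)" using dim dim_le_card[of "{v}" "{v}"] by (simp add: span_superset)
      then have "span {v} \<noteq> UNIV" by (metis dim_span dim_UNIV less_irrefl)
      then obtain u where u: "u \<notin> span {v}" by blast
      \<comment> \<open>The orthogonal projection of \<open>u\<close> away from \<open>v\<close>,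
        multiplied by \<open>g p v v\<close> to avoid a quotient.\<close>
      let ?w = "g p v v *\<^sub>R u - g p v u *\<^sub>R v"
      have "?w \<noteq> 0"
      proof
        assume "?w = 0"
        then have "u = (g p v u / g p v v) *\<^sub>R v"
          using g_pos[OF False, of p] by (simp add: field_simps eq_vector_fraction_iff)
        then show False using u by (simp add: span_singleton)
      qed
      then show thesis using that[of ?w] by (simp add: g_simps)
    qed
    obtain X Y where X: "X \<in> VF UNIV" "X p = v" and Y: "Y \<in> VF UNIV" "Y p = w"
      using vector_field_extension[OF A] by metis
    have "\<xi> \<in> line_sections T UNIV"
      using xi_along by (auto simp: line_sections_iff intro!: exI[of _ 1])
    then have "R X Y \<xi> \<in> line_sections T UNIV" using L X(1) Y(1) by blast
    then obtain k where "R X Y \<xi> p = k *\<^sub>R \<xi> p" by (auto simp: line_sections_iff)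
    then have "gt (\<Psi> p) (R X Y \<xi> p) (dF p w) = 0" by (simp add: gt_simps)
    then have "(lam p * \<omega> p v - differential \<A> lam p v) * g p w w = 0"
      using gt_R_xi[OF open_UNIV UNIV_I X(1) Y(1), of p w] by (simp add: X(2) Y(2) w)
    then show "lam p * \<omega> p v = differential \<A> lam p v"
      using g_pos[OF w(1), of p] by simp
  qed
next
  assume om: ?R
  show ?L
  proof (intro ballI)
    fix X Y \<sigma> assume X: "X \<in> VF UNIV" and Y: "Y \<in> VF UNIV" and \<sigma>: "\<sigma> \<in> line_sections T UNIV"
    obtain f where f: "smooth_fun \<A> UNIV f" "\<And>p. \<sigma> p = f p *\<^sub>R \<xi> p"
      using line_section_coefficient[OF open_UNIV \<sigma>] by blast
    have "\<sigma> = (\<lambda>p. f p *\<^sub>R \<xi> p)" using f(2) by auto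
    then have "\<exists>k. R X Y \<sigma> p = k *\<^sub>R \<xi> p" for p
      using R_line[OF _ open_UNIV UNIV_I X Y f(1), of p] om by simp
    then show "R X Y \<sigma> \<in> line_sections T UNIV"
      using R_closed[OF open_UNIV X Y] \<sigma> by (auto simp: line_sections_iff)
  qed
qed

text \<open>Written in the form that the body of \<open>beta\<close> takes after
  \<open>T_simps\<close>, so cosets from the definitions match it literally.\<close>

abbreviation coset :: "'m \<Rightarrow> 'f \<Rightarrow> 'f set" where
  "coset p a \<equiv> {a + t | t. t \<in> range (\<lambda>k. k *\<^sub>R \<xi> p)}"

lemma mem_coset: "x \<in> coset p a \<longleftrightarrow> (\<exists>k. x = a + k *\<^sub>R \<xi> p)"
  by auto

lemma coset_shift: "coset p (a + k *\<^sub>R \<xi> p) = coset p a"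
proof (intro set_eqI iffI)
  fix x
  show "x \<in> coset p a" if x: "x \<in> coset p (a + k *\<^sub>R \<xi> p)"
  proof -
    obtain l where "x = (a + k *\<^sub>R \<xi> p) + l *\<^sub>R \<xi> p" using x unfolding mem_coset by blast
    then have "x = a + (k + l) *\<^sub>R \<xi> p" by (simp add: algebra_simps)
    then show ?thesis by blast
  qed
  show "x \<in> coset p (a + k *\<^sub>R \<xi> p)" if x: "x \<in> coset p a"
  proof -
    obtain l where "x = a + l *\<^sub>R \<xi> p" using x by auto
    then have "x = (a + k *\<^sub>R \<xi> p) + (l - k) *\<^sub>R \<xi> p" by (simp add: algebra_simps)
    then show ?thesis by blast
  qed
qed

text \<open>Changing a representative adds a multiple of \<open>\<xi>\<close>, which is null and
  orthogonal to both \<open>a\<close> and \<open>b\<close>. Hence the description has exactly one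
  value.\<close>

lemma quot_metric_coset:
  assumes "gt (\<Psi> p) a (\<xi> p) = 0" "gt (\<Psi> p) b (\<xi> p) = 0"
  shows "quot_metric T p (coset p a) (coset p b) = gt (\<Psi> p) a b"
proof -
  have const: "gt (\<Psi> p) x y = gt (\<Psi> p) a b" if "x \<in> coset p a" "y \<in> coset p b" for x y
    using that assms gt_sym[of "\<Psi> p" "\<xi> p" b] by (auto simp: gt_simps)
  have mem: "a \<in> coset p a" "b \<in> coset p b"
    unfolding mem_coset by (rule exI[of _ 0], simp)+
  show ?thesis
    unfolding quot_metric_def T_simps
  proof (rule the_equality)
    show "\<forall>x\<in>coset p a. \<forall>y\<in>coset p b. gt (\<Psi> p) x y = gt (\<Psi> p) a b"
      by (intro ballI const)
    show "r = gt (\<Psi> p) a b" if "\<forall>x\<in>coset p a. \<forall>y\<in>coset p b. gt (\<Psi> p) x y = r" for r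
      by (rule bspec[OF bspec[OF that mem(1)] mem(2), symmetric])
  qed
qed

lemma D_line_section:
  assumes U: "open U" "p \<in> U" and X: "X \<in> VF U" and f: "smooth_fun \<A> U f"
    and \<sigma>: "\<sigma> \<in> FA U" "\<And>p. p \<in> U \<Longrightarrow> \<sigma> p = f p *\<^sub>R \<xi> p"
  shows "D X \<sigma> p = (- (f p * lam p)) *\<^sub>R dF p (X p) + (differential \<A> f p (X p) + f p * \<omega> p (X p)) *\<^sub>R \<xi> p"
  using D_cong[OF U(1) X X \<sigma>(1) FA_scaleR[OF U(1) f xi_along] refl \<sigma>(2) U(2)]
    D_scaleR[OF U(1) X xi_along f U(2)] D_xi[OF U X]
  by (simp add: algebra_simps)

text \<open>The coset absorbs every multiple of \<open>\<xi>\<close>, including the derivative of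
  \<open>f\<close> and \<open>\<omega>\<close>.\<close>

lemma beta_coset:
  assumes "open U" "p \<in> U" "X \<in> VF U" "smooth_fun \<A> U f" "\<sigma> \<in> FA U" "\<And>p. p \<in> U \<Longrightarrow> \<sigma> p = f p *\<^sub>R \<xi> p"
  shows "beta T \<sigma> X p = coset p ((- (f p * lam p)) *\<^sub>R dF p (X p))"
proof -
  have "beta T \<sigma> X p = coset p (D X \<sigma> p)" by (simp only: beta_def T_simps)
  then show ?thesis by (simp only: D_line_section[OF assms] coset_shift)
qed

lemma sigma_metric_eq:
  assumes "open U" "p \<in> U" "X \<in> VF U" "Y \<in> VF U" "smooth_fun \<A> U f" "\<sigma> \<in> FA U" "\<And>p. p \<in> U \<Longrightarrow> \<sigma> p = f p *\<^sub>R \<xi> p"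
  shows "sigma_metric T \<sigma> X Y p = (f p * lam p)\<^sup>2 * g p (X p) (Y p)"
  by (simp only: sigma_metric_def beta_coset[OF assms(1,2,3,5-7)] beta_coset[OF assms(1,2,4-7)])
    (subst quot_metric_coset, simp_all add: gt_simps gt_dF power2_eq_square)

text \<open>The curvature on the quotient is well defined: a lift differs from the tangential one by
  a smooth multiple of \<open>\<xi>\<close>, whose curvature stays in the line by condition
  (i).\<close>

lemma R_lift:
  assumes om: "\<And>v. lam p * \<omega> p v = differential \<A> lam p v"
    and U: "open U" "p \<in> U" and V: "V \<in> VF U" and X: "X \<in> VF U" and Y: "Y \<in> VF U"
    and \<phi>: "smooth_fun \<A> U \<phi>" and s: "s \<in> FA U" "\<And>q. q \<in> U \<Longrightarrow> s q \<in> coset q (\<phi> q *\<^sub>R dF q (Y q))"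
  shows "R V X s p \<in> coset p (\<phi> p *\<^sub>R R V X (\<lambda>q. dF q (Y q)) p)"
proof -
  let ?k = "\<lambda>q. (-1) * gt (\<Psi> q) (s q) (\<eta> q)"
  have k: "smooth_fun \<A> U ?k"
    by (intro smooth_fun_mult[OF A U(1) smooth_fun_const] smooth_gt[OF U(1) s(1) eta_along])
  have s': "s q = \<phi> q *\<^sub>R dF q (Y q) + ?k q *\<^sub>R \<xi> q" if "q \<in> U" for q
    using s(2)[OF that] by (auto simp: gt_simps)
  note dY = FA_dF[OF U(1) Y]
  note 1 = FA_scaleR[OF U(1) \<phi> dY] and 2 = FA_scaleR[OF U(1) k xi_along]
  have "R V X s p = \<phi> p *\<^sub>R R V X (\<lambda>q. dF q (Y q)) p + R V X (\<lambda>q. ?k q *\<^sub>R \<xi> q) p"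
    using R_cong[OF U V X s(1) FA_add[OF U(1) 1 2] s'] R_add[OF U V X 1 2] R_scaleR[OF U V X dY \<phi>] by simp
  moreover obtain c where "R V X (\<lambda>q. ?k q *\<^sub>R \<xi> q) p = c *\<^sub>R \<xi> p"
    using R_line[OF om U V X k] by blast
  ultimately show ?thesis unfolding mem_coset by auto
qed

text \<open>\<open>quot_curvature\<close> collects the results of all local lifts. They all fall
  into one coset, and the whole coset is attained because at least one lift exists.\<close>

lemma quot_curvature_coset:
  assumes om: "\<And>v. lam p * \<omega> p v = differential \<A> lam p v"
    and U: "open U" "p \<in> U" and V: "V \<in> VF U" and X: "X \<in> VF UNIV" and Y: "Y \<in> VF UNIV"
    and f: "smooth_fun \<A> U f" and \<sigma>: "\<sigma> \<in> FA U" "\<And>p. p \<in> U \<Longrightarrow> \<sigma> p = f p *\<^sub>R \<xi> p"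
  shows "quot_curvature \<A> T V X (beta T \<sigma> Y) p
    = coset p ((- (f p * lam p)) *\<^sub>R R V X (\<lambda>q. dF q (Y q)) p)" (is "?Q = coset p ?r")
proof -
  let ?\<phi> = "\<lambda>q. - (f q * lam q)"
  have \<phi>: "smooth_fun \<A> U ?\<phi>"
    using smooth_fun_bounded_linear[OF A bounded_linear_minus[OF bounded_linear_ident] U(1)
        smooth_fun_mult[OF A U(1) f lam_smooth]] .
  note b = beta_coset[OF U(1) _ VF_UNIV[OF Y] f \<sigma>]
  have lift: "R V X s p \<in> coset p ?r"
    if W: "open W" "p \<in> W" "s \<in> FA W" "\<And>q. q \<in> W \<Longrightarrow> s q \<in> beta T \<sigma> Y q" for W s
  proof (rule R_lift[OF om])
    show "open (U \<inter> W)" "p \<in> U \<inter> W" using U W by auto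
    show "V \<in> VF (U \<inter> W)" by (rule vector_fields_subset[OF A V]) auto
    show "smooth_fun \<A> (U \<inter> W) ?\<phi>" by (rule smooth_fun_subset[OF \<phi>]) auto
    show "s \<in> FA (U \<inter> W)" by (rule FA_subset[OF W(3)]) auto
    show "s q \<in> coset q (?\<phi> q *\<^sub>R dF q (Y q))" if "q \<in> U \<inter> W" for q
      using W(4)[of q] b[of q] that by simp
  qed (rule VF_UNIV[OF X] VF_UNIV[OF Y])+
  show ?thesis
  proof (intro set_eqI iffI)
    fix x assume "x \<in> ?Q"
    then obtain s k W where W: "open W" "p \<in> W" "s \<in> FA W" "\<And>q. q \<in> W \<Longrightarrow> s q \<in> beta T \<sigma> Y q"
      and x: "x = R V X s p + k *\<^sub>R \<xi> p"
      unfolding quot_curvature_def T_simps by blast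
    obtain l where "R V X s p = ?r + l *\<^sub>R \<xi> p" using lift[OF W] unfolding mem_coset by blast
    then have "x = ?r + (l + k) *\<^sub>R \<xi> p" using x by (simp add: algebra_simps)
    then show "x \<in> coset p ?r" by blast
  next
    fix x assume "x \<in> coset p ?r"
    then obtain k where k: "x = ?r + k *\<^sub>R \<xi> p" by blast
    \<comment> \<open>The representative from which \<open>beta\<close> is built is itself a smooth
      lift.\<close>
    let ?s = "D Y \<sigma>"
    have s: "?s \<in> FA U" by (rule D_closed[OF U(1) VF_UNIV[OF Y] \<sigma>(1)])
    have sb: "?s q \<in> beta T \<sigma> Y q" if "q \<in> U" for q
      unfolding beta_def T_simps mem_coset by (rule exI[of _ 0]) simp
    obtain l where l: "R V X ?s p = ?r + l *\<^sub>R \<xi> p"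
      using lift[OF U s sb] unfolding mem_coset by blast
    have "x = R V X ?s p + (k - l) *\<^sub>R \<xi> p"
      unfolding l k by (simp add: algebra_simps)
    then show "x \<in> ?Q"
      unfolding quot_curvature_def T_simps using U s sb by blast
  qed
qed

section \<open>Evaluation of the trace in condition (ii)\<close>

lemma nonzero_coefficient:
  assumes "\<sigma> p = f p *\<^sub>R \<xi> p" "\<sigma> p \<noteq> 0"
  shows "f p * lam p \<noteq> 0"
  using assms lam(2)[rule_format, of p] by auto

text \<open>The metric of \<sigma> is \<open>(f q * lam q)^2\<close> times \<open>g\<close>, so a
  \<open>g\<close>-orthonormal frame only has to be rescaled. Using the power -1/2 of the square
  keeps the factor positive and smooth for either sign of \<open>f\<close>.\<close>

lemma sigma_frame_exists:
  assumes U: "open U" "p \<in> U" and f: "smooth_fun \<A> U f"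
    and \<sigma>: "\<sigma> \<in> FA U" "\<And>p. p \<in> U \<Longrightarrow> \<sigma> p = f p *\<^sub>R \<xi> p" "\<And>p. p \<in> U \<Longrightarrow> \<sigma> p \<noteq> 0"
  shows "\<exists>U E. open U \<and> p \<in> U \<and> orthonormal_frame \<A> (sigma_metric T \<sigma>) U E"
proof -
  obtain W E where W: "open W" "p \<in> W" and E: "orthonormal_frame \<A> (on_fields g) W E"
    using orthonormal_frame_exists[OF A riemannian] by blast
  let ?U = "U \<inter> W" and ?r = "\<lambda>q. ((f q * lam q) * (f q * lam q)) powr (- 1 / 2)"
  have U': "open ?U" "p \<in> ?U" using U W by auto
  have f': "smooth_fun \<A> ?U f" by (rule smooth_fun_subset[OF f]) auto
  have pos: "(f q * lam q) * (f q * lam q) > 0" if "q \<in> ?U" for q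
    using nonzero_coefficient[of \<sigma> q f] \<sigma>(2,3)[of q] not_real_square_gt_zero[of "f q * lam q"] that
    by blast
  have r: "smooth_fun \<A> ?U ?r"
    by (rule smooth_fun_compose[OF A U'(1) open_greaterThan _ smooth_on_powr
          smooth_fun_mult[OF A U'(1) smooth_fun_mult[OF A U'(1) f' lam_smooth]
            smooth_fun_mult[OF A U'(1) f' lam_smooth]]])
      (use pos in auto)
  let ?E = "\<lambda>i q. ?r q *\<^sub>R E i q"
  have E1: "?E i \<in> VF ?U" if "i < DIM('e)" for i
  proof -
    have "E i \<in> VF W" using E that by (simp add: orthonormal_frame_def)
    from vector_fields_subset[OF A this] show ?thesis
      by (rule vector_fields_scaleR[OF A U'(1) r]) simp
  qed
  have "sigma_metric T \<sigma> (?E i) (?E j) q = (if i = j then 1 else 0)"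
    if q: "q \<in> ?U" and ij: "i < DIM('e)" "j < DIM('e)" for q i j
  proof -
    have "sigma_metric T \<sigma> (?E i) (?E j) q = (f q * lam q)\<^sup>2 * g q (?E i q) (?E j q)"
      by (rule sigma_metric_eq[OF U'(1) q E1[OF ij(1)] E1[OF ij(2)] f' FA_subset[OF \<sigma>(1)] \<sigma>(2)]) auto
    also have "\<dots> = ((f q * lam q) * (f q * lam q)) * (?r q * ?r q) * g q (E i q) (E j q)"
      by (simp add: g_simps power2_eq_square)
    also have "?r q * ?r q = 1 / ((f q * lam q) * (f q * lam q))"
      using pos[OF q] by (simp add: powr_add[symmetric] powr_minus inverse_eq_divide)
    finally show ?thesis
      using E ij q pos[OF q] by (auto simp: orthonormal_frame_def on_fields_def)
  qed
  then show ?thesis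
    using U' E1 by (intro exI[of _ ?U] exI[of _ ?E]) (simp add: orthonormal_frame_def)
qed

lemma normality_trace:
  assumes om: "\<And>p v. lam p * \<omega> p v = differential \<A> lam p v"
    and U: "open U" "p \<in> U" and X: "X \<in> VF UNIV" and Y: "Y \<in> VF UNIV"
    and \<sigma>: "\<sigma> \<in> line_sections T U" "\<forall>p\<in>U. \<sigma> p \<noteq> 0"
    and e: "\<And>i j. i < DIM('e) \<Longrightarrow> j < DIM('e) \<Longrightarrow> g p (e i) (e j) = (if i = j then 1 else 0)"
  shows "frame_trace \<A> (sigma_metric T \<sigma>)
      (\<lambda>V W q. quot_metric T q (quot_curvature \<A> T V X (beta T \<sigma> Y) q) (beta T \<sigma> W q)) p =
    ricci \<A> g nab X Y p + lam p * (\<Sum>i<DIM('e). eta_form p (e i) (e i)) * g p (X p) (Y p)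
      + (real DIM('e) - 2) * lam p * eta_form p (X p) (Y p)"
proof -
  obtain f where f: "smooth_fun \<A> U f" "\<And>p. p \<in> U \<Longrightarrow> \<sigma> p = f p *\<^sub>R \<xi> p"
    using line_section_coefficient[OF U(1) \<sigma>(1)] by blast
  have \<sigma>': "\<sigma> \<in> FA U" using \<sigma>(1) by (simp add: line_sections_iff)
  let ?c = "f p * lam p" and ?n = "DIM('e)"
  have c: "?c \<noteq> 0" by (rule nonzero_coefficient) (use f(2)[OF U(2)] \<sigma>(2) U(2) in auto)
  let ?dY = "\<lambda>q. dF q (Y q)"
  have dY: "?dY \<in> FA UNIV" by (rule FA_dF[OF open_UNIV Y])
  obtain L where L: "linear L" "\<And>U V. open U \<Longrightarrow> p \<in> U \<Longrightarrow> V \<in> VF U \<Longrightarrow> R V X ?dY p = L (V p)"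
    using R_pointwise[OF open_UNIV UNIV_I X dY, of p] by auto
  \<comment> \<open>\<open>?K\<close> is the ambient curvature restricted to tangent vectors and
    \<open>?Q\<close> the extrinsic part of the Gauss equation; their difference is the intrinsic
    curvature traced by \<open>ricci\<close>.\<close>
  let ?K = "\<lambda>v w. gt (\<Psi> p) (L v) (dF p w)"
  let ?Q = "\<lambda>v w. lam p * (g p (X p) (Y p) * eta_form p v w + eta_form p (X p) (Y p) * g p v w
      - g p v (Y p) * eta_form p (X p) w - eta_form p v (Y p) * g p (X p) w)"
  note eta_simps = bilinear_ladd[OF eta_form_bilinear] bilinear_radd[OF eta_form_bilinear]
    bilinear_lmul[OF eta_form_bilinear] bilinear_rmul[OF eta_form_bilinear]
  have K: "bilinear (\<lambda>v w. r * ?K v w)" for r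
    unfolding bilinear_def
    by (auto intro!: linearI simp: gt_simps dF_simps linear_add[OF L(1)] linear_cmul[OF L(1)] algebra_simps)
  have KQ: "bilinear (\<lambda>v w. ?K v w - ?Q v w)"
    unfolding bilinear_def
    by (auto intro!: linearI simp: gt_simps dF_simps g_simps eta_simps linear_add[OF L(1)] linear_cmul[OF L(1)] algebra_simps)
  have ricci: "ricci \<A> g nab X Y p = (\<Sum>i<?n. ?K (e i) (e i) - ?Q (e i) (e i))"
    unfolding ricci_def
  proof (rule frame_trace_eq[OF orthonormal_frame_exists[OF A riemannian] g_bilinear g_sym KQ e])
    fix U V W assume U: "open U" "p \<in> U" and V: "V \<in> VF U" and W: "W \<in> VF U"
    show "g p (curvature \<A> nab V X Y p) (W p) = ?K (V p) (W p) - ?Q (V p) (W p)"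
      using gt_R_tangential[OF U V VF_UNIV[OF X] VF_UNIV[OF Y], of "W p"] L(2)[OF U V] by simp
  qed (auto simp: on_fields_def)
  \<comment> \<open>In the trace the factor \<open>g p v w\<close> contributes \<open>n\<close>,
    while each of the last two summands contributes one \<open>eta_form p (X p) (Y p)\<close>; this
    is the origin of \<open>n - 2\<close>.\<close>
  have Q: "(\<Sum>i<?n. ?Q (e i) (e i)) = lam p * (\<Sum>i<?n. eta_form p (e i) (e i)) * g p (X p) (Y p)
      + (real ?n - 2) * lam p * eta_form p (X p) (Y p)"
  proof -
    have 1: "(\<Sum>i<?n. g p (e i) (Y p) * eta_form p (X p) (e i)) = eta_form p (X p) (Y p)"
    proof -
      have "eta_form p (X p) (Y p) = eta_form p (X p) (\<Sum>i<?n. g p (Y p) (e i) *\<^sub>R e i)"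
        using g_expansion[OF e, of "Y p"] by simp
      then show ?thesis
        using g_sym[of p "Y p"]
        by (simp add: bilinear_sum_right[OF eta_form_bilinear] eta_simps)
    qed
    have 2: "(\<Sum>i<?n. eta_form p (e i) (Y p) * g p (X p) (e i)) = eta_form p (X p) (Y p)"
    proof -
      have "eta_form p (X p) (Y p) = eta_form p (\<Sum>i<?n. g p (X p) (e i) *\<^sub>R e i) (Y p)"
        using g_expansion[OF e, of "X p"] by simp
      then show ?thesis
        by (simp add: bilinear_sum_left[OF eta_form_bilinear] eta_simps mult.commute)
    qed
    have "(\<Sum>i<?n. ?Q (e i) (e i)) = lam p * (g p (X p) (Y p) * (\<Sum>i<?n. eta_form p (e i) (e i))
        + eta_form p (X p) (Y p) * (\<Sum>i<?n. g p (e i) (e i))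
        - (\<Sum>i<?n. g p (e i) (Y p) * eta_form p (X p) (e i))
        - (\<Sum>i<?n. eta_form p (e i) (Y p) * g p (X p) (e i)))"
      by (simp only: sum_distrib_left[symmetric] sum.distrib sum_subtractf)
    also have "(\<Sum>i<?n. g p (e i) (e i)) = real ?n" using e by simp
    finally show ?thesis unfolding 1 2 by (simp add: algebra_simps)
  qed
  \<comment> \<open>Both \<open>beta\<close> factors carry \<open>- ?c\<close>, which gives the
    square, and \<open>e i\<close> divided by \<open>?c\<close> is orthonormal for the metric of
    \<sigma>. The two scalings cancel, so the trace does not depend on \<sigma>.\<close>
  have "frame_trace \<A> (sigma_metric T \<sigma>)
      (\<lambda>V W q. quot_metric T q (quot_curvature \<A> T V X (beta T \<sigma> Y) q) (beta T \<sigma> W q)) p =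
    (\<Sum>i<?n. ?c\<^sup>2 * ?K ((1 / ?c) *\<^sub>R e i) ((1 / ?c) *\<^sub>R e i))"
  proof (rule frame_trace_eq[OF sigma_frame_exists[OF U f(1) \<sigma>' f(2)] _ _ K, where h = "\<lambda>v w. ?c\<^sup>2 * g p v w"])
    show "\<sigma> p \<noteq> 0" if "p \<in> U" for p using \<sigma>(2) that by blast
    show "bilinear (\<lambda>v w. ?c\<^sup>2 * g p v w)"
      unfolding bilinear_def by (auto intro!: linearI simp: g_simps algebra_simps)
    show "?c\<^sup>2 * g p v w = ?c\<^sup>2 * g p w v" for v w by (simp add: g_sym)
    show "?c\<^sup>2 * g p ((1 / ?c) *\<^sub>R e i) ((1 / ?c) *\<^sub>R e j) = (if i = j then 1 else 0)"
      if "i < ?n" "j < ?n" for i j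
      using e[OF that] c by (simp add: g_simps power2_eq_square)
    fix U' V W assume U': "open U'" "p \<in> U'" and V: "V \<in> VF U'" and W: "W \<in> VF U'"
    have UU: "open (U \<inter> U')" "p \<in> U \<inter> U'" using U U' by auto
    have V': "V \<in> VF (U \<inter> U')" and W': "W \<in> VF (U \<inter> U')"
      by (rule vector_fields_subset[OF A V], blast) (rule vector_fields_subset[OF A W], blast)
    have f': "smooth_fun \<A> (U \<inter> U') f" by (rule smooth_fun_subset[OF f(1)]) auto
    have \<sigma>'': "\<sigma> \<in> FA (U \<inter> U')" by (rule FA_subset[OF \<sigma>']) auto
    have f2: "\<sigma> p = f p *\<^sub>R \<xi> p" if "p \<in> U \<inter> U'" for p using f(2) that by blast
    show "sigma_metric T \<sigma> V W p = ?c\<^sup>2 * g p (V p) (W p)"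
      by (rule sigma_metric_eq[OF UU V' W' f' \<sigma>'' f2])
    have q: "quot_curvature \<A> T V X (beta T \<sigma> Y) p = coset p ((- ?c) *\<^sub>R R V X ?dY p)"
      by (rule quot_curvature_coset[OF om UU V' X Y f' \<sigma>'' f2])
    have b: "beta T \<sigma> W p = coset p ((- ?c) *\<^sub>R dF p (W p))"
      by (rule beta_coset[OF UU W' f' \<sigma>'' f2])
    \<comment> \<open>By skewness the product moves onto \<open>R V X \<xi>\<close>, which lies in
      the line and is orthogonal to tangent vectors. This is what \<open>quot_metric_coset\<close>
      requires.\<close>
    have "gt (\<Psi> p) (R V X ?dY p) (\<xi> p) = 0"
    proof -
      obtain k where "R V X \<xi> p = k *\<^sub>R \<xi> p"
        using R_xi_line[OF om UU V' VF_UNIV[OF X]] by blast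
      then show ?thesis
        using R_skew[OF UU V' VF_UNIV[OF X] FA_UNIV[OF dY] xi_along] by (simp add: gt_simps)
    qed
    then have "quot_metric T p (quot_curvature \<A> T V X (beta T \<sigma> Y) p) (beta T \<sigma> W p) =
        gt (\<Psi> p) ((- ?c) *\<^sub>R R V X ?dY p) ((- ?c) *\<^sub>R dF p (W p))"
      by (simp only: q b) (rule quot_metric_coset, simp_all add: gt_simps)
    then show "quot_metric T p (quot_curvature \<A> T V X (beta T \<sigma> Y) p) (beta T \<sigma> W p) =
        ?c\<^sup>2 * ?K (V p) (W p)"
      using L(2)[OF U' V] by (simp add: gt_simps power2_eq_square)
  qed
  also have "\<dots> = (\<Sum>i<?n. ?K (e i) (e i))"
    using c by (intro sum.cong refl) (simp add: linear_cmul[OF L(1)] dF_simps gt_simps power2_eq_square)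
  also have "\<dots> = ricci \<A> g nab X Y p + (\<Sum>i<?n. ?Q (e i) (e i))"
    unfolding ricci by (simp only: sum_subtractf)
  finally show ?thesis unfolding Q by simp
qed

text \<open>In the null pair only the cross term of \<open>H\<close> with itself survives, twice;
  this 2 and the divisor \<open>n\<close> in the \<open>\<xi>\<close> coefficient are undone by the
  factor \<open>n / 2\<close>.\<close>

lemma mean_curvature_terms:
  assumes e: "\<And>i j. i < DIM('e) \<Longrightarrow> j < DIM('e) \<Longrightarrow> g p (e i) (e j) = (if i = j then 1 else 0)"
  defines "H \<equiv> mean_curvature \<A> \<B> gt \<Psi> D nab p"
  shows "gt (\<Psi> p) H (\<xi> p) = lam p"
    and "real DIM('e) / 2 * gt (\<Psi> p) H H = - lam p * (\<Sum>i<DIM('e). eta_form p (e i) (e i))"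
  by (simp_all add: H_def mean_curvature_eq[OF e] gt_simps)

text \<open>Condition (i) is the equation for \<open>\<omega>\<close>, a conjunct of both sides.
  Under it the trace in (ii) is the Ricci tensor minus its prescribed value, so the remaining
  conjuncts agree as well.\<close>

lemma normality_iff:
  assumes dim: "DIM('e) \<ge> 2"
  defines "H \<equiv> mean_curvature \<A> \<B> gt \<Psi> D nab"
  shows "normal_tractor_connection \<A> T \<longleftrightarrow>
     \<omega> = (\<lambda>p v. (1 / lam p) * differential \<A> lam p v) \<and>
     (\<forall>X\<in>VF UNIV. \<forall>Y\<in>VF UNIV. \<forall>p. ricci \<A> g nab X Y p =
        real DIM('e) / 2 * gt (\<Psi> p) (H p) (H p) * g p (X p) (Y p)
        - (real DIM('e) - 2) * gt (\<Psi> p) (H p) (\<xi> p) * g p (X p) (shape_operator \<A> \<B> gt \<Psi> D \<eta> Y p))"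
    (is "_ \<longleftrightarrow> ?om \<and> ?ric")
proof -
  let ?n = "DIM('e)"
  have "lam p \<noteq> 0" for p using lam(2)[rule_format, of p] by simp
  then have om: "?om \<longleftrightarrow> (\<forall>p v. lam p * \<omega> p v = differential \<A> lam p v)"
    by (auto simp: fun_eq_iff field_simps)
  let ?tr = "\<lambda>\<sigma> X Y p. frame_trace \<A> (sigma_metric T \<sigma>)
      (\<lambda>V W q. quot_metric T q (quot_curvature \<A> T V X (beta T \<sigma> Y) q) (beta T \<sigma> W q)) p"
  let ?eq = "\<lambda>X Y p. ricci \<A> g nab X Y p =
        real ?n / 2 * gt (\<Psi> p) (H p) (H p) * g p (X p) (Y p)
        - (real ?n - 2) * gt (\<Psi> p) (H p) (\<xi> p) * g p (X p) (shape_operator \<A> \<B> gt \<Psi> D \<eta> Y p)"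
  \<comment> \<open>Symmetry of \<open>eta_form\<close> lets the shape operator act on
    \<open>Y\<close> although the trace formula has it on \<open>X\<close>.\<close>
  have tr: "?tr \<sigma> X Y p = 0 \<longleftrightarrow> ?eq X Y p"
    if ?om and U: "open U" "p \<in> U" and X: "X \<in> VF UNIV" and Y: "Y \<in> VF UNIV"
      and \<sigma>: "\<sigma> \<in> line_sections T U" "\<forall>p\<in>U. \<sigma> p \<noteq> 0" for U p X Y \<sigma>
  proof -
    obtain e where e: "\<And>i j. i < ?n \<Longrightarrow> j < ?n \<Longrightarrow> g p (e i) (e j) = (if i = j then 1 else 0)"
      using orthonormal_basis_exists[of p] by blast
    have "?tr \<sigma> X Y p = ricci \<A> g nab X Y p + lam p * (\<Sum>i<?n. eta_form p (e i) (e i)) * g p (X p) (Y p)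
      + (real ?n - 2) * lam p * eta_form p (X p) (Y p)"
      using \<open>?om\<close> unfolding om by (intro normality_trace[OF _ U X Y \<sigma> e]) auto
    moreover have "g p (X p) (shape_operator \<A> \<B> gt \<Psi> D \<eta> Y p) = eta_form p (X p) (Y p)"
      using g_shape_eta[OF Y] eta_form_sym by simp
    moreover note mean_curvature_terms[OF e]
    ultimately show ?thesis
      unfolding H_def by (simp only:) (rule iffI; linarith)
  qed
  have xi: "\<xi> \<in> line_sections T UNIV" "\<forall>p\<in>UNIV. \<xi> p \<noteq> 0"
    using xi_along xi_nonzero by (auto simp: line_sections_iff intro!: exI[of _ 1])
  have N: "normal_tractor_connection \<A> T \<longleftrightarrow> ?om \<and>
    (\<forall>X\<in>VF UNIV. \<forall>Y\<in>VF UNIV. \<forall>U. open U \<longrightarrow> (\<forall>\<sigma>\<in>line_sections T U. (\<forall>p\<in>U. \<sigma> p \<noteq> 0) \<longrightarrow>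
          (\<forall>p\<in>U. ?tr \<sigma> X Y p = 0)))" (is "_ \<longleftrightarrow> ?om \<and> ?norm")
    unfolding normal_tractor_connection_def om T_simps R_line_sections_iff[OF dim] ..
  have "?norm \<longleftrightarrow> ?ric" if om: ?om
  proof
    assume n: ?norm
    show ?ric
    proof (intro ballI allI)
      fix X Y p assume X: "X \<in> VF UNIV" and Y: "Y \<in> VF UNIV"
      \<comment> \<open>Normality gives the trace for every local \<sigma>; the global section
        \<open>\<xi>\<close> is enough to reach every point.\<close>
      have "?tr \<xi> X Y p = 0"
        by (rule n[rule_format, OF X Y open_UNIV xi(1)]) (use xi in auto)
      then show "?eq X Y p" unfolding tr[OF om open_UNIV UNIV_I X Y xi] .
    qed
  next
    assume r: ?ric
    show ?norm
    proof (intro ballI allI impI)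
      fix X Y U \<sigma> p assume X: "X \<in> VF UNIV" and Y: "Y \<in> VF UNIV" and U: "open U" "p \<in> U"
        and \<sigma>: "\<sigma> \<in> line_sections T U" "\<forall>p\<in>U. \<sigma> p \<noteq> 0"
      show "?tr \<sigma> X Y p = 0" unfolding tr[OF om U X Y \<sigma>] using r X Y by blast
    qed
  qed
  then show ?thesis unfolding N by (rule conj_cong[OF refl])
qed

end

theorem corollary3p6:
  fixes \<A> :: "('m::{t2_space,second_countable_topology}, 'e::euclidean_space) chart set"
    and \<B> :: "('w::{t2_space,second_countable_topology}, 'f::euclidean_space) chart set"
    and gt :: "'w \<Rightarrow> 'f \<Rightarrow> 'f \<Rightarrow> real"
    and \<Psi> :: "'m \<Rightarrow> 'w"
    and g :: "'m \<Rightarrow> 'e \<Rightarrow> 'e \<Rightarrow> real"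
    and nabt :: "('w \<Rightarrow> 'f) \<Rightarrow> ('w \<Rightarrow> 'f) \<Rightarrow> ('w \<Rightarrow> 'f)"
    and D :: "('m \<Rightarrow> 'e) \<Rightarrow> ('m \<Rightarrow> 'f) \<Rightarrow> ('m \<Rightarrow> 'f)"
    and nab :: "('m \<Rightarrow> 'e) \<Rightarrow> ('m \<Rightarrow> 'e) \<Rightarrow> ('m \<Rightarrow> 'e)"
    and \<xi> \<eta> H :: "'m \<Rightarrow> 'f"
    and lam :: "'m \<Rightarrow> real"
    and \<omega> :: "'m \<Rightarrow> 'e \<Rightarrow> real"
    and n :: nat
  assumes M: "smooth_atlas \<A>" "connected (UNIV :: 'm set)" "DIM('e) = n" "n \<ge> 2"
    and Mt: "smooth_atlas \<B>" "DIM('f) = n + 2" "lorentzian_metric \<B> gt"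
    and immersion: "spacelike_immersion \<A> \<B> gt \<Psi>"
    and g: "g = pullback_metric \<A> \<B> \<Psi> gt"
    and nabt: "levi_civita \<B> gt nabt"
    and D: "pullback_connection \<A> \<B> \<Psi> nabt D"
    and nab: "levi_civita \<A> g nab"
    and xi: "\<xi> \<in> normal_fields \<A> \<B> gt \<Psi>" "lightlike gt \<Psi> \<xi>"
    and lam: "smooth_fun \<A> UNIV lam" "\<forall>p. lam p > 0"
    and umbilical: "\<forall>X\<in>vector_fields \<A> UNIV. \<forall>p.
          shape_operator \<A> \<B> gt \<Psi> D \<xi> X p = lam p *\<^sub>R X p"
    and eta: "\<eta> \<in> normal_fields \<A> \<B> gt \<Psi>" "lightlike gt \<Psi> \<eta>"
          "\<forall>p. gt (\<Psi> p) (\<xi> p) (\<eta> p) = -1"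
    and omega: "one_form \<A> \<omega>"
          "\<forall>X\<in>vector_fields \<A> UNIV. \<forall>p.
             normal_connection \<A> \<B> gt \<Psi> D X \<xi> p = \<omega> p (X p) *\<^sub>R \<xi> p"
    and H: "H = mean_curvature \<A> \<B> gt \<Psi> D nab"
  shows "normal_tractor_connection \<A> (associated_tractor \<A> \<B> gt \<Psi> D \<xi>) \<longleftrightarrow>
           \<omega> = (\<lambda>p v. (1 / lam p) * differential \<A> lam p v) \<and>
           (\<forall>X\<in>vector_fields \<A> UNIV. \<forall>Y\<in>vector_fields \<A> UNIV. \<forall>p.
              ricci \<A> g nab X Y p =
                real n / 2 * gt (\<Psi> p) (H p) (H p) * g p (X p) (Y p)
                - (real n - 2) * gt (\<Psi> p) (H p) (\<xi> p) *
                    g p (X p) (shape_operator \<A> \<B> gt \<Psi> D \<eta> Y p))"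
proof -
  interpret umbilical_immersion \<A> \<B> \<Psi> gt nabt D g nab \<xi> \<eta> lam \<omega>
  proof
    show "smooth_map \<A> \<B> \<Psi>" using immersion by (simp add: spacelike_immersion_def)
    show "symmetric_2tensor \<B> gt" using Mt(3) by (simp add: lorentzian_metric_def)
    show "DIM('f) = DIM('e) + 2" using M(3) Mt(2) by simp
  qed (fact M(1) Mt(1) nabt D immersion g nab xi lam umbilical eta omega)+
  have "DIM('e) \<ge> 2" using M(3,4) by simp
  from normality_iff[OF this] show ?thesis
    unfolding H M(3)[symmetric] .
qed

end
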